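(* Fix $a\in(0,1/2)$ and $\lambda>0$. Consider the polymer dynamics restricted to the pinned set $\check{\mathcal S}^a_N$, i.e. the continuous-time Markov chain on $\check{\mathcal S}^a_N$ with generator $\mathcal L_1f(\eta)=\sum_{\eta'\in\check{\mathcal S}^a_N}r^\lambda(\eta,\eta')(f(\eta')-f(\eta))$ (all transitions leaving $\check{\mathcal S}^a_N$ suppressed), which is reversible with respect to $\pi^{\lambda,a}_N(\cdot\mid\check{\mathcal S}^a_N)$, and let ${\rm gap}_1$ be its spectral gap. Then there exists $c(a,\lambda)>0$ such that ${\rm gap}_1\ge c(a,\lambda)N^{-12}$ for every even $N\ge1$ for which $\check{\mathcal S}^a_N\neq\emptyset$.
   Context: $\langle s\rangle$ is the smallest even integer $\ge s$. For $N$ even, $\mathcal S^a_N$ is the set of $\eta=(\eta_x)_{x\in\{0,\dots,N\}}$ with values in $\mathbb Z_{\ge0}$, $\eta_0=\eta_N=\langle aN\rangle$, $|\eta_{x+1}-\eta_x|=1$; $H(\eta)=\#\{x:\eta_x=0\}$; $\pi^{\lambda,a}_N(\eta)\propto\lambda^{H(\eta)}$; $\check{\mathcal S}^a_N=\{\eta\in\mathcal S^a_N:\exists x,\ \eta_x=0\}$. For $x\in\{1,\dots,N-1\}$, $\eta^x$ replaces $\eta_x$ by $\eta_{x+1}+\eta_{x-1}-\eta_x$. The rates are $r^\lambda(\eta,\eta^x)=\frac12$ if $\eta_x>0$ and $\eta^x_x>0$; $\frac{\lambda}{\lambda+1}$ if $\eta_{x\pm1}=1,\eta_x=2$; $\frac1{\lambda+1}$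 if $\eta_x=0$; $0$ if $\eta_{x\pm1}=0$; and $r^\lambda(\eta,\eta')=0$ if $\eta'$ is not of the form $\eta^x$. *)

theory Defs
  imports Complex_Main "HOL-Library.Extended_Real"
begin

text \<open>Configurations are maps nat => int; only the sites 0..N are relevant, and we
  normalise by requiring value 0 at sites > N so that the state space is a finite set.\<close>

type_synonym config = "nat \<Rightarrow> int"

definition even_ceil :: "real \<Rightarrow> int" where
  "even_ceil s = 2 * \<lceil>s / 2\<rceil>"

definition S_space :: "real \<Rightarrow> nat \<Rightarrow> config set" where
  "S_space a N = {\<eta>. (\<forall>x. N < x \<longrightarrow> \<eta> x = 0) \<and> (\<forall>x\<le>N. 0 \<le> \<eta> x)
      \<and> \<eta> 0 = even_ceil (a * real N) \<and> \<eta> N = even_ceil (a * real N)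
      \<and> (\<forall>x<N. \<bar>\<eta> (x+1) - \<eta> x\<bar> = 1)}"

definition H :: "nat \<Rightarrow> config \<Rightarrow> nat" where
  "H N \<eta> = card {x \<in> {0..N}. \<eta> x = 0}"

definition S_pinned :: "real \<Rightarrow> nat \<Rightarrow> config set" where
  "S_pinned a N = {\<eta> \<in> S_space a N. \<exists>x\<le>N. \<eta> x = 0}"

definition flip :: "config \<Rightarrow> nat \<Rightarrow> config" where
  "flip \<eta> x = \<eta>(x := \<eta> (x+1) + \<eta> (x-1) - \<eta> x)"

definition site_rate :: "real \<Rightarrow> config \<Rightarrow> nat \<Rightarrow> real" where
  "site_rate lam \<eta> x =
     (if 0 < \<eta> x \<and> 0 < flip \<eta> x x then 1/2
      else if \<eta> (x-1) = 1 \<and> \<eta> (x+1) = 1 \<and> \<eta> x = 2 then lam / (lam + 1)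
      else if \<eta> x = 0 then 1 / (lam + 1)
      else 0)"

text \<open>r^lambda(eta, eta'): nonzero only if eta' = eta^x for some x in {1..N-1}
  (for eta' = eta the value is irrelevant: it never contributes below).\<close>
definition rate :: "real \<Rightarrow> nat \<Rightarrow> config \<Rightarrow> config \<Rightarrow> real" where
  "rate lam N \<eta> \<eta>' = (\<Sum>x\<in>{1..N-1}. if \<eta>' = flip \<eta> x then site_rate lam \<eta> x else 0)"

definition pi_pinned :: "real \<Rightarrow> real \<Rightarrow> nat \<Rightarrow> config \<Rightarrow> real" where
  "pi_pinned lam a N \<eta> =
     (if \<eta> \<in> S_pinned a N
      then lam ^ H N \<eta> / (\<Sum>\<zeta>\<in>S_pinned a N. lam ^ H N \<zeta>) else 0)"

definition dirichlet1 :: "real \<Rightarrow> real \<Rightarrow> nat \<Rightarrow> (config \<Rightarrow> real) \<Rightarrow> real" where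
  "dirichlet1 lam a N f = (1/2) * (\<Sum>\<eta>\<in>S_pinned a N. \<Sum>\<eta>'\<in>S_pinned a N.
       pi_pinned lam a N \<eta> * rate lam N \<eta> \<eta>' * (f \<eta>' - f \<eta>)^2)"

definition var1 :: "real \<Rightarrow> real \<Rightarrow> nat \<Rightarrow> (config \<Rightarrow> real) \<Rightarrow> real" where
  "var1 lam a N f = (\<Sum>\<eta>\<in>S_pinned a N. pi_pinned lam a N \<eta> *
       (f \<eta> - (\<Sum>\<zeta>\<in>S_pinned a N. pi_pinned lam a N \<zeta> * f \<zeta>))^2)"

text \<open>spectral gap (variational characterisation); Inf of the empty set is +infinity\<close>
definition gap1 :: "real \<Rightarrow> real \<Rightarrow> nat \<Rightarrow> ereal" where
  "gap1 lam a N = Inf {ereal (dirichlet1 lam a N f / var1 lam a N f) | f. var1 lam a N f \<noteq> 0}"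

end

theory Submission
  imports Defs "HOL-Analysis.Convex"
begin

text \<open>Decompose the variance along the zero set \<open>Z\<close> of the path, and then along the pair
  \<open>(min Z, max Z)\<close>.

  Given \<open>Z\<close>, the path is uniform and its excursions only see a hard wall. Single-site heat bath
  contracts the Lipschitz seminorm with weights \<open>x (N - x)\<close>, which gives a relaxation time of
  order \<open>N\<^sup>2\<close>.

  Given \<open>min Z\<close> and \<open>max Z\<close>, the set \<open>Z\<close> is a renewal set whose gap weights are Catalan numbers.
  Replacing \<open>Z\<close> by \<open>Z'\<close> from left to right defines canonical paths; since
  \<open>K i * K j\<close> and \<open>K k * K l\<close> with \<open>i + j = k + l\<close> differ by a polynomial factor only, their congestion is
  polynomial.

  Finally \<open>(min Z, max Z)\<close> has weight \<open>V l * z (r - l) * V (n - r)\<close>, where the first-passage count \<open>V\<close> is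
  log-concave up to constants (this uses that the boundary height is of order \<open>N\<close>) and \<open>z\<close> is multiplicative
  up to polynomial factors. Hence every state is joined to the mode by a lattice path along which the weight never
  drops by more than a polynomial factor. The three steps cost \<open>N\<^sup>3\<close>, \<open>N\<^sup>3\<close> and
  \<open>N\<^sup>6\<close>; the first includes a factor \<open>N\<close> for comparing toggles of \<open>Z\<close> with flips of the
  path.\<close>

section \<open>Relaxation of paths with a fixed zero set\<close>

lemma log_convex_seq_ratio_le:
  fixes b :: "nat \<Rightarrow> real"
  assumes nn: "\<And>k. 0 \<le> b k" and lc: "\<And>k. (b (Suc k))\<^sup>2 \<le> b k * b (Suc (Suc k))"
    and q: "0 < q" and bd: "\<And>k. b k \<le> C * q ^ k"
  shows "b (Suc 0) \<le> q * b 0"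
proof (rule ccontr)
  assume "\<not> ?thesis"
  then have gt: "q * b 0 < b (Suc 0)" by simp
  have b0: "0 < b 0"
  proof (rule ccontr)
    assume "\<not> 0 < b 0"
    then have "b 0 = 0" using nn[of 0] by simp
    then show False using lc[of 0] gt by simp
  qed
  define r where "r = b (Suc 0) / b 0"
  have rq: "q < r" using gt b0 by (simp add: r_def field_simps)
  have step: "0 < b k \<and> r * b k \<le> b (Suc k)" for k
  proof (induction k)
    case 0
    then show ?case using b0 by (simp add: r_def)
  next
    case (Suc k)
    have pos: "0 < b (Suc k)" using Suc rq q by (smt (verit) mult_pos_pos)
    have "(r * b k) * b (Suc k) \<le> b (Suc k) * b (Suc k)"
      using Suc pos by (intro mult_right_mono) auto
    also have "\<dots> \<le> b k * b (Suc (Suc k))" using lc[of k] by (simp add: power2_eq_square)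
    finally have "b k * (r * b (Suc k)) \<le> b k * b (Suc (Suc k))" by (simp add: ac_simps)
    then show ?case using Suc pos by simp
  qed
  have low: "r ^ k * b 0 \<le> b k" for k
  proof (induction k)
    case (Suc k)
    have "r ^ Suc k * b 0 \<le> r * b k" using Suc rq q by (simp add: mult.assoc)
    then show ?case using step[of k] by linarith
  qed simp
  have "1 < r / q" using rq q by simp
  then obtain k where k: "C / b 0 < (r / q) ^ k" using real_arch_pow by blast
  have "(r / q) ^ k * b 0 \<le> C"
    using low[of k] bd[of k] q by (simp add: power_divide field_simps)
  then show False using k b0 by (simp add: field_simps)
qed

text \<open>Decay of the iterates in any norm controls the \<open>L\<^sup>2\<close> norm of a symmetric operator, because
  \<open>k \<mapsto> \<parallel>A\<^sup>k f\<parallel>\<^sup>2\<close> is log-convex.\<close>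

lemma symmetric_operator_le_of_decay:
  fixes A :: "('a \<Rightarrow> real) \<Rightarrow> 'a \<Rightarrow> real"
  assumes sym: "\<And>f g. (\<Sum>x\<in>S. A f x * g x) = (\<Sum>x\<in>S. f x * A g x)"
    and q: "0 < q" and bd: "\<And>k. (\<Sum>x\<in>S. ((A ^^ k) f x)\<^sup>2) \<le> C * (q\<^sup>2) ^ k"
  shows "(\<Sum>x\<in>S. f x * A f x) \<le> q * (\<Sum>x\<in>S. (f x)\<^sup>2)"
proof -
  define b where "b k = (\<Sum>x\<in>S. ((A ^^ k) f x)\<^sup>2)" for k
  have nn: "0 \<le> b k" for k by (simp add: b_def sum_nonneg)
  have lc: "(b (Suc k))\<^sup>2 \<le> b k * b (Suc (Suc k))" for k
  proof -
    have "b (Suc k) = (\<Sum>x\<in>S. (A ^^ k) f x * (A ^^ Suc (Suc k)) f x)"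
      using sym[of "(A ^^ k) f" "(A ^^ Suc k) f"] by (simp add: b_def power2_eq_square)
    then show ?thesis using Cauchy_Schwarz_ineq_sum by (simp add: b_def)
  qed
  have "b (Suc 0) \<le> q\<^sup>2 * b 0"
    by (rule log_convex_seq_ratio_le[where b = b, OF nn lc]) (use q bd in \<open>auto simp: b_def\<close>)
  moreover have "(\<Sum>x\<in>S. f x * A f x)\<^sup>2 \<le> b 0 * b (Suc 0)"
    using Cauchy_Schwarz_ineq_sum[of f "A f" S] by (simp add: b_def)
  ultimately have "(\<Sum>x\<in>S. f x * A f x)\<^sup>2 \<le> b 0 * (q\<^sup>2 * b 0)"
    using mult_left_mono[OF _ nn[of 0]] by (meson order_trans)
  also have "\<dots> = (q * b 0)\<^sup>2" by (simp add: power2_eq_square)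
  finally have "(\<Sum>x\<in>S. f x * A f x) \<le> q * b 0"
    using q nn[of 0] by (auto intro: power2_le_imp_le[rotated])
  then show ?thesis by (simp add: b_def)
qed

definition paths :: "nat \<Rightarrow> int \<Rightarrow> nat \<Rightarrow> int \<Rightarrow> nat set \<Rightarrow> config set" where
  "paths s \<alpha> t \<beta> A = {\<eta>. (\<forall>x. x < s \<or> t < x \<longrightarrow> \<eta> x = 0) \<and> (\<forall>x. s \<le> x \<and> x \<le> t \<longrightarrow> 0 \<le> \<eta> x)
     \<and> \<eta> s = \<alpha> \<and> \<eta> t = \<beta> \<and> (\<forall>x. s \<le> x \<and> x < t \<longrightarrow> \<bar>\<eta> (x + 1) - \<eta> x\<bar> = 1)
     \<and> {x. s < x \<and> x < t \<and> \<eta> x = 0} = A}"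

lemma paths_upper_bound:
  assumes "\<eta> \<in> paths s \<alpha> t \<beta> A" "s \<le> x" "x \<le> t"
  shows "\<eta> x \<le> \<alpha> + int (x - s)"
  using assms(2,3)
proof (induction x rule: dec_induct)
  case base
  then show ?case using assms(1) by (simp add: paths_def)
next
  case (step x)
  have "\<bar>\<eta> (x + 1) - \<eta> x\<bar> = 1" using assms(1) step by (simp add: paths_def)
  then show ?case using step by (simp add: Suc_diff_le)
qed

lemma finite_paths: "finite (paths s \<alpha> t \<beta> A)"
proof (rule finite_subset)
  show "paths s \<alpha> t \<beta> A \<subseteq> {\<eta>. \<forall>x. (x \<in> {s..t} \<longrightarrow> \<eta> x \<in> {0..\<alpha> + int t}) \<and> (x \<notin> {s..t} \<longrightarrow> \<eta> x = 0)}"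
  proof (intro subsetI CollectI allI conjI impI)
    fix \<eta> x assume e: "\<eta> \<in> paths s \<alpha> t \<beta> A"
    { assume x: "x \<in> {s..t}"
      then show "\<eta> x \<in> {0..\<alpha> + int t}" using paths_upper_bound[OF e, of x] e
        by (auto simp: paths_def) }
    { assume "x \<notin> {s..t}"
      then show "\<eta> x = 0" using e by (auto simp: paths_def) }
  qed
  show "finite {\<eta>. \<forall>x. (x \<in> {s..t} \<longrightarrow> \<eta> x \<in> {0..\<alpha> + int t}) \<and> (x \<notin> {s..t} \<longrightarrow> \<eta> x = 0)}"
    by (rule finite_set_of_finite_funs) auto
qed

lemma flip_same: "flip \<eta> x x = \<eta> (x + 1) + \<eta> (x - 1) - \<eta> x"
  and flip_other: "y \<noteq> x \<Longrightarrow> flip \<eta> x y = \<eta> y"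
  by (auto simp: flip_def)

lemma flip_flip: "0 < x \<Longrightarrow> flip (flip \<eta> x) x = \<eta>"
  by (auto simp: flip_def fun_eq_iff)

lemma flip_commute:
  assumes "0 < x" "0 < y" "x \<noteq> y" "x \<noteq> y + 1" "y \<noteq> x + 1"
  shows "flip (flip \<eta> x) y = flip (flip \<eta> y) x"
  using assms by (auto simp: flip_def fun_eq_iff)

lemma paths_step:
  assumes "\<eta> \<in> paths s \<alpha> t \<beta> A" "s \<le> x" "x < t"
  shows "\<eta> (x + 1) = \<eta> x + 1 \<or> \<eta> (x + 1) = \<eta> x - 1"
proof -
  have "\<bar>\<eta> (x + 1) - \<eta> x\<bar> = 1" using assms by (simp add: paths_def)
  then show ?thesis by linarith
qed

lemma paths_step_left:
  assumes "\<eta> \<in> paths s \<alpha> t \<beta> A" "s < x" "x \<le> t"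
  shows "\<eta> (x - 1) = \<eta> x + 1 \<or> \<eta> (x - 1) = \<eta> x - 1"
  using paths_step[OF assms(1), of "x - 1"] assms(2,3) by auto

lemma flip_mem_paths_iff:
  assumes e: "\<eta> \<in> paths 0 \<alpha> t \<beta> A" and x: "0 < x" "x < t"
  shows "flip \<eta> x \<in> paths 0 \<alpha> t \<beta> A \<longleftrightarrow> 0 < \<eta> x \<and> 0 < flip \<eta> x x"
proof -
  have st: "\<bar>flip \<eta> x (y + 1) - flip \<eta> x y\<bar> = 1" if "y < t" for y
  proof -
    have a: "\<bar>\<eta> (y + 1) - \<eta> y\<bar> = 1" using e that by (simp add: paths_def)
    have b: "\<bar>\<eta> (x + 1) - \<eta> x\<bar> = 1" using e x by (simp add: paths_def)
    have c: "\<bar>\<eta> x - \<eta> (x - 1)\<bar> = 1" using paths_step_left[OF e, of x] x by auto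
    consider "y = x" | "y + 1 = x" | "y \<noteq> x" "y + 1 \<noteq> x" by auto
    then show ?thesis
    proof cases
      case 1 then show ?thesis using c by (simp add: flip_same flip_other)
    next
      case 2
      then have "y = x - 1" "y \<noteq> x" by auto
      then show ?thesis using 2 b by (simp add: flip_same flip_other)
    next
      case 3 then show ?thesis using a by (simp add: flip_other)
    qed
  qed
  have up: "0 \<le> \<eta> y" if "y \<le> t" for y using e that by (simp add: paths_def)
  have z: "flip \<eta> x x = 2" if "\<eta> x = 0"
  proof -
    have "x - 1 \<le> t" using x by simp
    then show ?thesis
      using paths_step_left[OF e, of x] paths_step[OF e, of x] that x up[of "x - 1"] up[of "x + 1"]
      by (auto simp: flip_same)
  qed
  have A: "A = {y. 0 < y \<and> y < t \<and> \<eta> y = 0}" using e by (auto simp: paths_def)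
  show ?thesis
  proof
    assume f: "flip \<eta> x \<in> paths 0 \<alpha> t \<beta> A"
    then have "{y. 0 < y \<and> y < t \<and> flip \<eta> x y = 0} = {y. 0 < y \<and> y < t \<and> \<eta> y = 0}"
      using A by (simp add: paths_def)
    then have "flip \<eta> x x = 0 \<longleftrightarrow> \<eta> x = 0" using x by blast
    moreover have "0 \<le> flip \<eta> x x" using f x by (simp add: paths_def)
    ultimately show "0 < \<eta> x \<and> 0 < flip \<eta> x x" using z up[of x] x by fastforce
  next
    assume p: "0 < \<eta> x \<and> 0 < flip \<eta> x x"
    have nz: "flip \<eta> x y = 0 \<longleftrightarrow> \<eta> y = 0" for y using p by (cases "y = x") (auto simp: flip_other)
    have "0 \<le> flip \<eta> x y" if "y \<le> t" for y
      using p up[OF that] by (cases "y = x") (auto simp: flip_other)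
    moreover have "flip \<eta> x 0 = \<alpha>" "flip \<eta> x t = \<beta>" using e x by (auto simp: flip_other paths_def)
    moreover have "flip \<eta> x y = 0" if "t < y" for y using e that x by (auto simp: flip_other paths_def)
    ultimately show "flip \<eta> x \<in> paths 0 \<alpha> t \<beta> A"
      using st A nz by (simp add: paths_def)
  qed
qed

lemma paths_reduce:
  assumes e: "\<eta> \<in> paths 0 \<alpha> t \<beta> A" and e': "\<eta>' \<in> paths 0 \<alpha> t \<beta> A" and ne: "\<eta> \<noteq> \<eta>'"
  shows "\<exists>x. 0 < x \<and> x < t \<and>
    (flip \<eta>' x \<in> paths 0 \<alpha> t \<beta> A \<and> (\<Sum>y\<le>t. \<bar>\<eta> y - flip \<eta>' x y\<bar>) < (\<Sum>y\<le>t. \<bar>\<eta> y - \<eta>' y\<bar>) \<or>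
     flip \<eta> x \<in> paths 0 \<alpha> t \<beta> A \<and> (\<Sum>y\<le>t. \<bar>flip \<eta> x y - \<eta>' y\<bar>) < (\<Sum>y\<le>t. \<bar>\<eta> y - \<eta>' y\<bar>))"
proof -
  have parity: "even (\<eta> x - \<eta>' x)" if "x \<le> t" for x
    using that
  proof (induction x)
    case 0 then show ?case using e e' by (simp add: paths_def)
  next
    case (Suc x)
    then show ?case using paths_step[OF e, of x] paths_step[OF e', of x] by auto
  qed
  have key: "0 < x \<and> x < t \<and> flip \<zeta>' x \<in> paths 0 \<alpha> t \<beta> A \<and>
      (\<Sum>y\<le>t. \<bar>\<zeta> y - flip \<zeta>' x y\<bar>) < (\<Sum>y\<le>t. \<bar>\<zeta> y - \<zeta>' y\<bar>)"
    if m: "\<zeta> \<in> paths 0 \<alpha> t \<beta> A" "\<zeta>' \<in> paths 0 \<alpha> t \<beta> A" and x: "x \<le> t" "\<zeta> x < \<zeta>' x"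
      and mx: "\<forall>y. y \<le> t \<longrightarrow> \<zeta> y \<noteq> \<zeta>' y \<longrightarrow> \<zeta>' y \<le> \<zeta>' x" and ev: "even (\<zeta>' x - \<zeta> x)" for \<zeta> \<zeta>' x
  proof -
    have x0: "0 < x" using m x by (cases "x = 0") (auto simp: paths_def)
    have xt: "x < t" using m x by (cases "x = t") (auto simp: paths_def)
    have g2: "\<zeta> x + 2 \<le> \<zeta>' x" using x(2) ev by presburger
    have up: "\<zeta>' (x + 1) = \<zeta>' x - 1"
    proof (rule ccontr)
      assume "\<not> ?thesis"
      then have u: "\<zeta>' (x + 1) = \<zeta>' x + 1" using paths_step[OF m(2), of x] xt by auto
      moreover have "\<zeta> (x + 1) \<le> \<zeta> x + 1" using paths_step[OF m(1), of x] xt by auto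
      ultimately show False using mx[rule_format, of "x + 1"] xt g2 by auto
    qed
    have dn: "\<zeta>' (x - 1) = \<zeta>' x - 1"
    proof (rule ccontr)
      assume "\<not> ?thesis"
      then have u: "\<zeta>' (x - 1) = \<zeta>' x + 1" using paths_step_left[OF m(2), of x] xt x0 by auto
      moreover have "\<zeta> (x - 1) \<le> \<zeta> x + 1" using paths_step_left[OF m(1), of x] xt x0 by auto
      moreover have "x - 1 \<le> t" using xt by simp
      ultimately show False using mx[rule_format, of "x - 1"] g2 by auto
    qed
    have v: "flip \<zeta>' x x = \<zeta>' x - 2" using up dn by (simp add: flip_same)
    have nn: "0 \<le> \<zeta> x" using m(1) x by (simp add: paths_def)
    have "\<zeta> x \<noteq> 0"
    proof
      assume "\<zeta> x = 0"
      then have "x \<in> A" using m(1) x0 xt by (auto simp: paths_def)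
      then show False using m(2) nn x(2) by (auto simp: paths_def)
    qed
    then have mem: "flip \<zeta>' x \<in> paths 0 \<alpha> t \<beta> A"
      using flip_mem_paths_iff[OF m(2) x0 xt] v g2 nn by auto
    have "(\<Sum>y\<le>t. \<bar>\<zeta> y - flip \<zeta>' x y\<bar>) < (\<Sum>y\<le>t. \<bar>\<zeta> y - \<zeta>' y\<bar>)"
    proof (rule sum_strict_mono_ex1)
      show "\<forall>y\<in>{..t}. \<bar>\<zeta> y - flip \<zeta>' x y\<bar> \<le> \<bar>\<zeta> y - \<zeta>' y\<bar>"
      proof
        fix y show "\<bar>\<zeta> y - flip \<zeta>' x y\<bar> \<le> \<bar>\<zeta> y - \<zeta>' y\<bar>"
          using v g2 by (cases "y = x") (auto simp: flip_other)
      qed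
      show "\<exists>y\<in>{..t}. \<bar>\<zeta> y - flip \<zeta>' x y\<bar> < \<bar>\<zeta> y - \<zeta>' y\<bar>"
        using v g2 x by (intro bexI[of _ x]) auto
    qed simp
    then show ?thesis using x0 xt mem by blast
  qed
  define D where "D = {x. x \<le> t \<and> \<eta> x \<noteq> \<eta>' x}"
  have "D \<noteq> {}"
  proof
    assume "D = {}"
    then have "\<eta> x = \<eta>' x" for x using e e' by (cases "x \<le> t") (auto simp: D_def paths_def)
    then show False using ne by auto
  qed
  moreover have "finite D" by (simp add: D_def)
  ultimately have "Max ((\<lambda>y. max (\<eta> y) (\<eta>' y)) ` D) \<in> (\<lambda>y. max (\<eta> y) (\<eta>' y)) ` D"
    by (intro Max_in) auto
  then obtain x where xD: "x \<in> D" and Mx: "Max ((\<lambda>y. max (\<eta> y) (\<eta>' y)) ` D) = max (\<eta> x) (\<eta>' x)"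
    by blast
  have mx: "max (\<eta> y) (\<eta>' y) \<le> max (\<eta> x) (\<eta>' x)" if "y \<in> D" for y
    unfolding Mx[symmetric] using that \<open>finite D\<close> by (intro Max_ge) auto
  have xt: "x \<le> t" using xD by (simp add: D_def)
  have ev: "even (\<eta> x - \<eta>' x)" "even (\<eta>' x - \<eta> x)" using parity[OF xt] by auto
  show ?thesis
  proof (cases "\<eta> x < \<eta>' x")
    case True
    have "\<forall>y. y \<le> t \<longrightarrow> \<eta> y \<noteq> \<eta>' y \<longrightarrow> \<eta>' y \<le> \<eta>' x"
      using mx True by (auto simp: D_def)
    from key[OF e e' xt True this ev(2)] show ?thesis by (intro exI[of _ x]) simp
  next
    case False
    then have l: "\<eta>' x < \<eta> x" using xD by (auto simp: D_def)
    have "\<forall>y. y \<le> t \<longrightarrow> \<eta>' y \<noteq> \<eta> y \<longrightarrow> \<eta> y \<le> \<eta> x"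
      using mx l by (auto simp: D_def)
    from key[OF e' e xt l this ev(1)] have "0 < x \<and> x < t \<and> flip \<eta> x \<in> paths 0 \<alpha> t \<beta> A \<and>
      (\<Sum>y\<le>t. \<bar>flip \<eta> x y - \<eta>' y\<bar>) < (\<Sum>y\<le>t. \<bar>\<eta> y - \<eta>' y\<bar>)"
      by (simp only: abs_minus_commute[of "\<eta>' _"])
    then show ?thesis by (intro exI[of _ x]) simp
  qed
qed

definition resample :: "config set \<Rightarrow> nat \<Rightarrow> (config \<Rightarrow> real) \<Rightarrow> config \<Rightarrow> real" where
  "resample S x f \<eta> = (if flip \<eta> x \<in> S then (f \<eta> + f (flip \<eta> x)) / 2 else f \<eta>)"

lemma sum_flip_swap:
  assumes "0 < x"
  shows "(\<Sum>\<eta>\<in>S. if flip \<eta> x \<in> S then F \<eta> (flip \<eta> x) else (0::real)) =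
         (\<Sum>\<eta>\<in>S. if flip \<eta> x \<in> S then F (flip \<eta> x) \<eta> else 0)"
proof (cases "finite S")
  case True
  have "(\<Sum>\<eta> | \<eta> \<in> S \<and> flip \<eta> x \<in> S. F \<eta> (flip \<eta> x)) = (\<Sum>\<eta> | \<eta> \<in> S \<and> flip \<eta> x \<in> S. F (flip \<eta> x) \<eta>)"
    by (rule sum.reindex_bij_witness[of _ "\<lambda>\<eta>. flip \<eta> x" "\<lambda>\<eta>. flip \<eta> x"]) (auto simp: flip_flip assms)
  then show ?thesis using True by (simp add: sum.inter_filter)
qed simp

lemma resample_symmetric:
  assumes "0 < x"
  shows "(\<Sum>\<eta>\<in>S. resample S x f \<eta> * g \<eta>) = (\<Sum>\<eta>\<in>S. f \<eta> * resample S x g \<eta>)"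
proof -
  have 1: "resample S x f \<eta> * g \<eta> = (if flip \<eta> x \<in> S then f \<eta> * g \<eta> / 2 else f \<eta> * g \<eta>)
      + (if flip \<eta> x \<in> S then f (flip \<eta> x) * g \<eta> / 2 else 0)" for \<eta>
    by (simp add: resample_def field_simps)
  have 2: "f \<eta> * resample S x g \<eta> = (if flip \<eta> x \<in> S then f \<eta> * g \<eta> / 2 else f \<eta> * g \<eta>)
      + (if flip \<eta> x \<in> S then f \<eta> * g (flip \<eta> x) / 2 else 0)" for \<eta>
    by (simp add: resample_def field_simps)
  show ?thesis
    unfolding 1 2 sum.distrib
    using sum_flip_swap[OF assms, of S "\<lambda>\<eta> \<zeta>. f \<zeta> * g \<eta> / 2"] by simp
qed

lemma resample_energy:
  assumes "0 < x"
  shows "(\<Sum>\<eta>\<in>S. f \<eta> * (f \<eta> - resample S x f \<eta>)) =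
         (\<Sum>\<eta>\<in>S. if flip \<eta> x \<in> S then (f (flip \<eta> x) - f \<eta>)\<^sup>2 else 0) / 4"
proof -
  have 1: "f \<eta> * (f \<eta> - resample S x f \<eta>) = (if flip \<eta> x \<in> S then f \<eta> * (f \<eta> - f (flip \<eta> x)) / 2 else 0)" for \<eta>
    by (simp add: resample_def field_simps)
  have "(\<Sum>\<eta>\<in>S. f \<eta> * (f \<eta> - resample S x f \<eta>)) =
    (\<Sum>\<eta>\<in>S. if flip \<eta> x \<in> S then f (flip \<eta> x) * (f (flip \<eta> x) - f \<eta>) / 2 else 0)"
    unfolding 1 using sum_flip_swap[OF assms, of S "\<lambda>\<eta> \<zeta>. f \<eta> * (f \<eta> - f \<zeta>) / 2"] by simp
  then have "2 * (\<Sum>\<eta>\<in>S. f \<eta> * (f \<eta> - resample S x f \<eta>)) =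
    (\<Sum>\<eta>\<in>S. if flip \<eta> x \<in> S then f \<eta> * (f \<eta> - f (flip \<eta> x)) / 2 else 0) +
    (\<Sum>\<eta>\<in>S. if flip \<eta> x \<in> S then f (flip \<eta> x) * (f (flip \<eta> x) - f \<eta>) / 2 else 0)"
    unfolding 1 by simp
  also have "\<dots> = (\<Sum>\<eta>\<in>S. (if flip \<eta> x \<in> S then (f (flip \<eta> x) - f \<eta>)\<^sup>2 else 0) / 2)"
    unfolding sum.distrib[symmetric] by (rule sum.cong) (auto simp: power2_eq_square field_simps)
  finally show ?thesis by (simp add: sum_divide_distrib[symmetric])
qed

definition heat_bath :: "config set \<Rightarrow> nat \<Rightarrow> (config \<Rightarrow> real) \<Rightarrow> config \<Rightarrow> real" where
  "heat_bath S t f \<eta> = (\<Sum>x\<in>{1..t - 1}. resample S x f \<eta>)"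

definition flip_lipschitz :: "config set \<Rightarrow> nat \<Rightarrow> real \<Rightarrow> (config \<Rightarrow> real) \<Rightarrow> bool" where
  "flip_lipschitz S t L f \<longleftrightarrow> (\<forall>\<eta>\<in>S. \<forall>x. 0 < x \<and> x < t \<and> flip \<eta> x \<in> S \<longrightarrow>
     \<bar>f (flip \<eta> x) - f \<eta>\<bar> \<le> L * (real x * (real t - real x)))"

text \<open>Adjacent sites cannot both be flippable before and after a flip: this is what limits the growth of
  a discrepancy.\<close>

lemma adjacent_flip_trivial:
  assumes e: "\<eta> \<in> paths 0 \<alpha> t \<beta> A" and x: "0 < x" "x < t" and y: "0 < y" "y < t"
    and adj: "y = x + 1 \<or> x = y + 1" and ne: "flip \<eta> x \<noteq> \<eta>"
  shows "flip \<eta> y = \<eta> \<or> flip (flip \<eta> x) y = flip \<eta> x"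
proof -
  have fe: "flip \<zeta> z = \<zeta> \<longleftrightarrow> \<zeta> (z + 1) + \<zeta> (z - 1) = 2 * \<zeta> z" for \<zeta> z
    by (auto simp: flip_def fun_eq_iff)
  have nx: "\<eta> (x + 1) + \<eta> (x - 1) \<noteq> 2 * \<eta> x" using ne fe by blast
  have s: "\<eta> (x + 1) = \<eta> x + 1 \<or> \<eta> (x + 1) = \<eta> x - 1" "\<eta> (x - 1) = \<eta> x + 1 \<or> \<eta> (x - 1) = \<eta> x - 1"
    using paths_step[OF e, of x] paths_step_left[OF e, of x] x by auto
  show ?thesis
  proof (cases "y = x + 1")
    case True
    have "\<eta> (x + 2) = \<eta> (x + 1) + 1 \<or> \<eta> (x + 2) = \<eta> (x + 1) - 1"
      using paths_step[OF e, of "x + 1"] y True by auto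
    then show ?thesis unfolding fe using True s nx by (auto simp: flip_def)
  next
    case False
    then have xy: "x = y + 1" using adj by simp
    have "\<eta> (y - 1) = \<eta> y + 1 \<or> \<eta> (y - 1) = \<eta> y - 1"
      using paths_step_left[OF e, of y] y by auto
    then show ?thesis unfolding fe using xy s nx y by (auto simp: flip_def)
  qed
qed

lemma resample_lipschitz:
  fixes w :: "nat \<Rightarrow> real"
  assumes S: "S = paths 0 \<alpha> t \<beta> A" and L: "flip_lipschitz S t L f" and L0: "0 \<le> L"
    and e: "\<eta> \<in> S" and x: "0 < x" "x < t" and fx: "flip \<eta> x \<in> S" and y: "0 < y" "y < t"
    and w: "\<And>z. w z = real z * (real t - real z)"
  shows "\<bar>resample S y f (flip \<eta> x) - resample S y f \<eta>\<bar> \<le>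
    L * (if y = x then 0 else if y = x + 1 \<or> x = y + 1 then w x + w y / 2 else w x)"
proof -
  have w0: "0 \<le> w z" if "z < t" for z using that by (simp add: w)
  have Lx: "\<bar>f (flip \<zeta> z) - f \<zeta>\<bar> \<le> L * w z" if "\<zeta> \<in> S" "flip \<zeta> z \<in> S" "0 < z" "z < t" for \<zeta> z
    using L that by (simp add: flip_lipschitz_def w)
  consider "y = x" | "y \<noteq> x" "y = x + 1 \<or> x = y + 1" | "y \<noteq> x" "\<not> (y = x + 1 \<or> x = y + 1)" by blast
  then show ?thesis
  proof cases
    case 1
    then show ?thesis using e fx x by (simp add: resample_def flip_flip add.commute)
  next
    case 2
    have R: "\<bar>resample S y f \<zeta> - f \<zeta>\<bar> \<le> L * w y / 2" if "\<zeta> \<in> S" for \<zeta>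
    proof (cases "flip \<zeta> y \<in> S")
      case True
      have "resample S y f \<zeta> - f \<zeta> = (f (flip \<zeta> y) - f \<zeta>) / 2" using True by (simp add: resample_def field_simps)
      then have "\<bar>resample S y f \<zeta> - f \<zeta>\<bar> = \<bar>f (flip \<zeta> y) - f \<zeta>\<bar> / 2" by (simp only: abs_divide abs_numeral)
      then show ?thesis unfolding \<open>\<bar>resample S y f \<zeta> - f \<zeta>\<bar> = _\<close> using Lx[OF that True y] by simp
    next
      case False
      then show ?thesis using L0 w0[OF y(2)] by (simp add: resample_def)
    qed
    have triv: "resample S y f \<zeta> = f \<zeta>" if "flip \<zeta> y = \<zeta>" for \<zeta>
      using that by (simp add: resample_def)
    have "\<bar>resample S y f (flip \<eta> x) - resample S y f \<eta>\<bar> \<le> L * w x + L * w y / 2"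
    proof (cases "flip \<eta> x = \<eta>")
      case True
      have "0 \<le> L * w x + L * w y / 2" using L0 w0 x y by simp
      then show ?thesis using True by simp
    next
      case False
      from adjacent_flip_trivial[OF e[unfolded S] x y 2(2) False]
      consider "flip \<eta> y = \<eta>" | "flip (flip \<eta> x) y = flip \<eta> x" by blast
      then show ?thesis
      proof cases
        case 1
        then show ?thesis using triv[OF 1] R[OF fx] Lx[OF e fx x] by linarith
      next
        case 2
        then show ?thesis using triv[OF 2] R[OF e] Lx[OF e fx x] by linarith
      qed
    qed
    then show ?thesis using 2 by (simp add: algebra_simps)
  next
    case 3
    have far: "y \<noteq> x" "y \<noteq> x + 1" "x \<noteq> y + 1" using 3 by auto
    have c: "flip (flip \<eta> x) y = flip (flip \<eta> y) x" using far x y by (intro flip_commute) auto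
    have vy: "flip \<eta> x y = \<eta> y" using far by (simp add: flip_other)
    have vv: "flip (flip \<eta> x) y y = flip \<eta> y y" using far y by (auto simp: flip_def)
    have iff: "flip (flip \<eta> x) y \<in> S \<longleftrightarrow> flip \<eta> y \<in> S"
      using flip_mem_paths_iff[of "flip \<eta> x" \<alpha> t \<beta> A y] flip_mem_paths_iff[of \<eta> \<alpha> t \<beta> A y] e fx S y vy vv
      by simp
    show ?thesis
    proof (cases "flip \<eta> y \<in> S")
      case True
      have "\<bar>f (flip (flip \<eta> y) x) - f (flip \<eta> y)\<bar> \<le> L * w x"
        using Lx[OF True _ x] iff c True by simp
      moreover have "2 * (resample S y f (flip \<eta> x) - resample S y f \<eta>) =
         (f (flip \<eta> x) - f \<eta>) + (f (flip (flip \<eta> y) x) - f (flip \<eta> y))"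
        using True iff by (simp add: resample_def c field_simps)
      ultimately have "\<bar>resample S y f (flip \<eta> x) - resample S y f \<eta>\<bar> \<le> L * w x"
        using Lx[OF e fx x] by (smt (verit))
      then show ?thesis using 3 by simp
    next
      case False
      then show ?thesis using Lx[OF e fx x] iff 3 by (simp add: resample_def)
    qed
  qed
qed

lemma heat_bath_lipschitz:
  assumes S: "S = paths 0 \<alpha> t \<beta> A" and L: "flip_lipschitz S t L f" and L0: "0 \<le> L"
  shows "flip_lipschitz S t (L * (real t - 1 - 1 / (real t)\<^sup>2)) (heat_bath S t f)"
  unfolding flip_lipschitz_def
proof (intro ballI allI impI, elim conjE)
  fix \<eta> x assume e: "\<eta> \<in> S" and x: "0 < x" "x < t" and fx: "flip \<eta> x \<in> S"
  define w where "w z = real z * (real t - real z)" for z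
  define d where "d y = (if y = x then 0 else if y = x + 1 \<or> x = y + 1 then w x + w y / 2 else w x)" for y
  have w0: "0 \<le> w z" if "z \<le> t" for z using that by (simp add: w_def)
  have "\<bar>heat_bath S t f (flip \<eta> x) - heat_bath S t f \<eta>\<bar> \<le>
      (\<Sum>y\<in>{1..t - 1}. \<bar>resample S y f (flip \<eta> x) - resample S y f \<eta>\<bar>)"
    unfolding heat_bath_def sum_subtractf[symmetric] by (rule sum_abs)
  also have "\<dots> \<le> (\<Sum>y\<in>{1..t - 1}. L * d y)"
    by (intro sum_mono, unfold d_def, rule resample_lipschitz[OF S L L0 e x fx _ _ w_def]) auto
  also have "\<dots> = L * (\<Sum>y\<in>{1..t - 1}. d y)" by (simp add: sum_distrib_left)
  also have "\<dots> \<le> L * ((real t - 1 - 1 / (real t)\<^sup>2) * w x)"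
  proof (rule mult_left_mono[OF _ L0])
    have "(\<Sum>y\<in>{1..t - 1}. d y) = (\<Sum>y\<in>{1..t - 1}. w x - (if y = x then w x else 0)
        + (if y = x + 1 then w (x + 1) / 2 else 0) + (if y = x - 1 then w (x - 1) / 2 else 0))"
      using x by (intro sum.cong) (auto simp: d_def)
    also have "\<dots> = real (t - 1) * w x - w x + (if x + 1 \<in> {1..t - 1} then w (x + 1) / 2 else 0)
        + (if x - 1 \<in> {1..t - 1} then w (x - 1) / 2 else 0)"
    proof -
      have "x \<le> t - Suc 0" using x by simp
      then show ?thesis using x by (simp add: sum.distrib sum_subtractf)
    qed
    also have "\<dots> \<le> real (t - 1) * w x - w x + w (x + 1) / 2 + w (x - 1) / 2"
      using w0[of "x + 1"] w0[of "x - 1"] x by auto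
    also have "\<dots> = (real t - 1) * w x - 1"
      using x by (simp add: w_def of_nat_diff field_simps)
    also have "\<dots> \<le> (real t - 1 - 1 / (real t)\<^sup>2) * w x"
    proof -
      have "w x \<le> real t * real t" unfolding w_def using x by (intro mult_mono) auto
      then have "w x / (real t)\<^sup>2 \<le> 1" using x by (simp add: power2_eq_square)
      then show ?thesis by (simp add: algebra_simps)
    qed
    finally show "(\<Sum>y\<in>{1..t - 1}. d y) \<le> (real t - 1 - 1 / (real t)\<^sup>2) * w x" .
  qed
  finally show "\<bar>heat_bath S t f (flip \<eta> x) - heat_bath S t f \<eta>\<bar> \<le>
     L * (real t - 1 - 1 / (real t)\<^sup>2) * (real x * (real t - real x))"
    by (simp add: w_def mult.assoc)
qed

lemma flip_lipschitz_diff: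
  assumes S: "S = paths 0 \<alpha> t \<beta> A" and L: "flip_lipschitz S t L f" and L0: "0 \<le> L"
    and "\<eta> \<in> S" "\<eta>' \<in> S"
  shows "\<bar>f \<eta> - f \<eta>'\<bar> \<le> L * (real t)\<^sup>2 * real (nat (\<Sum>y\<le>t. \<bar>\<eta> y - \<eta>' y\<bar>))"
  using assms(4,5)
proof (induction "nat (\<Sum>y\<le>t. \<bar>\<eta> y - \<eta>' y\<bar>)" arbitrary: \<eta> \<eta>' rule: less_induct)
  case less
  show ?case
  proof (cases "\<eta> = \<eta>'")
    case True
    then show ?thesis using L0 by simp
  next
    case False
    define m where "m \<eta> \<eta>' = (\<Sum>y\<le>t. \<bar>\<eta> y - \<eta>' y\<bar>)" for \<eta> \<eta>' :: config
    have m0: "0 \<le> m \<eta> \<eta>'" for \<eta> \<eta>' by (simp add: m_def sum_nonneg)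
    have st: "\<bar>f (flip \<zeta> x) - f \<zeta>\<bar> \<le> L * (real t)\<^sup>2" if "0 < x" "x < t" "\<zeta> \<in> S" "flip \<zeta> x \<in> S" for \<zeta> x
    proof -
      have "\<bar>f (flip \<zeta> x) - f \<zeta>\<bar> \<le> L * (real x * (real t - real x))"
        using L that by (simp add: flip_lipschitz_def)
      also have "\<dots> \<le> L * (real t * real t)" using L0 that by (intro mult_left_mono mult_mono) auto
      finally show ?thesis by (simp add: power2_eq_square)
    qed
    have fin: "L * (real t)\<^sup>2 * real (nat (m \<zeta> \<zeta>')) + L * (real t)\<^sup>2 \<le> L * (real t)\<^sup>2 * real (nat (m \<eta> \<eta>'))"
      if "m \<zeta> \<zeta>' < m \<eta> \<eta>'" for \<zeta> \<zeta>'
    proof -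
      have "real (nat (m \<zeta> \<zeta>')) + 1 \<le> real (nat (m \<eta> \<eta>'))" using that m0[of \<zeta> \<zeta>'] by linarith
      from mult_left_mono[OF this, of "L * (real t)\<^sup>2"] show ?thesis using L0 by (simp add: algebra_simps)
    qed
    obtain x where x: "0 < x" "x < t" and
      c: "flip \<eta>' x \<in> S \<and> m \<eta> (flip \<eta>' x) < m \<eta> \<eta>' \<or> flip \<eta> x \<in> S \<and> m (flip \<eta> x) \<eta>' < m \<eta> \<eta>'"
      using paths_reduce[of \<eta> \<alpha> t \<beta> A \<eta>'] less.prems False unfolding S m_def by blast
    from c show ?thesis
    proof
      assume h: "flip \<eta>' x \<in> S \<and> m \<eta> (flip \<eta>' x) < m \<eta> \<eta>'"
      have "nat (m \<eta> (flip \<eta>' x)) < nat (m \<eta> \<eta>')" using h m0[of \<eta> "flip \<eta>' x"] by linarith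
      then have "\<bar>f \<eta> - f (flip \<eta>' x)\<bar> \<le> L * (real t)\<^sup>2 * real (nat (m \<eta> (flip \<eta>' x)))"
        using less.hyps[of \<eta> "flip \<eta>' x"] less.prems h by (simp add: m_def)
      then show ?thesis using st[OF x less.prems(2)] h fin[of \<eta> "flip \<eta>' x"] unfolding m_def by linarith
    next
      assume h: "flip \<eta> x \<in> S \<and> m (flip \<eta> x) \<eta>' < m \<eta> \<eta>'"
      have "nat (m (flip \<eta> x) \<eta>') < nat (m \<eta> \<eta>')" using h m0[of "flip \<eta> x" \<eta>'] by linarith
      then have "\<bar>f (flip \<eta> x) - f \<eta>'\<bar> \<le> L * (real t)\<^sup>2 * real (nat (m (flip \<eta> x) \<eta>'))"
        using less.hyps[of "flip \<eta> x" \<eta>'] less.prems h by (simp add: m_def)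
      then show ?thesis using st[OF x less.prems(1)] h fin[of "flip \<eta> x" \<eta>'] unfolding m_def by linarith
    qed
  qed
qed

lemma flip_lipschitz_exists:
  assumes "finite S"
  shows "\<exists>L\<ge>0. flip_lipschitz S t L f"
proof -
  define L where "L = (\<Sum>\<eta>\<in>S. \<Sum>\<zeta>\<in>S. \<bar>f \<zeta> - f \<eta>\<bar>)"
  have L: "\<bar>f \<zeta> - f \<eta>\<bar> \<le> L" if "\<eta> \<in> S" "\<zeta> \<in> S" for \<eta> \<zeta>
  proof -
    have "\<bar>f \<zeta> - f \<eta>\<bar> \<le> (\<Sum>\<zeta>\<in>S. \<bar>f \<zeta> - f \<eta>\<bar>)" using assms that by (intro member_le_sum) auto
    also have "\<dots> \<le> L" unfolding L_def using assms that
      by (intro member_le_sum[of \<eta> S "\<lambda>\<eta>. \<Sum>\<zeta>\<in>S. \<bar>f \<zeta> - f \<eta>\<bar>"]) (auto intro: sum_nonneg)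
    finally show ?thesis .
  qed
  have L0: "0 \<le> L" by (simp add: L_def sum_nonneg)
  have "\<bar>f (flip \<eta> x) - f \<eta>\<bar> \<le> L * (real x * (real t - real x))"
    if "\<eta> \<in> S" "0 < x" "x < t" "flip \<eta> x \<in> S" for \<eta> x
  proof -
    have "1 * 1 \<le> real x * (real t - real x)" using that by (intro mult_mono) auto
    then have "L * 1 \<le> L * (real x * (real t - real x))" using L0 by (intro mult_left_mono) auto
    then show ?thesis using L[OF that(1,4)] by linarith
  qed
  then show ?thesis using L0 by (auto simp: flip_lipschitz_def)
qed

lemma paths_poincare_mean_zero:
  assumes S: "S = paths 0 \<alpha> t \<beta> A" and t: "2 \<le> t" and mz: "(\<Sum>\<eta>\<in>S. f \<eta>) = 0"
  shows "(\<Sum>\<eta>\<in>S. (f \<eta>)\<^sup>2) \<le> (real t)\<^sup>2 / 4 *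
    (\<Sum>\<eta>\<in>S. \<Sum>x\<in>{1..t - 1}. if flip \<eta> x \<in> S then (f (flip \<eta> x) - f \<eta>)\<^sup>2 else 0)"
proof -
  have fin: "finite S" by (simp add: S finite_paths)
  define q where "q = real t - 1 - 1 / (real t)\<^sup>2"
  have t4: "4 \<le> (real t)\<^sup>2" using t power_mono[of 2 "real t" 2] by simp
  have "1 / (real t)\<^sup>2 \<le> 1 / 4" using t4 t by (intro divide_left_mono) auto
  moreover have "2 \<le> real t" using t by simp
  ultimately have q0: "0 < q" unfolding q_def by linarith
  have sym: "(\<Sum>\<eta>\<in>S. heat_bath S t f \<eta> * g \<eta>) = (\<Sum>\<eta>\<in>S. f \<eta> * heat_bath S t g \<eta>)" for f g
  proof -
    have "(\<Sum>\<eta>\<in>S. heat_bath S t f \<eta> * g \<eta>) = (\<Sum>x\<in>{1..t - 1}. \<Sum>\<eta>\<in>S. resample S x f \<eta> * g \<eta>)"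
      unfolding heat_bath_def sum_distrib_right by (rule sum.swap)
    also have "\<dots> = (\<Sum>x\<in>{1..t - 1}. \<Sum>\<eta>\<in>S. f \<eta> * resample S x g \<eta>)"
      by (intro sum.cong resample_symmetric) auto
    also have "\<dots> = (\<Sum>\<eta>\<in>S. f \<eta> * heat_bath S t g \<eta>)"
      unfolding heat_bath_def sum_distrib_left by (rule sum.swap)
    finally show ?thesis .
  qed
  have one: "heat_bath S t (\<lambda>_. 1) \<eta> = real (t - 1)" for \<eta>
  proof -
    have "resample S x (\<lambda>_. 1) \<eta> = 1" for x by (auto simp: resample_def)
    then show ?thesis by (simp add: heat_bath_def)
  qed
  obtain L where L0: "0 \<le> L" and L: "flip_lipschitz S t L f" using flip_lipschitz_exists[OF fin] by blast
  have iter: "flip_lipschitz S t (L * q ^ k) ((heat_bath S t ^^ k) f) \<and> (\<Sum>\<eta>\<in>S. (heat_bath S t ^^ k) f \<eta>) = 0" for k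
  proof (induction k)
    case 0
    then show ?case using L mz by simp
  next
    case (Suc k)
    have "flip_lipschitz S t (L * q ^ k * q) (heat_bath S t ((heat_bath S t ^^ k) f))"
      unfolding q_def by (rule heat_bath_lipschitz[OF S]) (use Suc L0 q0 in \<open>auto simp: q_def\<close>)
    moreover have "(\<Sum>\<eta>\<in>S. heat_bath S t ((heat_bath S t ^^ k) f) \<eta>) = 0"
      using sym[of "(heat_bath S t ^^ k) f" "\<lambda>_. 1"] Suc by (simp add: one sum_distrib_right[symmetric])
    ultimately show ?case by (simp add: ac_simps)
  qed
  define M where "M = (\<Sum>\<eta>\<in>S. \<Sum>\<eta>'\<in>S. (real t)\<^sup>2 * real (nat (\<Sum>y\<le>t. \<bar>\<eta> y - \<eta>' y\<bar>)))"
  have decay: "(\<Sum>\<eta>\<in>S. ((heat_bath S t ^^ k) f \<eta>)\<^sup>2) \<le> (real (card S) * (L * M)\<^sup>2) * (q\<^sup>2) ^ k" for k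
  proof -
    define h where "h = (heat_bath S t ^^ k) f"
    have hl: "flip_lipschitz S t (L * q ^ k) h" and hz: "(\<Sum>\<eta>\<in>S. h \<eta>) = 0" using iter[of k] by (auto simp: h_def)
    have Lq: "0 \<le> L * q ^ k" using L0 q0 by simp
    have "(h \<eta>)\<^sup>2 \<le> (L * M)\<^sup>2 * (q\<^sup>2) ^ k" if e: "\<eta> \<in> S" for \<eta>
    proof -
      have "0 < card S" using e fin by (auto simp: card_gt_0_iff)
      then have c1: "1 \<le> real (card S)" by simp
      have "real (card S) * h \<eta> = (\<Sum>\<eta>'\<in>S. h \<eta> - h \<eta>')" using hz by (simp add: sum_subtractf)
      then have "real (card S) * \<bar>h \<eta>\<bar> = \<bar>\<Sum>\<eta>'\<in>S. h \<eta> - h \<eta>'\<bar>" by (metis abs_mult abs_of_nat)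
      also have "\<dots> \<le> (\<Sum>\<eta>'\<in>S. \<bar>h \<eta> - h \<eta>'\<bar>)" by (rule sum_abs)
      also have "\<dots> \<le> (\<Sum>\<eta>'\<in>S. L * q ^ k * ((real t)\<^sup>2 * real (nat (\<Sum>y\<le>t. \<bar>\<eta> y - \<eta>' y\<bar>))))"
        using flip_lipschitz_diff[OF S hl Lq e] by (intro sum_mono) (simp add: mult.assoc)
      also have "\<dots> = L * q ^ k * (\<Sum>\<eta>'\<in>S. (real t)\<^sup>2 * real (nat (\<Sum>y\<le>t. \<bar>\<eta> y - \<eta>' y\<bar>)))"
        by (simp add: sum_distrib_left)
      also have "\<dots> \<le> L * q ^ k * M" unfolding M_def using fin e Lq
        by (intro mult_left_mono member_le_sum[of \<eta> S "\<lambda>\<eta>. \<Sum>\<eta>'\<in>S. (real t)\<^sup>2 * real (nat (\<Sum>y\<le>t. \<bar>\<eta> y - \<eta>' y\<bar>))"]) (auto intro: sum_nonneg)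
      finally have "real (card S) * \<bar>h \<eta>\<bar> \<le> L * q ^ k * M" .
      moreover have "1 * \<bar>h \<eta>\<bar> \<le> real (card S) * \<bar>h \<eta>\<bar>" using c1 by (intro mult_right_mono) auto
      ultimately have "\<bar>h \<eta>\<bar> \<le> L * q ^ k * M" by linarith
      then have "\<bar>h \<eta>\<bar>\<^sup>2 \<le> (L * q ^ k * M)\<^sup>2" by (intro power_mono) auto
      then show ?thesis by (simp add: power_mult_distrib power_mult[symmetric] mult.commute mult.left_commute)
    qed
    then have "(\<Sum>\<eta>\<in>S. (h \<eta>)\<^sup>2) \<le> (\<Sum>\<eta>\<in>S. (L * M)\<^sup>2 * (q\<^sup>2) ^ k)" by (intro sum_mono)
    then show ?thesis by (simp add: h_def)
  qed
  have main: "(\<Sum>\<eta>\<in>S. f \<eta> * heat_bath S t f \<eta>) \<le> q * (\<Sum>\<eta>\<in>S. (f \<eta>)\<^sup>2)"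
    by (rule symmetric_operator_le_of_decay[OF sym q0 decay])
  have "(\<Sum>\<eta>\<in>S. \<Sum>x\<in>{1..t - 1}. if flip \<eta> x \<in> S then (f (flip \<eta> x) - f \<eta>)\<^sup>2 else 0) / 4 =
      (\<Sum>x\<in>{1..t - 1}. (\<Sum>\<eta>\<in>S. if flip \<eta> x \<in> S then (f (flip \<eta> x) - f \<eta>)\<^sup>2 else 0) / 4)"
    unfolding sum_divide_distrib[symmetric] by (subst sum.swap) simp
  also have "\<dots> = (\<Sum>x\<in>{1..t - 1}. \<Sum>\<eta>\<in>S. f \<eta> * (f \<eta> - resample S x f \<eta>))"
    by (intro sum.cong resample_energy[symmetric]) auto
  also have "\<dots> = (\<Sum>\<eta>\<in>S. \<Sum>x\<in>{1..t - 1}. f \<eta> * (f \<eta> - resample S x f \<eta>))" by (rule sum.swap)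
  also have "\<dots> = (\<Sum>\<eta>\<in>S. real (t - 1) * (f \<eta>)\<^sup>2 - f \<eta> * heat_bath S t f \<eta>)"
    by (intro sum.cong) (auto simp: heat_bath_def sum_distrib_left[symmetric] sum_subtractf power2_eq_square algebra_simps)
  also have "\<dots> = (real t - 1) * (\<Sum>\<eta>\<in>S. (f \<eta>)\<^sup>2) - (\<Sum>\<eta>\<in>S. f \<eta> * heat_bath S t f \<eta>)"
    using t by (simp add: sum_subtractf sum_distrib_left of_nat_diff)
  also have "\<dots> \<ge> (1 / (real t)\<^sup>2) * (\<Sum>\<eta>\<in>S. (f \<eta>)\<^sup>2)" using main by (simp add: q_def algebra_simps)
  finally have "(\<Sum>\<eta>\<in>S. (f \<eta>)\<^sup>2) \<le> (real t)\<^sup>2 * ((\<Sum>\<eta>\<in>S. \<Sum>x\<in>{1..t - 1}. if flip \<eta> x \<in> S then (f (flip \<eta> x) - f \<eta>)\<^sup>2 else 0) / 4)"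
    using t by (simp add: field_simps)
  then show ?thesis by simp
qed

lemma paths_poincare:
  assumes S: "S = paths 0 \<alpha> t \<beta> A" and t: "2 \<le> t"
  shows "(\<Sum>\<eta>\<in>S. (f \<eta> - (\<Sum>\<zeta>\<in>S. f \<zeta>) / real (card S))\<^sup>2) \<le> (real t)\<^sup>2 / 4 *
    (\<Sum>\<eta>\<in>S. \<Sum>x\<in>{1..t - 1}. if flip \<eta> x \<in> S then (f (flip \<eta> x) - f \<eta>)\<^sup>2 else 0)"
proof -
  have "finite S" by (simp add: S finite_paths)
  then have "(\<Sum>\<eta>\<in>S. f \<eta> - (\<Sum>\<zeta>\<in>S. f \<zeta>) / real (card S)) = 0"
    by (cases "S = {}") (auto simp: sum_subtractf)
  from paths_poincare_mean_zero[OF S t this] show ?thesis by (simp only: diff_diff_eq2 diff_add_cancel)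
qed

section \<open>Renewal sets with fixed end points\<close>

lemma weighted_variance_pairs:
  fixes w g :: "'a \<Rightarrow> real"
  assumes "finite S" and W: "W = (\<Sum>i\<in>S. w i)" "W \<noteq> 0"
  shows "(\<Sum>i\<in>S. \<Sum>j\<in>S. w i * w j * (g j - g i)\<^sup>2) = 2 * W * (\<Sum>i\<in>S. w i * (g i - (\<Sum>j\<in>S. w j * g j) / W)\<^sup>2)"
proof -
  define P where "P = (\<Sum>j\<in>S. w j * g j)"
  define Q where "Q = (\<Sum>j\<in>S. w j * (g j)\<^sup>2)"
  have "(\<Sum>i\<in>S. \<Sum>j\<in>S. w i * w j * (g j - g i)\<^sup>2) =
      (\<Sum>i\<in>S. \<Sum>j\<in>S. w i * (w j * (g j)\<^sup>2) + w i * (g i)\<^sup>2 * w j - 2 * (w i * g i) * (w j * g j))"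
    by (intro sum.cong refl) (simp add: power2_eq_square algebra_simps)
  also have "\<dots> = W * Q + Q * W - 2 * P * P"
    by (simp add: sum.distrib sum_subtractf sum_distrib_left[symmetric] sum_distrib_right[symmetric] W P_def Q_def)
  finally have 1: "(\<Sum>i\<in>S. \<Sum>j\<in>S. w i * w j * (g j - g i)\<^sup>2) = 2 * W * Q - 2 * P * P" by simp
  have "(\<Sum>i\<in>S. w i * (g i - c)\<^sup>2) = Q - 2 * c * P + c\<^sup>2 * W" for c
  proof -
    have "(\<Sum>i\<in>S. w i * (g i - c)\<^sup>2) = (\<Sum>i\<in>S. w i * (g i)\<^sup>2 - 2 * c * (w i * g i) + c\<^sup>2 * w i)"
      by (intro sum.cong refl) (simp add: power2_eq_square algebra_simps)
    then show ?thesis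
      by (simp add: sum.distrib sum_subtractf sum_distrib_left[symmetric] W P_def Q_def)
  qed
  then have "(\<Sum>i\<in>S. w i * (g i - P / W)\<^sup>2) = Q - 2 * (P / W) * P + (P / W)\<^sup>2 * W" .
  also have "\<dots> = Q - P * P / W" using W(2) by (simp add: power2_eq_square field_simps)
  finally have v: "(\<Sum>i\<in>S. w i * (g i - P / W)\<^sup>2) = Q - P * P / W" .
  have "2 * W * (\<Sum>i\<in>S. w i * (g i - P / W)\<^sup>2) = 2 * W * Q - 2 * P * P"
    unfolding v using W(2) by (simp add: right_diff_distrib)
  then show ?thesis using 1 by (simp add: P_def)
qed

lemma jensen_sum:
  fixes g :: "'b \<Rightarrow> real"
  assumes "finite S"
  shows "real (card S) * ((\<Sum>x\<in>S. g x) / real (card S) - c)\<^sup>2 \<le> (\<Sum>x\<in>S. (g x - c)\<^sup>2)"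
proof (cases "S = {}")
  case False
  then have k: "0 < real (card S)" using assms by (simp add: card_gt_0_iff)
  define D where "D = (\<Sum>x\<in>S. g x) / real (card S) - c"
  have "(\<Sum>x\<in>S. g x - c) = real (card S) * D" using k by (simp add: sum_subtractf D_def right_diff_distrib)
  then have "(real (card S) * D)\<^sup>2 \<le> (\<Sum>x\<in>S. (g x - c)\<^sup>2) * real (card S)"
    using sum_squared_le_sum_of_squares[of "\<lambda>x. g x - c" S] by simp
  then have "real (card S) * (real (card S) * D\<^sup>2) \<le> real (card S) * (\<Sum>x\<in>S. (g x - c)\<^sup>2)"
    by (simp add: power2_eq_square mult_ac)
  then show ?thesis using k unfolding D_def by (subst (asm) mult_le_cancel_left_pos) auto
qed simp

lemma set_eq_trichotomy:
  fixes y :: nat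
  assumes "\<And>x. x < y \<Longrightarrow> x \<in> A \<longleftrightarrow> x \<in> B" "y \<in> A \<longleftrightarrow> y \<in> B" "\<And>x. y < x \<Longrightarrow> x \<in> A \<longleftrightarrow> x \<in> B"
  shows "A = B"
  using assms by (metis linorder_neqE_nat set_eqI)

locale renewal =
  fixes K :: "nat \<Rightarrow> real" and lam R :: real and m :: nat
  assumes lam_pos: "0 < lam" and R_pos: "0 < R" and K_pos: "\<And>j. 1 \<le> j \<Longrightarrow> 0 < K j" and K_1: "K 1 = 1"
    and K_Suc: "\<And>j. 1 \<le> j \<Longrightarrow> K (Suc j) \<le> 4 * K j"
    and K_swap: "\<And>i j k l. 1 \<le> i \<Longrightarrow> 1 \<le> j \<Longrightarrow> 1 \<le> k \<Longrightarrow> 1 \<le> l \<Longrightarrow> i + j = k + l \<Longrightarrow> i + j \<le> 2 * m \<Longrightarrow>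
       K i * K j \<le> R * (K k * K l)"
    and K_insert: "\<And>i j. 1 \<le> i \<Longrightarrow> 1 \<le> j \<Longrightarrow> i + j \<le> m \<Longrightarrow> K (i + j) \<le> R * (K i * K j)"
begin

fun gap_prod :: "nat list \<Rightarrow> real" where
  "gap_prod [] = 1"
| "gap_prod [x] = 1"
| "gap_prod (x # y # zs) = K (y - x) * gap_prod (y # zs)"

definition gap_weight :: "nat set \<Rightarrow> real" where
  "gap_weight A = gap_prod (sorted_list_of_set A)"

lemma gap_prod_append:
  "xs \<noteq> [] \<Longrightarrow> ys \<noteq> [] \<Longrightarrow> gap_prod (xs @ ys) = gap_prod xs * K (hd ys - last xs) * gap_prod ys"
proof (induction xs rule: gap_prod.induct)
  case (2 x)
  then show ?case by (cases ys) auto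
qed auto

lemma gap_prod_pos: "sorted xs \<Longrightarrow> distinct xs \<Longrightarrow> 0 < gap_prod xs"
proof (induction xs rule: gap_prod.induct)
  case (3 x y zs)
  then have "x < y" by auto
  then show ?case using 3 by (auto intro!: mult_pos_pos K_pos)
qed auto

lemma gap_weight_pos: "0 < gap_weight A"
  unfolding gap_weight_def by (intro gap_prod_pos) auto

lemma gap_weight_singleton [simp]: "gap_weight {u} = 1"
  by (simp add: gap_weight_def)

lemma last_sorted_list_of_set:
  assumes "finite A" "A \<noteq> {}"
  shows "last (sorted_list_of_set (A :: nat set)) = Max A"
proof -
  have ne: "sorted_list_of_set A \<noteq> []" using assms by simp
  have "Max A = Max (set (sorted_list_of_set A))" using assms by simp
  also have "\<dots> = last (sorted_list_of_set A)"
  proof (rule Max_eqI)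
    show "last (sorted_list_of_set A) \<in> set (sorted_list_of_set A)" using ne by (rule last_in_set)
    show "x \<le> last (sorted_list_of_set A)" if x: "x \<in> set (sorted_list_of_set A)" for x
    proof -
      obtain i where i: "i < length (sorted_list_of_set A)" "x = sorted_list_of_set A ! i"
        using x by (metis in_set_conv_nth)
      then have "x \<le> sorted_list_of_set A ! (length (sorted_list_of_set A) - 1)"
        by (simp only:) (intro sorted_nth_mono, auto)
      then show ?thesis using ne by (simp add: last_conv_nth)
    qed
  qed simp
  finally show ?thesis by simp
qed

lemma gap_weight_join:
  assumes "finite A" "finite B" "A \<noteq> {}" "B \<noteq> {}" and lt: "\<And>x y. x \<in> A \<Longrightarrow> y \<in> B \<Longrightarrow> x < y"
  shows "gap_weight (A \<union> B) = gap_weight A * K (Min B - Max A) * gap_weight B"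
proof -
  have "sorted_list_of_set (A \<union> B) = sorted_list_of_set A @ sorted_list_of_set B"
    using assms by (intro sorted_distinct_set_unique) (auto simp: sorted_append less_imp_le dest: lt)
  moreover have "hd (sorted_list_of_set B) = Min B"
    using assms by (simp add: sorted_list_of_set_nonempty)
  ultimately show ?thesis
    using assms by (simp add: gap_weight_def gap_prod_append last_sorted_list_of_set)
qed

lemma gap_weight_split:
  assumes "finite Z" "u \<in> Z"
  shows "gap_weight Z = gap_weight (Z \<inter> {..u}) * gap_weight (Z \<inter> {u..})"
proof (cases "Z \<inter> {..<u} = {}")
  case True
  then have "Z \<inter> {..u} = {u}" "Z \<inter> {u..} = Z" using assms by force+
  then show ?thesis by simp
next
  case False
  have Mi: "Min (Z \<inter> {u..}) = u" using assms by (intro Min_eqI) auto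
  have "Z = (Z \<inter> {..<u}) \<union> (Z \<inter> {u..})" by auto
  then have "gap_weight Z = gap_weight ((Z \<inter> {..<u}) \<union> (Z \<inter> {u..}))" by simp
  also have "\<dots> = gap_weight (Z \<inter> {..<u}) * K (u - Max (Z \<inter> {..<u})) * gap_weight (Z \<inter> {u..})"
    using False assms by (subst gap_weight_join) (auto simp: Mi)
  also have "gap_weight (Z \<inter> {..<u}) * K (u - Max (Z \<inter> {..<u})) = gap_weight ((Z \<inter> {..<u}) \<union> {u})"
    using False assms by (subst gap_weight_join) auto
  also have "(Z \<inter> {..<u}) \<union> {u} = Z \<inter> {..u}" using assms by auto
  finally show ?thesis .
qed

lemma gap_weight_shift: "finite A \<Longrightarrow> gap_weight ((+) d ` A) = gap_weight A"
proof -
  assume f: "finite A"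
  have "sorted_list_of_set ((+) d ` A) = map ((+) d) (sorted_list_of_set A)"
    using f by (intro sorted_distinct_set_unique) (auto simp: sorted_map distinct_map)
  moreover have "gap_prod (map ((+) d) xs) = gap_prod xs" for xs
    by (induction xs rule: gap_prod.induct) auto
  ultimately show ?thesis by (simp add: gap_weight_def)
qed

lemma gap_weight_insert:
  assumes Z: "finite Z" "y \<notin> Z" and A: "A = Z \<inter> {..<y}" "A \<noteq> {}" and B: "B = Z \<inter> {y<..}" "B \<noteq> {}"
  shows "gap_weight Z = gap_weight A * K (Min B - Max A) * gap_weight B"
    and "gap_weight (insert y Z) = gap_weight A * (K (y - Max A) * K (Min B - y)) * gap_weight B"
proof -
  have fin: "finite A" "finite B" using Z A B by auto
  have "Z = A \<union> B" using Z A B by force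
  then show "gap_weight Z = gap_weight A * K (Min B - Max A) * gap_weight B"
    using gap_weight_join[OF fin A(2) B(2)] A B by auto
  have Mi: "Min ({y} \<union> B) = y" using fin B by (intro Min_eqI) auto
  have "insert y Z = A \<union> ({y} \<union> B)" using Z A B by force
  then have "gap_weight (insert y Z) = gap_weight A * K (y - Max A) * gap_weight ({y} \<union> B)"
    using gap_weight_join[of A "{y} \<union> B"] fin A B Mi by (metis (no_types, lifting) Int_iff UnE finite.emptyI finite_Un finite_insert
      greaterThan_iff insert_not_empty lessThan_iff less_trans singletonD Un_empty)
  moreover have "gap_weight ({y} \<union> B) = K (Min B - y) * gap_weight B"
    using gap_weight_join[of "{y}" B] fin B by auto
  ultimately show "gap_weight (insert y Z) = gap_weight A * (K (y - Max A) * K (Min B - y)) * gap_weight B" by simp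
qed

definition wt :: "nat set \<Rightarrow> real" where
  "wt Z = lam ^ card Z * gap_weight Z"

lemma wt_pos: "0 < wt Z"
  by (simp add: wt_def lam_pos gap_weight_pos)

lemma wt_swap:
  assumes f: "finite A" "finite A'" "finite B" "finite B'" and ne: "A \<noteq> {}" "A' \<noteq> {}" "B \<noteq> {}" "B' \<noteq> {}"
    and lt: "\<And>x y. x \<in> A \<union> A' \<Longrightarrow> y \<in> B \<union> B' \<Longrightarrow> x < y"
    and rng: "A \<union> A' \<union> B \<union> B' \<subseteq> {l..l + m}"
  shows "wt (A \<union> B) * wt (A' \<union> B') \<le> R * (wt (A' \<union> B) * wt (A \<union> B'))"
proof -
  have mem: "Max A \<in> A" "Max A' \<in> A'" "Min B \<in> B" "Min B' \<in> B'" using f ne by auto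
  have l: "Max A < Min B" "Max A' < Min B" "Max A < Min B'" "Max A' < Min B'" using mem lt by auto
  have r: "l \<le> Max A" "l \<le> Max A'" "Min B \<le> l + m" "Min B' \<le> l + m" using mem rng by auto
  have K: "K (Min B - Max A) * K (Min B' - Max A') \<le> R * (K (Min B - Max A') * K (Min B' - Max A))"
    using l r by (intro K_swap) auto
  have d: "A \<inter> B = {}" "A' \<inter> B = {}" "A \<inter> B' = {}" "A' \<inter> B' = {}" using lt by fastforce+
  have c: "lam ^ card (A \<union> B) * lam ^ card (A' \<union> B') = lam ^ card (A' \<union> B) * lam ^ card (A \<union> B')"
    using f d by (simp add: card_Un_disjoint power_add)
  have k: "gap_weight (A \<union> B) = gap_weight A * K (Min B - Max A) * gap_weight B" "gap_weight (A' \<union> B') = gap_weight A' * K (Min B' - Max A') * gap_weight B'"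
     "gap_weight (A' \<union> B) = gap_weight A' * K (Min B - Max A') * gap_weight B" "gap_weight (A \<union> B') = gap_weight A * K (Min B' - Max A) * gap_weight B'"
    using f ne lt by (auto intro!: gap_weight_join)
  define c0 where "c0 = lam ^ card (A \<union> B) * lam ^ card (A' \<union> B') * (gap_weight A * gap_weight B * gap_weight A' * gap_weight B')"
  have c0: "0 \<le> c0" using lam_pos gap_weight_pos by (simp add: c0_def less_imp_le)
  have "wt (A \<union> B) * wt (A' \<union> B') = c0 * (K (Min B - Max A) * K (Min B' - Max A'))"
    by (simp add: wt_def k c0_def)
  also have "\<dots> \<le> c0 * (R * (K (Min B - Max A') * K (Min B' - Max A)))"
    by (rule mult_left_mono[OF K c0])
  also have "\<dots> = R * (wt (A' \<union> B) * wt (A \<union> B'))"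
    by (simp add: wt_def k c0_def c)
  finally show ?thesis .
qed

definition fam :: "nat \<Rightarrow> nat \<Rightarrow> nat set set" where
  "fam l r = {Z. Z \<subseteq> {l..r} \<and> l \<in> Z \<and> r \<in> Z}"

lemma finite_fam: "finite (fam l r)"
  by (rule finite_subset[of _ "Pow {l..r}"]) (auto simp: fam_def)

lemma fam_finite: "Z \<in> fam l r \<Longrightarrow> finite Z"
  by (auto simp: fam_def intro: finite_subset)

definition hybrid :: "nat \<Rightarrow> nat set \<Rightarrow> nat set \<Rightarrow> nat set" where
  "hybrid y Z Z' = (Z' \<inter> {..<y}) \<union> (Z \<inter> {y..})"

lemma hybrid_step_sum:
  assumes y: "l < y" "y < r" and len: "r \<le> l + m"
  shows "(\<Sum>Z\<in>fam l r. \<Sum>Z'\<in>fam l r. wt Z * wt Z' * (G (hybrid (Suc y) Z Z') - G (hybrid y Z Z'))\<^sup>2)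
    \<le> 2 * R * (\<Sum>C\<in>fam l r. wt C) * (\<Sum>I\<in>{I \<in> fam l r. y \<in> I}. wt I * (G I - G (I - {y}))\<^sup>2)"
proof -
  define F where "F Z Z' = wt Z * wt Z' * (G (hybrid (Suc y) Z Z') - G (hybrid y Z Z'))\<^sup>2" for Z Z'
  define E where "E I = wt I * (G I - G (I - {y}))\<^sup>2" for I
  define X where "X = fam l r \<times> fam l r"
  define Xa where "Xa = {(Z, Z') \<in> X. y \<notin> Z \<and> y \<in> Z'}"
  define Xb where "Xb = {(Z, Z') \<in> X. y \<in> Z \<and> y \<notin> Z'}"
  define Y where "Y = {I \<in> fam l r. y \<in> I} \<times> fam l r"
  have finX: "finite X" "finite Xa" "finite Xb" "finite Y"
  proof -
    show "finite X" "finite Y" using finite_fam by (auto simp: X_def Y_def)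
    then show "finite Xa" "finite Xb" by (auto simp: Xa_def Xb_def intro: finite_subset[of _ X])
  qed
  have hy: "hybrid (Suc y) Z Z' = hybrid y Z Z'" if "y \<in> Z \<longleftrightarrow> y \<in> Z'" for Z Z'
    using that by (auto simp: hybrid_def less_Suc_eq Suc_le_eq le_less)
  have R0: "0 \<le> R" using R_pos by simp
  have E0: "0 \<le> E I" for I using wt_pos by (simp add: E_def less_imp_le)
  have main: "wt Z * wt Z' \<le> R * (wt (A' \<union> B) * wt (A \<union> B'))"
    if "A = Z \<inter> {..<y}" "Z = A \<union> B" "Z' = A' \<union> B'" "B' = Z' \<inter> {y<..}" "Z \<in> fam l r" "Z' \<in> fam l r"
      "l \<in> A'" "r \<in> B" "\<And>x z. x \<in> A \<union> A' \<Longrightarrow> z \<in> B \<union> B' \<Longrightarrow> x < z" for A B A' B' Z Z'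
  proof -
    have "finite Z" "finite Z'" using fam_finite that(5,6) by blast+
    then have f: "finite A" "finite B" "finite A'" "finite B'" using that(2,3) by (metis finite_Un)+
    have "A \<noteq> {}" "B' \<noteq> {}" using that(1,4,5,6) y by (auto simp: fam_def)
    moreover have "A' \<noteq> {}" "B \<noteq> {}" using that(7,8) by auto
    moreover have "A \<union> A' \<union> B \<union> B' \<subseteq> {l..l + m}" using that(2,3,5,6) len by (force simp: fam_def)
    ultimately show ?thesis using wt_swap[of A A' B B' l] f that(2,3,9) by metis
  qed
  have a: "(\<Sum>p\<in>Xa. F (fst p) (snd p)) \<le> (\<Sum>p\<in>Y. R * E (fst p) * wt (snd p))"
  proof (rule sum_le_included[OF finX(2,4), where i = "\<lambda>(I, C). ((C \<inter> {..<y}) \<union> (I \<inter> {y<..}), (I \<inter> {..y}) \<union> (C \<inter> {y<..}))"])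
    show "\<forall>p\<in>Y. 0 \<le> R * E (fst p) * wt (snd p)" using R0 E0 wt_pos by (simp add: less_imp_le)
    show "\<forall>p\<in>Xa. \<exists>q\<in>Y. (case q of (I, C) \<Rightarrow> ((C \<inter> {..<y}) \<union> (I \<inter> {y<..}), (I \<inter> {..y}) \<union> (C \<inter> {y<..}))) = p \<and>
        F (fst p) (snd p) \<le> R * E (fst q) * wt (snd q)"
    proof
      fix p assume "p \<in> Xa"
      then obtain Z Z' where p: "p = (Z, Z')" and Z: "Z \<in> fam l r" "Z' \<in> fam l r" "y \<notin> Z" "y \<in> Z'"
        by (auto simp: Xa_def X_def)
      define I where "I = (Z' \<inter> {..y}) \<union> (Z \<inter> {y<..})"
      define C where "C = (Z \<inter> {..<y}) \<union> (Z' \<inter> {y<..})"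
      have q: "(I, C) \<in> Y" using Z y by (auto simp: Y_def I_def C_def fam_def)
      have dec1: "(C \<inter> {..<y}) \<union> (I \<inter> {y<..}) = Z"
        by (rule set_eq_trichotomy[of y]) (use Z(3,4) in \<open>auto simp: I_def C_def hybrid_def\<close>)
      have dec2: "(I \<inter> {..y}) \<union> (C \<inter> {y<..}) = Z'"
        by (rule set_eq_trichotomy[of y]) (use Z(3,4) in \<open>auto simp: I_def C_def hybrid_def\<close>)
      note dec = dec1 dec2
      have h1: "hybrid (Suc y) Z Z' = I"
        by (rule set_eq_trichotomy[of y]) (use Z(3,4) in \<open>auto simp: I_def C_def hybrid_def\<close>)
      have h2: "hybrid y Z Z' = I - {y}"
        by (rule set_eq_trichotomy[of y]) (use Z(3,4) in \<open>auto simp: I_def C_def hybrid_def\<close>)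
      note h = h1 h2
      have ZZ1: "Z = (Z \<inter> {..<y}) \<union> (Z \<inter> {y<..})"
        by (rule set_eq_trichotomy[of y]) (use Z(3,4) in auto)
      have ZZ2: "Z' = (Z' \<inter> {..y}) \<union> (Z' \<inter> {y<..})"
        by (rule set_eq_trichotomy[of y]) (use Z(3,4) in auto)
      note ZZ = ZZ1 ZZ2
      have "wt Z * wt Z' \<le> R * (wt I * wt C)" unfolding I_def C_def
        by (rule main[OF refl ZZ refl Z(1,2)]) (use Z y in \<open>auto simp: fam_def\<close>)
      then have "F Z Z' \<le> R * (wt I * wt C) * (G I - G (I - {y}))\<^sup>2"
        unfolding F_def h by (intro mult_right_mono) auto
      then have "F Z Z' \<le> R * E I * wt C" by (simp add: E_def ac_simps)
      then show "\<exists>q\<in>Y. (case q of (I, C) \<Rightarrow> ((C \<inter> {..<y}) \<union> (I \<inter> {y<..}), (I \<inter> {..y}) \<union> (C \<inter> {y<..}))) = p \<and>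
        F (fst p) (snd p) \<le> R * E (fst q) * wt (snd q)"
        using q dec p by (intro bexI[of _ "(I, C)"]) auto
    qed
  qed
  have b: "(\<Sum>p\<in>Xb. F (fst p) (snd p)) \<le> (\<Sum>p\<in>Y. R * E (fst p) * wt (snd p))"
  proof (rule sum_le_included[OF finX(3,4), where i = "\<lambda>(I, C). ((C \<inter> {..<y}) \<union> (I \<inter> {y..}), (I \<inter> {..<y}) \<union> (C \<inter> {y<..}))"])
    show "\<forall>p\<in>Y. 0 \<le> R * E (fst p) * wt (snd p)" using R0 E0 wt_pos by (simp add: less_imp_le)
    show "\<forall>p\<in>Xb. \<exists>q\<in>Y. (case q of (I, C) \<Rightarrow> ((C \<inter> {..<y}) \<union> (I \<inter> {y..}), (I \<inter> {..<y}) \<union> (C \<inter> {y<..}))) = p \<and>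
        F (fst p) (snd p) \<le> R * E (fst q) * wt (snd q)"
    proof
      fix p assume "p \<in> Xb"
      then obtain Z Z' where p: "p = (Z, Z')" and Z: "Z \<in> fam l r" "Z' \<in> fam l r" "y \<in> Z" "y \<notin> Z'"
        by (auto simp: Xb_def X_def)
      define I where "I = (Z' \<inter> {..<y}) \<union> (Z \<inter> {y..})"
      define C where "C = (Z \<inter> {..<y}) \<union> (Z' \<inter> {y<..})"
      have q: "(I, C) \<in> Y" using Z y by (auto simp: Y_def I_def C_def fam_def)
      have dec1: "(C \<inter> {..<y}) \<union> (I \<inter> {y..}) = Z"
        by (rule set_eq_trichotomy[of y]) (use Z(3,4) in \<open>auto simp: I_def C_def hybrid_def\<close>)
      have dec2: "(I \<inter> {..<y}) \<union> (C \<inter> {y<..}) = Z'"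
        by (rule set_eq_trichotomy[of y]) (use Z(3,4) in \<open>auto simp: I_def C_def hybrid_def\<close>)
      note dec = dec1 dec2
      have h1: "hybrid y Z Z' = I"
        by (rule set_eq_trichotomy[of y]) (use Z(3,4) in \<open>auto simp: I_def C_def hybrid_def\<close>)
      have h2: "hybrid (Suc y) Z Z' = I - {y}"
        by (rule set_eq_trichotomy[of y]) (use Z(3,4) in \<open>auto simp: I_def C_def hybrid_def\<close>)
      note h = h1 h2
      have ZZ1: "Z = (Z \<inter> {..<y}) \<union> (Z \<inter> {y..})"
        by (rule set_eq_trichotomy[of y]) (use Z(3,4) in auto)
      have ZZ2: "Z' = (Z' \<inter> {..<y}) \<union> (Z' \<inter> {y<..})"
        by (rule set_eq_trichotomy[of y]) (use Z(3,4) in auto)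
      note ZZ = ZZ1 ZZ2
      have "wt Z * wt Z' \<le> R * (wt I * wt C)" unfolding I_def C_def
        by (rule main[OF refl ZZ refl Z(1,2)]) (use Z y in \<open>auto simp: fam_def\<close>)
      then have "F Z Z' \<le> R * (wt I * wt C) * (G I - G (I - {y}))\<^sup>2"
        unfolding F_def h power2_commute[of "G (I - {y})"] by (intro mult_right_mono) auto
      then have "F Z Z' \<le> R * E I * wt C" by (simp add: E_def ac_simps)
      then show "\<exists>q\<in>Y. (case q of (I, C) \<Rightarrow> ((C \<inter> {..<y}) \<union> (I \<inter> {y..}), (I \<inter> {..<y}) \<union> (C \<inter> {y<..}))) = p \<and>
        F (fst p) (snd p) \<le> R * E (fst q) * wt (snd q)"
        using q dec p by (intro bexI[of _ "(I, C)"]) auto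
    qed
  qed
  have Ysum: "(\<Sum>p\<in>Y. R * E (fst p) * wt (snd p)) = R * (\<Sum>C\<in>fam l r. wt C) * (\<Sum>I\<in>{I \<in> fam l r. y \<in> I}. E I)"
    unfolding Y_def by (simp add: sum.cartesian_product' sum_distrib_left sum_distrib_right ac_simps sum.swap[of _ "fam l r"])
  have "(\<Sum>Z\<in>fam l r. \<Sum>Z'\<in>fam l r. F Z Z') = (\<Sum>p\<in>X. F (fst p) (snd p))"
    unfolding X_def by (simp add: sum.cartesian_product')
  also have "\<dots> = (\<Sum>p\<in>Xa \<union> Xb. F (fst p) (snd p))"
  proof (rule sum.mono_neutral_right[OF finX(1)])
    show "\<forall>p\<in>X - (Xa \<union> Xb). F (fst p) (snd p) = 0"
    proof
      fix p assume "p \<in> X - (Xa \<union> Xb)"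
      then have "y \<in> fst p \<longleftrightarrow> y \<in> snd p" by (cases p) (auto simp: Xa_def Xb_def)
      then show "F (fst p) (snd p) = 0" by (simp add: F_def hy)
    qed
  qed (auto simp: Xa_def Xb_def)
  also have "\<dots> = (\<Sum>p\<in>Xa. F (fst p) (snd p)) + (\<Sum>p\<in>Xb. F (fst p) (snd p))"
    using finX by (intro sum.union_disjoint) (auto simp: Xa_def Xb_def)
  also have "\<dots> \<le> 2 * R * (\<Sum>C\<in>fam l r. wt C) * (\<Sum>I\<in>{I \<in> fam l r. y \<in> I}. E I)"
    using a b unfolding Ysum by simp
  finally show ?thesis by (simp add: F_def E_def)
qed

definition fam_mean :: "(nat set \<Rightarrow> real) \<Rightarrow> nat \<Rightarrow> nat \<Rightarrow> real" where
  "fam_mean G l r = (\<Sum>Z\<in>fam l r. wt Z * G Z) / (\<Sum>Z\<in>fam l r. wt Z)"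

lemma fam_total_pos: "l \<le> r \<Longrightarrow> 0 < (\<Sum>Z\<in>fam l r. wt Z)"
  using finite_fam wt_pos by (intro sum_pos) (auto simp: fam_def)

lemma fam_poincare:
  assumes lr: "l \<le> r" and len: "r \<le> l + m"
  shows "(\<Sum>Z\<in>fam l r. wt Z * (G Z - fam_mean G l r)\<^sup>2) \<le>
    R * real m * (\<Sum>Z\<in>fam l r. \<Sum>y\<in>Z \<inter> {l<..<r}. wt Z * (G Z - G (Z - {y}))\<^sup>2)"
proof -
  define W where "W = (\<Sum>Z\<in>fam l r. wt Z)"
  have W: "0 < W" unfolding W_def by (rule fam_total_pos[OF lr])
  define T where "T = (\<Sum>y\<in>{Suc l..<r}. \<Sum>I\<in>{I \<in> fam l r. y \<in> I}. wt I * (G I - G (I - {y}))\<^sup>2)"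
  have dist: "(G Z' - G Z)\<^sup>2 \<le> real m * (\<Sum>y\<in>{Suc l..<r}. (G (hybrid (Suc y) Z Z') - G (hybrid y Z Z'))\<^sup>2)"
    if Z: "Z \<in> fam l r" "Z' \<in> fam l r" for Z Z'
  proof (cases "l = r")
    case True
    then have "Z = {l}" "Z' = {l}" using Z by (auto simp: fam_def)
    then show ?thesis by (simp add: sum_nonneg)
  next
    case False
    then have le: "Suc l \<le> r" using lr by simp
    have h: "hybrid r Z Z' = Z'" using Z by (auto simp: hybrid_def fam_def) (metis atLeastAtMost_iff le_neq_implies_less subsetD)
    have h': "hybrid (Suc l) Z Z' = Z" using Z by (auto simp: hybrid_def fam_def less_Suc_eq_le dest: subsetD) (metis Suc_leI atLeastAtMost_iff nless_le subsetD)
    have "G Z' - G Z = (\<Sum>y\<in>{Suc l..<r}. G (hybrid (Suc y) Z Z') - G (hybrid y Z Z'))"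
      using sum_Suc_diff'[OF le, of "\<lambda>y. G (hybrid y Z Z')"] h h' by simp
    then have "(G Z' - G Z)\<^sup>2 \<le> (\<Sum>y\<in>{Suc l..<r}. (G (hybrid (Suc y) Z Z') - G (hybrid y Z Z'))\<^sup>2) * real (card {Suc l..<r})"
      using sum_squared_le_sum_of_squares by metis
    also have "\<dots> \<le> (\<Sum>y\<in>{Suc l..<r}. (G (hybrid (Suc y) Z Z') - G (hybrid y Z Z'))\<^sup>2) * real m"
      using len by (intro mult_left_mono) (auto intro: sum_nonneg)
    finally show ?thesis by (simp add: mult.commute)
  qed
  have "2 * W * (\<Sum>Z\<in>fam l r. wt Z * (G Z - fam_mean G l r)\<^sup>2) = (\<Sum>Z\<in>fam l r. \<Sum>Z'\<in>fam l r. wt Z * wt Z' * (G Z' - G Z)\<^sup>2)"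
    using weighted_variance_pairs[OF finite_fam W_def, of G] W by (simp add: fam_mean_def W_def)
  also have "\<dots> \<le> (\<Sum>Z\<in>fam l r. \<Sum>Z'\<in>fam l r. wt Z * wt Z' *
       (real m * (\<Sum>y\<in>{Suc l..<r}. (G (hybrid (Suc y) Z Z') - G (hybrid y Z Z'))\<^sup>2)))"
    using dist wt_pos by (intro sum_mono mult_left_mono) (auto simp: less_imp_le)
  also have "\<dots> = real m * (\<Sum>Z\<in>fam l r. \<Sum>Z'\<in>fam l r. \<Sum>y\<in>{Suc l..<r}. wt Z * wt Z' * (G (hybrid (Suc y) Z Z') - G (hybrid y Z Z'))\<^sup>2)"
    by (simp add: sum_distrib_left ac_simps)
  also have "(\<Sum>Z\<in>fam l r. \<Sum>Z'\<in>fam l r. \<Sum>y\<in>{Suc l..<r}. wt Z * wt Z' * (G (hybrid (Suc y) Z Z') - G (hybrid y Z Z'))\<^sup>2) =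
     (\<Sum>y\<in>{Suc l..<r}. \<Sum>Z\<in>fam l r. \<Sum>Z'\<in>fam l r. wt Z * wt Z' * (G (hybrid (Suc y) Z Z') - G (hybrid y Z Z'))\<^sup>2)"
    by (subst (2) sum.swap, subst (1) sum.swap, rule refl)
  also have "real m * \<dots> \<le> real m * (\<Sum>y\<in>{Suc l..<r}. 2 * R * W * (\<Sum>I\<in>{I \<in> fam l r. y \<in> I}. wt I * (G I - G (I - {y}))\<^sup>2))"
    unfolding W_def using len by (intro mult_left_mono sum_mono hybrid_step_sum) auto
  also have "\<dots> = 2 * W * (R * real m * T)" by (simp add: T_def sum_distrib_left ac_simps)
  finally have "(\<Sum>Z\<in>fam l r. wt Z * (G Z - fam_mean G l r)\<^sup>2) \<le> R * real m * T" using W by simp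
  also have "T = (\<Sum>Z\<in>fam l r. \<Sum>y\<in>Z \<inter> {l<..<r}. wt Z * (G Z - G (Z - {y}))\<^sup>2)"
  proof -
    have "T = (\<Sum>y\<in>{Suc l..<r}. \<Sum>I\<in>fam l r. if y \<in> I then wt I * (G I - G (I - {y}))\<^sup>2 else 0)"
      unfolding T_def using finite_fam by (intro sum.cong refl sum.inter_filter)
    also have "\<dots> = (\<Sum>I\<in>fam l r. \<Sum>y\<in>{Suc l..<r}. if y \<in> I then wt I * (G I - G (I - {y}))\<^sup>2 else 0)"
      by (rule sum.swap)
    also have "\<dots> = (\<Sum>I\<in>fam l r. \<Sum>y\<in>I \<inter> {l<..<r}. wt I * (G I - G (I - {y}))\<^sup>2)"
    proof (rule sum.cong[OF refl])
      fix I assume "I \<in> fam l r"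
      have "(\<Sum>y\<in>{Suc l..<r}. if y \<in> I then wt I * (G I - G (I - {y}))\<^sup>2 else 0) = (\<Sum>y\<in>{y \<in> {Suc l..<r}. y \<in> I}. wt I * (G I - G (I - {y}))\<^sup>2)"
        by (subst sum.inter_filter) auto
      also have "{y \<in> {Suc l..<r}. y \<in> I} = I \<inter> {l<..<r}" by auto
      finally show "(\<Sum>y\<in>{Suc l..<r}. if y \<in> I then wt I * (G I - G (I - {y}))\<^sup>2 else 0) = (\<Sum>y\<in>I \<inter> {l<..<r}. wt I * (G I - G (I - {y}))\<^sup>2)" .
    qed
    finally show ?thesis .
  qed
  finally show ?thesis .
qed

end

lemma mean_difference_le:
  fixes w G :: "'a \<Rightarrow> real"
  assumes fin: "finite F1" "finite F2" and B: "B \<subseteq> F1" and inj: "inj_on \<phi> B" and im: "\<phi> ` B \<subseteq> F2"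
    and w: "\<And>Z. 0 \<le> w Z" and c1: "(\<Sum>Z\<in>F1. w Z) \<le> c1 * (\<Sum>Z\<in>B. w Z)" "0 \<le> c1"
    and c2: "\<And>Z. Z \<in> B \<Longrightarrow> w Z \<le> c2 * w (\<phi> Z)" "0 \<le> c2"
  shows "(\<Sum>Z\<in>F1. w Z) * (m1 - m2)\<^sup>2 \<le> 3 * c1 * ((\<Sum>Z\<in>F1. w Z * (G Z - m1)\<^sup>2) +
    (\<Sum>Z\<in>B. w Z * (G Z - G (\<phi> Z))\<^sup>2) + c2 * (\<Sum>Z\<in>F2. w Z * (G Z - m2)\<^sup>2))"
proof -
  have sq: "(m1 - m2)\<^sup>2 \<le> 3 * ((x - m1)\<^sup>2 + (x - y)\<^sup>2 + (y - m2)\<^sup>2)" for x y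
  proof -
    define u where "u = m1 - x"
    define v where "v = x - y"
    define t where "t = y - m2"
    have "(u + v + t)\<^sup>2 \<le> 3 * (u\<^sup>2 + v\<^sup>2 + t\<^sup>2)"
    proof -
      have "3 * (u\<^sup>2 + v\<^sup>2 + t\<^sup>2) - (u + v + t)\<^sup>2 = (u - v)\<^sup>2 + (v - t)\<^sup>2 + (u - t)\<^sup>2"
        by (simp add: power2_eq_square algebra_simps)
      then show ?thesis by (smt (verit) zero_le_power2)
    qed
    then show ?thesis by (simp add: u_def v_def t_def power2_commute[of m1 x])
  qed
  have finB: "finite B" using B fin finite_subset by blast
  have "(\<Sum>Z\<in>B. w Z) * (m1 - m2)\<^sup>2 = (\<Sum>Z\<in>B. w Z * (m1 - m2)\<^sup>2)" by (simp add: sum_distrib_right)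
  also have "\<dots> \<le> (\<Sum>Z\<in>B. w Z * (3 * ((G Z - m1)\<^sup>2 + (G Z - G (\<phi> Z))\<^sup>2 + (G (\<phi> Z) - m2)\<^sup>2)))"
    using sq w by (intro sum_mono mult_left_mono) auto
  also have "\<dots> = 3 * ((\<Sum>Z\<in>B. w Z * (G Z - m1)\<^sup>2) + (\<Sum>Z\<in>B. w Z * (G Z - G (\<phi> Z))\<^sup>2) + (\<Sum>Z\<in>B. w Z * (G (\<phi> Z) - m2)\<^sup>2))"
    by (simp add: sum.distrib sum_distrib_left algebra_simps)
  finally have 1: "(\<Sum>Z\<in>B. w Z) * (m1 - m2)\<^sup>2 \<le> 3 * ((\<Sum>Z\<in>B. w Z * (G Z - m1)\<^sup>2) + (\<Sum>Z\<in>B. w Z * (G Z - G (\<phi> Z))\<^sup>2) + (\<Sum>Z\<in>B. w Z * (G (\<phi> Z) - m2)\<^sup>2))" .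
  have 2: "(\<Sum>Z\<in>B. w Z * (G Z - m1)\<^sup>2) \<le> (\<Sum>Z\<in>F1. w Z * (G Z - m1)\<^sup>2)"
    using fin B w by (intro sum_mono2) auto
  have "(\<Sum>Z\<in>B. w Z * (G (\<phi> Z) - m2)\<^sup>2) \<le> (\<Sum>Z\<in>B. c2 * w (\<phi> Z) * (G (\<phi> Z) - m2)\<^sup>2)"
    using c2 by (intro sum_mono mult_right_mono) auto
  also have "\<dots> = c2 * (\<Sum>Z\<in>\<phi> ` B. w Z * (G Z - m2)\<^sup>2)"
    by (simp add: sum.reindex[OF inj] sum_distrib_left mult.assoc)
  also have "\<dots> \<le> c2 * (\<Sum>Z\<in>F2. w Z * (G Z - m2)\<^sup>2)"
    using c2 fin im w by (intro mult_left_mono sum_mono2) auto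
  finally have 3: "(\<Sum>Z\<in>B. w Z * (G (\<phi> Z) - m2)\<^sup>2) \<le> c2 * (\<Sum>Z\<in>F2. w Z * (G Z - m2)\<^sup>2)" .
  have "(\<Sum>Z\<in>F1. w Z) * (m1 - m2)\<^sup>2 \<le> c1 * (\<Sum>Z\<in>B. w Z) * (m1 - m2)\<^sup>2"
    using c1 by (intro mult_right_mono) auto
  also have "\<dots> = c1 * ((\<Sum>Z\<in>B. w Z) * (m1 - m2)\<^sup>2)" by simp
  also have "\<dots> \<le> c1 * (3 * ((\<Sum>Z\<in>F1. w Z * (G Z - m1)\<^sup>2) +
    (\<Sum>Z\<in>B. w Z * (G Z - G (\<phi> Z))\<^sup>2) + c2 * (\<Sum>Z\<in>F2. w Z * (G Z - m2)\<^sup>2)))"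
    using 1 2 3 c1(2) by (intro mult_left_mono) auto
  finally show ?thesis by (simp only: mult.assoc mult.left_commute[of c1])
qed

context renewal
begin

lemma fam_mass_le_insert:
  assumes y: "l < y" "y < r" and c: "0 \<le> c"
    and Kb: "\<And>p q. l \<le> p \<Longrightarrow> p < y \<Longrightarrow> y < q \<Longrightarrow> q \<le> r \<Longrightarrow>
       K (q - p) \<le> c * (K (y - p) * K (q - y))"
  shows "(\<Sum>Z\<in>fam l r. wt Z) \<le> (1 + c / lam) * (\<Sum>Z\<in>{Z \<in> fam l r. y \<in> Z}. wt Z)"
proof -
  define F where "F = {Z \<in> fam l r. y \<in> Z}"
  define F' where "F' = {Z \<in> fam l r. y \<notin> Z}"
  have fin: "finite F" "finite F'" using finite_fam by (auto simp: F_def F'_def)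
  have ins: "wt Z \<le> c / lam * wt (insert y Z)" if "Z \<in> F'" for Z
  proof -
    have Z: "Z \<in> fam l r" "y \<notin> Z" "finite Z" using that fam_finite by (auto simp: F'_def)
    define A where "A = Z \<inter> {..<y}"
    define B where "B = Z \<inter> {y<..}"
    have ne: "A \<noteq> {}" "B \<noteq> {}" using Z y by (auto simp: A_def B_def fam_def)
    have f: "finite A" "finite B" using Z by (auto simp: A_def B_def)
    have mem: "Max A \<in> A" "Min B \<in> B" using f ne by auto
    have K: "K (Min B - Max A) \<le> c * (K (y - Max A) * K (Min B - y))"
      using mem Z by (intro Kb) (auto simp: A_def B_def fam_def)
    note k = gap_weight_insert[OF Z(3,2) A_def ne(1) B_def ne(2)]
    define c0 where "c0 = lam ^ card Z * gap_weight A * gap_weight B"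
    have c0: "0 \<le> c0" using lam_pos gap_weight_pos by (simp add: c0_def less_imp_le)
    have "wt Z = c0 * K (Min B - Max A)" by (simp add: wt_def k c0_def)
    also have "\<dots> \<le> c0 * (c * (K (y - Max A) * K (Min B - y)))" by (rule mult_left_mono[OF K c0])
    also have "\<dots> = c / lam * wt (insert y Z)"
      using Z lam_pos by (simp add: wt_def k c0_def)
    finally show ?thesis .
  qed
  have "(\<Sum>Z\<in>F'. wt Z) \<le> (\<Sum>Z\<in>F. (c / lam) * wt Z)"
  proof (rule sum_le_included[OF fin(2,1), where i = "\<lambda>Z. Z - {y}"])
    show "\<forall>Z\<in>F. 0 \<le> c / lam * wt Z" using c lam_pos wt_pos by (simp add: less_imp_le)
    show "\<forall>Z\<in>F'. \<exists>Z'\<in>F. Z' - {y} = Z \<and> wt Z \<le> c / lam * wt Z'"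
    proof
      fix Z assume Z: "Z \<in> F'"
      then show "\<exists>Z'\<in>F. Z' - {y} = Z \<and> wt Z \<le> c / lam * wt Z'"
        using ins[OF Z] y by (intro bexI[of _ "insert y Z"]) (auto simp: F_def F'_def fam_def)
    qed
  qed
  moreover have "(\<Sum>Z\<in>fam l r. wt Z) = (\<Sum>Z\<in>F. wt Z) + (\<Sum>Z\<in>F'. wt Z)"
    using fin by (subst sum.union_disjoint[symmetric]) (auto simp: F_def F'_def intro!: sum.cong)
  ultimately show ?thesis unfolding F_def[symmetric] sum_distrib_left[symmetric] distrib_right by simp
qed

lemma fam_mass_le_insert_first:
  assumes "l < r"
  shows "(\<Sum>Z\<in>fam l r. wt Z) \<le> (1 + 4 / lam) * (\<Sum>Z\<in>{Z \<in> fam l r. Suc l \<in> Z}. wt Z)"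
proof (cases "Suc l = r")
  case True
  have "(1 :: real) \<le> 1 + 4 / lam" using lam_pos by simp
  moreover have "{Z \<in> fam l r. Suc l \<in> Z} = fam l r" using True by (auto simp: fam_def)
  ultimately show ?thesis using fam_total_pos[of l r] assms by (simp add: mult_le_cancel_right1)
next
  case False
  show ?thesis
  proof (rule fam_mass_le_insert)
    fix p q assume h: "l \<le> p" "p < Suc l" "Suc l < q" "q \<le> r"
    then have "q - p = Suc (q - Suc l)" "Suc l - p = 1" by auto
    then show "K (q - p) \<le> 4 * (K (Suc l - p) * K (q - Suc l))"
      using K_Suc[of "q - Suc l"] K_1 h by (simp only:) simp
  qed (use assms False in auto)
qed

lemma fam_mass_le_insert_last:
  assumes "l < r"
  shows "(\<Sum>Z\<in>fam l r. wt Z) \<le> (1 + 4 / lam) * (\<Sum>Z\<in>{Z \<in> fam l r. r - 1 \<in> Z}. wt Z)"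
proof (cases "l = r - 1")
  case True
  have "(1 :: real) \<le> 1 + 4 / lam" using lam_pos by simp
  moreover have "{Z \<in> fam l r. r - 1 \<in> Z} = fam l r" using True by (auto simp: fam_def)
  ultimately show ?thesis using fam_total_pos[of l r] assms by (simp add: mult_le_cancel_right1)
next
  case False
  show ?thesis
  proof (rule fam_mass_le_insert)
    fix p q assume h: "l \<le> p" "p < r - 1" "r - 1 < q" "q \<le> r"
    then have "q = r" "r - p = Suc (r - 1 - p)" "r - (r - 1) = 1" by auto
    then show "K (q - p) \<le> 4 * (K (r - 1 - p) * K (q - (r - 1)))"
      using K_Suc[of "r - 1 - p"] K_1 h by simp
  qed (use assms False in auto)
qed

definition bridge_mass :: "nat \<Rightarrow> real" where
  "bridge_mass k = (\<Sum>Z\<in>fam 0 k. wt Z)"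

lemma fam_total: "l \<le> r \<Longrightarrow> (\<Sum>Z\<in>fam l r. wt Z) = bridge_mass (r - l)"
proof -
  assume lr: "l \<le> r"
  have "(\<Sum>Z\<in>fam 0 (r - l). wt Z) = (\<Sum>Z\<in>fam l r. wt Z)"
  proof (rule sum.reindex_bij_witness[of _ "\<lambda>Z. (\<lambda>x. x - l) ` Z" "\<lambda>Z. (+) l ` Z"])
    fix Z assume Z: "Z \<in> fam 0 (r - l)"
    show "(\<lambda>x. x - l) ` (+) l ` Z = Z" by (simp add: image_image)
    show "(+) l ` Z \<in> fam l r"
      using Z lr by (auto simp: fam_def image_iff subset_iff intro!: bexI[of _ "r - l"])
    have "finite Z" using Z fam_finite by blast
    then show "wt ((+) l ` Z) = wt Z" by (simp add: wt_def gap_weight_shift card_image)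
  next
    fix Z assume Z: "Z \<in> fam l r"
    show "(+) l ` (\<lambda>x. x - l) ` Z = Z"
      using Z by (force simp: image_image fam_def)
    show "(\<lambda>x. x - l) ` Z \<in> fam 0 (r - l)"
      using Z by (auto simp: fam_def image_iff subset_iff)
  qed
  then show ?thesis by (simp add: bridge_mass_def)
qed

lemma bridge_mass_pos: "0 < bridge_mass k"
  unfolding bridge_mass_def by (rule fam_total_pos) simp

lemma bridge_mass_0: "bridge_mass 0 = lam"
proof -
  have "fam 0 0 = {{0}}" by (auto simp: fam_def)
  then show ?thesis by (simp add: bridge_mass_def wt_def)
qed

lemma bridge_mass_1: "bridge_mass 1 = lam\<^sup>2"
proof -
  have "fam 0 1 = {{0, 1}}" by (auto simp: fam_def)
  moreover have "gap_weight {0, 1} = 1" using gap_weight_join[of "{0}" "{1}"] K_1 by (simp add: insert_commute)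
  ultimately show ?thesis by (simp add: bridge_mass_def wt_def power2_eq_square)
qed

lemma fam_pinned_total:
  assumes "l \<le> y" "y \<le> r"
  shows "(\<Sum>Z\<in>{Z \<in> fam l r. y \<in> Z}. wt Z) = bridge_mass (y - l) * bridge_mass (r - y) / lam"
proof -
  have "bridge_mass (y - l) * bridge_mass (r - y) = (\<Sum>p\<in>fam l y \<times> fam y r. wt (fst p) * wt (snd p))"
    unfolding fam_total[OF assms(1), symmetric] fam_total[OF assms(2), symmetric] sum_product
    by (simp add: sum.cartesian_product split_def)
  also have "\<dots> = (\<Sum>Z\<in>{Z \<in> fam l r. y \<in> Z}. lam * wt Z)"
  proof (rule sum.reindex_bij_witness[of _ "\<lambda>Z. (Z \<inter> {..y}, Z \<inter> {y..})" "\<lambda>p. fst p \<union> snd p"])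
    fix Z assume Z: "Z \<in> {Z \<in> fam l r. y \<in> Z}"
    show "fst (Z \<inter> {..y}, Z \<inter> {y..}) \<union> snd (Z \<inter> {..y}, Z \<inter> {y..}) = Z" by auto
    show "(Z \<inter> {..y}, Z \<inter> {y..}) \<in> fam l y \<times> fam y r" using Z assms by (auto simp: fam_def)
  next
    fix p assume "p \<in> fam l y \<times> fam y r"
    then obtain A B where p: "p = (A, B)" "A \<in> fam l y" "B \<in> fam y r" by auto
    have i: "(A \<union> B) \<inter> {..y} = A" "(A \<union> B) \<inter> {y..} = B" "A \<inter> B = {y}" using p by (fastforce simp: fam_def)+
    show "((fst p \<union> snd p) \<inter> {..y}, (fst p \<union> snd p) \<inter> {y..}) = p" using p i by simp
    show "fst p \<union> snd p \<in> {Z \<in> fam l r. y \<in> Z}" using p assms by (auto simp: fam_def)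
    have f: "finite A" "finite B" using p fam_finite by auto
    have "card A + card B = Suc (card (A \<union> B))" using card_Un_Int[OF f] i by simp
    moreover have "gap_weight (A \<union> B) = gap_weight A * gap_weight B" using gap_weight_split[of "A \<union> B" y] f i p by (auto simp: fam_def)
    ultimately show "lam * wt (fst p \<union> snd p) = wt (fst p) * wt (snd p)"
      using p by (simp add: wt_def power_add[symmetric] flip: power_Suc)
  qed
  also have "\<dots> = lam * (\<Sum>Z\<in>{Z \<in> fam l r. y \<in> Z}. wt Z)" by (simp add: sum_distrib_left)
  finally show ?thesis using lam_pos by simp
qed

lemma bridge_mass_supermult: "bridge_mass i * bridge_mass j \<le> lam * bridge_mass (i + j)"
proof -
  have "bridge_mass i * bridge_mass j / lam \<le> bridge_mass (i + j)"
    using fam_pinned_total[of 0 i "i + j"] sum_mono2[of "fam 0 (i + j)" "{Z \<in> fam 0 (i + j). i \<in> Z}" wt]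
      finite_fam wt_pos by (auto simp: bridge_mass_def less_imp_le)
  then show ?thesis using lam_pos by (simp add: field_simps)
qed

lemma bridge_mass_submult: "i + j \<le> m \<Longrightarrow> bridge_mass (i + j) \<le> (1 + R / lam) * (bridge_mass i * bridge_mass j / lam)"
proof -
  assume le: "i + j \<le> m"
  have c: "1 \<le> 1 + R / lam" using R_pos lam_pos by simp
  consider "i = 0" | "j = 0" | "0 < i" "0 < j" by blast
  then show ?thesis
  proof cases
    case 1
    then show ?thesis using c bridge_mass_pos[of j] lam_pos by (simp add: bridge_mass_0 mult_le_cancel_right1)
  next
    case 2
    then show ?thesis using c bridge_mass_pos[of i] lam_pos by (simp add: bridge_mass_0 mult_le_cancel_right1)
  next
    case 3
    have "(\<Sum>Z\<in>fam 0 (i + j). wt Z) \<le> (1 + R / lam) * (\<Sum>Z\<in>{Z \<in> fam 0 (i + j). i \<in> Z}. wt Z)"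
    proof (rule fam_mass_le_insert)
      fix p q assume h: "0 \<le> p" "p < i" "i < q" "q \<le> i + j"
      then have "q - p = (i - p) + (q - i)" by simp
      then show "K (q - p) \<le> R * (K (i - p) * K (q - i))"
        using K_insert[of "i - p" "q - i"] h le by simp
    qed (use 3 R_pos in auto)
    then show ?thesis using fam_pinned_total[of 0 i "i + j"] by (simp add: bridge_mass_def)
  qed
qed

lemma bridge_mass_swap: "i + j = k + l \<Longrightarrow> i + j \<le> m \<Longrightarrow> bridge_mass i * bridge_mass j \<le> (1 + R / lam) * (bridge_mass k * bridge_mass l)"
proof -
  assume h: "i + j = k + l" "i + j \<le> m"
  have "bridge_mass i * bridge_mass j \<le> lam * bridge_mass (k + l)" using bridge_mass_supermult[of i j] h by simp
  also have "\<dots> \<le> lam * ((1 + R / lam) * (bridge_mass k * bridge_mass l / lam))"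
    using bridge_mass_submult[of k l] h lam_pos by (intro mult_left_mono) auto
  also have "\<dots> = (1 + R / lam) * (bridge_mass k * bridge_mass l)" using lam_pos by simp
  finally show ?thesis .
qed

lemma bridge_mass_Suc: "lam * bridge_mass k \<le> bridge_mass (Suc k)"
  using bridge_mass_supermult[of k 1] bridge_mass_1 lam_pos by (simp add: power2_eq_square mult.commute)

end

section \<open>Motion of the end points\<close>

locale pinned_renewal = renewal K lam R m for K :: "nat \<Rightarrow> real" and lam R :: real and m :: nat +
  fixes V :: "nat \<Rightarrow> real" and n \<beta> :: nat and Cv Cg :: real
  assumes m_large: "2 * n \<le> m" and Cv_pos: "0 < Cv" and Cg_pos: "0 < Cg"
    and V_pos: "\<And>i. \<beta> \<le> i \<Longrightarrow> i \<le> n \<Longrightarrow> 0 < V i"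
    and V_mono: "\<And>i. \<beta> \<le> i \<Longrightarrow> i < n \<Longrightarrow> V i \<le> V (Suc i)"
    and V_growth: "\<And>i. \<beta> \<le> i \<Longrightarrow> i < n \<Longrightarrow> V (Suc i) \<le> Cg * V i"
    and V_swap: "\<And>i j k l. \<beta> \<le> i \<Longrightarrow> i \<le> k \<Longrightarrow> k \<le> j \<Longrightarrow> j \<le> n \<Longrightarrow> i + j = k + l \<Longrightarrow>
       V i * V j \<le> Cv * (V k * V l)"
begin

definition admissible :: "nat \<Rightarrow> nat \<Rightarrow> bool" where
  "admissible l r \<longleftrightarrow> \<beta> \<le> l \<and> l \<le> r \<and> r + \<beta> \<le> n"

definition zsets :: "nat set set" where
  "zsets = {Z. Z \<noteq> {} \<and> Z \<subseteq> {\<beta>..n - \<beta>}}"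

definition mu :: "nat set \<Rightarrow> real" where
  "mu Z = V (Min Z) * wt Z * V (n - Max Z)"

definition nu :: "nat \<Rightarrow> nat \<Rightarrow> real" where
  "nu l r = V l * bridge_mass (r - l) * V (n - r)"

definition toggle_energy :: "(nat set \<Rightarrow> real) \<Rightarrow> real" where
  "toggle_energy G = (\<Sum>I\<in>zsets. \<Sum>z\<in>I. if I = {z} then 0 else mu I * (G I - G (I - {z}))\<^sup>2)"

lemma finite_zsets: "finite zsets"
  by (rule finite_subset[of _ "Pow {\<beta>..n - \<beta>}"]) (auto simp: zsets_def)

lemma zsets_finite: "Z \<in> zsets \<Longrightarrow> finite Z"
  by (auto simp: zsets_def intro: finite_subset)

lemma mu_pos: "Z \<in> zsets \<Longrightarrow> 0 < mu Z"
proof -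
  assume Z: "Z \<in> zsets"
  have f: "finite Z" "Z \<noteq> {}" using Z zsets_finite by (auto simp: zsets_def)
  then have "Min Z \<in> Z" "Max Z \<in> Z" by auto
  then have "\<beta> \<le> Min Z" "Min Z \<le> n" "\<beta> \<le> Max Z" "Max Z \<le> n - \<beta>"
    using Z by (auto simp: zsets_def subset_iff)
  then show ?thesis using wt_pos[of Z] V_pos[of "Min Z"] V_pos[of "n - Max Z"] by (simp add: mu_def)
qed

lemma V_ends_pos: "admissible l r \<Longrightarrow> 0 < V l \<and> 0 < V (n - r)"
  by (auto simp: admissible_def intro!: V_pos)

lemma nu_pos: "admissible l r \<Longrightarrow> 0 < nu l r"
  using V_ends_pos[of l r] bridge_mass_pos[of "r - l"] by (simp add: nu_def)

lemma fam_sub_zsets: "admissible l r \<Longrightarrow> fam l r \<subseteq> zsets"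
  by (force simp: fam_def zsets_def admissible_def)

lemma fam_Min_Max: "Z \<in> fam l r \<Longrightarrow> Min Z = l \<and> Max Z = r"
proof -
  assume Z: "Z \<in> fam l r"
  then have "finite Z" using fam_finite by blast
  then show ?thesis using Z by (auto simp: fam_def intro!: Min_eqI Max_eqI)
qed

lemma fam_mu: "Z \<in> fam l r \<Longrightarrow> mu Z = V l * V (n - r) * wt Z"
  using fam_Min_Max by (simp add: mu_def)

lemma fam_mu_total: "admissible l r \<Longrightarrow> (\<Sum>Z\<in>fam l r. mu Z) = nu l r"
  using fam_total[of l r] by (simp add: fam_mu nu_def admissible_def flip: sum_distrib_left)

lemma toggle_energy_ge:
  assumes S: "S \<subseteq> zsets" and Y: "\<And>Z. Z \<in> S \<Longrightarrow> Y Z \<subseteq> Z" "\<And>Z y. Z \<in> S \<Longrightarrow> y \<in> Y Z \<Longrightarrow> Z \<noteq> {y}"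
  shows "(\<Sum>Z\<in>S. \<Sum>y\<in>Y Z. mu Z * (G Z - G (Z - {y}))\<^sup>2) \<le> toggle_energy G"
proof -
  have nn: "0 \<le> (if I = {z} then 0 else mu I * (G I - G (I - {z}))\<^sup>2)" if "I \<in> zsets" for I z
    using mu_pos[OF that] by simp
  have "(\<Sum>Z\<in>S. \<Sum>y\<in>Y Z. mu Z * (G Z - G (Z - {y}))\<^sup>2) =
      (\<Sum>Z\<in>S. \<Sum>z\<in>Y Z. if Z = {z} then 0 else mu Z * (G Z - G (Z - {z}))\<^sup>2)"
    using Y(2) by (intro sum.cong refl) auto
  also have "\<dots> \<le> (\<Sum>Z\<in>S. \<Sum>z\<in>Z. if Z = {z} then 0 else mu Z * (G Z - G (Z - {z}))\<^sup>2)"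
    using S Y(1) zsets_finite by (intro sum_mono sum_mono2 nn) auto
  also have "\<dots> \<le> toggle_energy G" unfolding toggle_energy_def
    using S finite_zsets by (intro sum_mono2 sum_nonneg nn) auto
  finally show ?thesis .
qed

lemma toggle_energy_nonneg: "0 \<le> toggle_energy G"
  using toggle_energy_ge[of "{}"] by simp

lemma fam_mu_variance:
  assumes D: "admissible l r"
  shows "(\<Sum>Z\<in>fam l r. mu Z * (G Z - fam_mean G l r)\<^sup>2) \<le> R * real m * toggle_energy G"
proof -
  define c where "c = V l * V (n - r)"
  have c: "0 \<le> c" using V_ends_pos[OF D] by (simp add: c_def)
  have "(\<Sum>Z\<in>fam l r. mu Z * (G Z - fam_mean G l r)\<^sup>2) = c * (\<Sum>Z\<in>fam l r. wt Z * (G Z - fam_mean G l r)\<^sup>2)"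
    unfolding sum_distrib_left by (intro sum.cong refl) (simp add: fam_mu c_def)
  also have "\<dots> \<le> c * (R * real m * (\<Sum>Z\<in>fam l r. \<Sum>y\<in>Z \<inter> {l<..<r}. wt Z * (G Z - G (Z - {y}))\<^sup>2))"
    using D m_large by (intro mult_left_mono[OF _ c] fam_poincare) (auto simp: admissible_def)
  also have "\<dots> = R * real m * (\<Sum>Z\<in>fam l r. \<Sum>y\<in>Z \<inter> {l<..<r}. mu Z * (G Z - G (Z - {y}))\<^sup>2)"
    unfolding sum_distrib_left by (intro sum.cong refl) (simp add: fam_mu c_def)
  also have "\<dots> \<le> R * real m * toggle_energy G"
    using fam_sub_zsets[OF D] R_pos by (intro mult_left_mono toggle_energy_ge) (auto simp: fam_def)
  finally show ?thesis .
qed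

definition edge_bound :: "(nat set \<Rightarrow> real) \<Rightarrow> real" where
  "edge_bound G = 3 * (1 + 4 / lam) * ((1 + lam) * (R * real m) + 1) * toggle_energy G"

lemma boundary_edge:
  assumes D: "admissible l r" and D': "admissible l' r'" and B: "B \<subseteq> fam l r" and u: "\<And>Z. Z \<in> B \<Longrightarrow> u \<in> Z \<and> Z \<noteq> {u}"
    and im: "(\<lambda>Z. Z - {u}) ` B \<subseteq> fam l' r'"
    and mass: "(\<Sum>Z\<in>fam l r. wt Z) \<le> (1 + 4 / lam) * (\<Sum>Z\<in>B. wt Z)"
    and w: "\<And>Z. Z \<in> B \<Longrightarrow> wt Z = lam * wt (Z - {u})" and V: "V l * V (n - r) \<le> V l' * V (n - r')"
  shows "nu l r * (fam_mean G l r - fam_mean G l' r')\<^sup>2 \<le> edge_bound G"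
proof -
  have VV: "0 \<le> V l * V (n - r)" using V_ends_pos[OF D] by simp
  have mass': "(\<Sum>Z\<in>fam l r. mu Z) \<le> (1 + 4 / lam) * (\<Sum>Z\<in>B. mu Z)"
  proof -
    have "(\<Sum>Z\<in>fam l r. mu Z) = V l * V (n - r) * (\<Sum>Z\<in>fam l r. wt Z)"
      unfolding sum_distrib_left by (intro sum.cong refl fam_mu)
    also have "\<dots> \<le> V l * V (n - r) * ((1 + 4 / lam) * (\<Sum>Z\<in>B. wt Z))"
      by (rule mult_left_mono[OF mass VV])
    also have "\<dots> = (1 + 4 / lam) * (\<Sum>Z\<in>B. V l * V (n - r) * wt Z)"
      unfolding sum_distrib_left[symmetric] by (simp only: mult_ac)
    also have "(\<Sum>Z\<in>B. V l * V (n - r) * wt Z) = (\<Sum>Z\<in>B. mu Z)" using B fam_mu by (intro sum.cong) auto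
    finally show ?thesis .
  qed
  have c2: "mu Z \<le> lam * mu (Z - {u})" if Z: "Z \<in> B" for Z
  proof -
    have Zf: "Z \<in> fam l r" "Z - {u} \<in> fam l' r'" using Z B im by auto
    have "V l * V (n - r) * wt Z \<le> V l' * V (n - r') * wt Z"
      using V wt_pos[of Z] by (intro mult_right_mono) auto
    then show ?thesis using fam_mu[OF Zf(1)] fam_mu[OF Zf(2)] w[OF Z] by (simp add: mult_ac)
  qed
  define mu' where "mu' Z = (if Z \<in> zsets then mu Z else 0)" for Z
  have sub: "fam l r \<subseteq> zsets" "fam l' r' \<subseteq> zsets" using fam_sub_zsets D D' by auto
  have BZ: "B \<subseteq> zsets" "(\<lambda>Z. Z - {u}) ` B \<subseteq> zsets" using B im sub by auto
  have eqs: "(\<Sum>Z\<in>S. mu' Z * h Z) = (\<Sum>Z\<in>S. mu Z * h Z)" "(\<Sum>Z\<in>S. mu' Z) = (\<Sum>Z\<in>S. mu Z)" if "S \<subseteq> zsets" for S h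
    using that by (auto simp: mu'_def intro!: sum.cong)
  have "(\<Sum>Z\<in>fam l r. mu' Z) * (fam_mean G l r - fam_mean G l' r')\<^sup>2 \<le> 3 * (1 + 4 / lam) *
    ((\<Sum>Z\<in>fam l r. mu' Z * (G Z - fam_mean G l r)\<^sup>2) + (\<Sum>Z\<in>B. mu' Z * (G Z - G (Z - {u}))\<^sup>2) +
     lam * (\<Sum>Z\<in>fam l' r'. mu' Z * (G Z - fam_mean G l' r')\<^sup>2))"
  proof (rule mean_difference_le[OF finite_fam finite_fam B _ im])
    show "inj_on (\<lambda>Z. Z - {u}) B"
    proof (rule inj_onI)
      fix X Y assume "X \<in> B" "Y \<in> B" "X - {u} = Y - {u}"
      then show "X = Y" using u insert_Diff by metis
    qed
    show "0 \<le> mu' Z" for Z using mu_pos[of Z] by (auto simp: mu'_def)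
    show "(\<Sum>Z\<in>fam l r. mu' Z) \<le> (1 + 4 / lam) * (\<Sum>Z\<in>B. mu' Z)" using mass' eqs sub BZ by simp
    show "mu' Z \<le> lam * mu' (Z - {u})" if "Z \<in> B" for Z using c2[OF that] that BZ by (auto simp: mu'_def)
  qed (use lam_pos in auto)
  also have "\<dots> \<le> 3 * (1 + 4 / lam) * (R * real m * toggle_energy G + toggle_energy G + lam * (R * real m * toggle_energy G))"
  proof (intro mult_left_mono add_mono)
    have "(\<Sum>Z\<in>B. \<Sum>y\<in>{u}. mu Z * (G Z - G (Z - {y}))\<^sup>2) \<le> toggle_energy G"
      by (rule toggle_energy_ge) (use BZ u in auto)
    then show "(\<Sum>Z\<in>B. mu' Z * (G Z - G (Z - {u}))\<^sup>2) \<le> toggle_energy G"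
      using eqs(1)[OF BZ(1)] by simp
  qed (use fam_mu_variance D D' sub lam_pos in \<open>auto simp: eqs(1)\<close>)
  also have "\<dots> = edge_bound G" by (simp add: edge_bound_def algebra_simps)
  finally show ?thesis using fam_mu_total[OF D] eqs(2)[OF sub(1)] by simp
qed

lemma left_edge:
  assumes D: "admissible l r" and lr: "l < r"
  shows "nu l r * (fam_mean G l r - fam_mean G (Suc l) r)\<^sup>2 \<le> edge_bound G"
proof (rule boundary_edge[where B = "{Z \<in> fam l r. Suc l \<in> Z}" and u = l])
  show "admissible (Suc l) r" using D lr by (simp add: admissible_def)
  show im: "(\<lambda>Z. Z - {l}) ` {Z \<in> fam l r. Suc l \<in> Z} \<subseteq> fam (Suc l) r"
    using lr by (auto simp: fam_def Suc_le_eq subset_iff)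
  show "(\<Sum>Z\<in>fam l r. wt Z) \<le> (1 + 4 / lam) * (\<Sum>Z\<in>{Z \<in> fam l r. Suc l \<in> Z}. wt Z)"
    by (rule fam_mass_le_insert_first[OF lr])
  show "wt Z = lam * wt (Z - {l})" if Z: "Z \<in> {Z \<in> fam l r. Suc l \<in> Z}" for Z
  proof -
    have Zf: "Z \<in> fam l r" "finite Z" using Z fam_finite by auto
    have Z': "Z - {l} \<in> fam (Suc l) r" using im Z by auto
    have Mi: "Min (Z - {l}) = Suc l" using fam_Min_Max[OF Z'] by simp
    have "Z = {l} \<union> (Z - {l})" using Zf by (auto simp: fam_def)
    then have "gap_weight Z = gap_weight ({l} \<union> (Z - {l}))" by simp
    also have "\<dots> = gap_weight {l} * K (Min (Z - {l}) - Max {l}) * gap_weight (Z - {l})"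
      using Zf Z' by (intro gap_weight_join) (auto simp: fam_def Suc_le_eq)
    finally have "gap_weight Z = gap_weight (Z - {l})" using Mi K_1 by simp
    moreover have "card Z = Suc (card (Z - {l}))" using Zf by (intro card.remove) (auto simp: fam_def)
    ultimately show ?thesis by (simp add: wt_def)
  qed
  show "V l * V (n - r) \<le> V (Suc l) * V (n - r)"
    using V_mono[of l] V_ends_pos[OF D] D lr by (intro mult_right_mono) (auto simp: admissible_def)
qed (use D lr in \<open>auto simp: fam_def\<close>)

lemma right_edge:
  assumes D: "admissible l r" and lr: "l < r"
  shows "nu l r * (fam_mean G l r - fam_mean G l (r - 1))\<^sup>2 \<le> edge_bound G"
proof (rule boundary_edge[where B = "{Z \<in> fam l r. r - 1 \<in> Z}" and u = r])
  show "admissible l (r - 1)" using D lr by (auto simp: admissible_def)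
  show im: "(\<lambda>Z. Z - {r}) ` {Z \<in> fam l r. r - 1 \<in> Z} \<subseteq> fam l (r - 1)"
    using lr by (auto simp: fam_def subset_iff)
  show "(\<Sum>Z\<in>fam l r. wt Z) \<le> (1 + 4 / lam) * (\<Sum>Z\<in>{Z \<in> fam l r. r - 1 \<in> Z}. wt Z)"
    by (rule fam_mass_le_insert_last[OF lr])
  show "wt Z = lam * wt (Z - {r})" if Z: "Z \<in> {Z \<in> fam l r. r - 1 \<in> Z}" for Z
  proof -
    have Zf: "Z \<in> fam l r" "finite Z" using Z fam_finite by auto
    have Z': "Z - {r} \<in> fam l (r - 1)" using im Z by auto
    have Ma: "Max (Z - {r}) = r - 1" using fam_Min_Max[OF Z'] by simp
    have lt: "x < r" if "x \<in> Z - {r}" for x using that Z' lr by (fastforce simp: fam_def)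
    have "Z = (Z - {r}) \<union> {r}" using Zf by (auto simp: fam_def)
    then have "gap_weight Z = gap_weight ((Z - {r}) \<union> {r})" by simp
    also have "\<dots> = gap_weight (Z - {r}) * K (Min {r} - Max (Z - {r})) * gap_weight {r}"
      using Zf Z' lt by (intro gap_weight_join) (auto simp: fam_def)
    finally have "gap_weight Z = gap_weight (Z - {r})" using Ma K_1 lr by simp
    moreover have "card Z = Suc (card (Z - {r}))" using Zf by (intro card.remove) (auto simp: fam_def)
    ultimately show ?thesis by (simp add: wt_def)
  qed
  have "Suc (n - r) = n - (r - 1)" using D lr by (auto simp: admissible_def)
  then have "V (n - r) \<le> V (n - (r - 1))" using V_mono[of "n - r"] D lr by (auto simp: admissible_def)
  then show "V l * V (n - r) \<le> V l * V (n - (r - 1))"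
    using V_ends_pos[OF D] by (intro mult_left_mono) auto
qed (use D lr in \<open>auto simp: fam_def\<close>)

lemma V_swap':
  assumes "\<beta> \<le> min i j" "max i j \<le> n" "min i j \<le> k" "k \<le> max i j" "i + j = k + l"
  shows "V i * V j \<le> Cv * (V k * V l)"
proof (cases "i \<le> j")
  case True
  then show ?thesis using V_swap[of i k j l] assms by simp
next
  case False
  then show ?thesis using V_swap[of j k i l] assms by (simp add: mult.commute)
qed

definition hub_ratio :: real where
  "hub_ratio = Cv\<^sup>2 * (1 + R / lam + Cg / lam)"

lemma hub_ratio_pos: "0 < hub_ratio"
  using Cv_pos R_pos Cg_pos lam_pos by (simp add: hub_ratio_def add_pos_pos)

text \<open>\<open>(i, j)\<close> and its complement \<open>(l + l' - i, r + r' - j)\<close> are states between \<open>(l, r)\<close> and the mode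
  \<open>(l', r')\<close>, up to the complement being out of order by one unit.\<close>

lemma nu_le_between:
  assumes D: "admissible l r" "admissible l' r'" and hub: "\<And>i j. admissible i j \<Longrightarrow> nu i j \<le> nu l' r'"
    and i: "min l l' \<le> i" "i \<le> max l l'" and j: "min r r' \<le> j" "j \<le> max r r'"
    and ij: "i \<le> j" "j + l + l' \<le> i + r + r' + 1"
  shows "nu l r \<le> hub_ratio * nu i j"
proof -
  define i' where "i' = l + l' - i"
  define j' where "j' = r + r' - j"
  have i': "i + i' = l + l'" "min l l' \<le> i'" "i' \<le> max l l'" using i by (auto simp: i'_def)
  have j': "j + j' = r + r'" "min r r' \<le> j'" "j' \<le> max r r'" using j by (auto simp: j'_def)
  have b: "\<beta> \<le> l" "\<beta> \<le> l'" "l \<le> r" "l' \<le> r'" "r + \<beta> \<le> n" "r' + \<beta> \<le> n" using D by (auto simp: admissible_def)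
  have bi: "\<beta> \<le> i" "\<beta> \<le> i'" "i + \<beta> \<le> n" "i' + \<beta> \<le> n" "j + \<beta> \<le> n" "j' + \<beta> \<le> n" using b i i' j j' by linarith+
  have V1: "V l * V l' \<le> Cv * (V i * V i')" using b i i' by (intro V_swap') auto
  have V2: "V (n - r) * V (n - r') \<le> Cv * (V (n - j) * V (n - j'))" using b j j' by (intro V_swap') auto
  have Vp: "0 < V i" "0 < V i'" "0 < V (n - j)" "0 < V (n - j')" "0 < V l" "0 < V l'" "0 < V (n - r)" "0 < V (n - r')" "0 < V (n - i')"
    using b bi by (auto intro!: V_pos)
  have admissibleij: "admissible i j" using bi ij by (simp add: admissible_def)
  have np: "0 < nu i j" "0 < nu l' r'" using nu_pos admissibleij D by auto
  have prod3: "x1 * x2 * x3 \<le> y1 * y2 * y3" if "0 \<le> x1" "0 \<le> x2" "0 \<le> x3" "x1 \<le> y1" "x2 \<le> y2" "x3 \<le> y3" for x1 x2 x3 y1 y2 y3 :: real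
    using that by (intro mult_mono mult_nonneg_nonneg) auto
  have split: "nu l r * nu l' r' = (V l * V l') * (bridge_mass (r - l) * bridge_mass (r' - l')) * (V (n - r) * V (n - r'))"
    by (simp add: nu_def mult_ac)
  have "nu l r * nu l' r' \<le> hub_ratio * nu i j * nu l' r'"
  proof (cases "i' \<le> j'")
    case True
    have D': "admissible i' j'" using True bi by (simp add: admissible_def)
    have z: "bridge_mass (r - l) * bridge_mass (r' - l') \<le> (1 + R / lam) * (bridge_mass (j - i) * bridge_mass (j' - i'))"
      using b m_large ij True i' j' by (intro bridge_mass_swap) auto
    have "nu l r * nu l' r' \<le> (Cv * (V i * V i')) * ((1 + R / lam) * (bridge_mass (j - i) * bridge_mass (j' - i'))) * (Cv * (V (n - j) * V (n - j')))"
      unfolding split by (rule prod3[OF _ _ _ V1 z V2]) (use Vp bridge_mass_pos in \<open>auto simp: less_imp_le\<close>)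
    also have "\<dots> = Cv\<^sup>2 * (1 + R / lam) * (nu i j * nu i' j')" by (simp add: nu_def power2_eq_square mult_ac)
    also have "\<dots> \<le> hub_ratio * (nu i j * nu l' r')"
      using hub[OF D'] np lam_pos R_pos Cg_pos nu_pos[OF D'] unfolding hub_ratio_def
      by (intro mult_mono mult_left_mono mult_nonneg_nonneg) (auto simp: less_imp_le)
    finally show ?thesis by (simp add: mult.assoc)
  next
    case False
    then have ji: "i' = Suc j'" using ij i' j' by linarith
    have D': "admissible i' i'" using bi by (simp add: admissible_def)
    have "bridge_mass (r - l) * bridge_mass (r' - l') \<le> lam * bridge_mass ((r - l) + (r' - l'))" by (rule bridge_mass_supermult)
    also have "\<dots> \<le> bridge_mass (Suc ((r - l) + (r' - l')))" by (rule bridge_mass_Suc)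
    also have "Suc ((r - l) + (r' - l')) = j - i" using ji i' j' b by linarith
    finally have z: "bridge_mass (r - l) * bridge_mass (r' - l') \<le> bridge_mass (j - i)" .
    have "n - j' = Suc (n - i')" using ji bi by linarith
    then have "V (n - j') \<le> Cg * V (n - i')" using V_growth[of "n - i'"] bi ji by auto
    then have V3: "V (n - r) * V (n - r') \<le> Cv * (V (n - j) * (Cg * V (n - i')))"
      using V2 Vp Cv_pos by (smt (verit) mult_left_mono)
    have "nu l r * nu l' r' \<le> (Cv * (V i * V i')) * bridge_mass (j - i) * (Cv * (V (n - j) * (Cg * V (n - i'))))"
      unfolding split by (rule prod3[OF _ _ _ V1 z V3]) (use Vp bridge_mass_pos in \<open>auto simp: less_imp_le\<close>)
    also have "\<dots> = Cv\<^sup>2 * (Cg / lam) * (nu i j * nu i' i')"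
    proof -
      have "Cg / lam * nu i' i' = Cg * (V i' * V (n - i'))" using lam_pos by (simp add: nu_def bridge_mass_0)
      then have "Cv\<^sup>2 * (Cg / lam) * (nu i j * nu i' i') = Cv\<^sup>2 * (nu i j * (Cg * (V i' * V (n - i'))))"
        by (metis (no_types, opaque_lifting) mult.assoc mult.left_commute)
      then show ?thesis by (simp only: nu_def power2_eq_square mult_ac)
    qed
    also have "\<dots> \<le> hub_ratio * (nu i j * nu l' r')"
      using hub[OF D'] np lam_pos R_pos Cg_pos nu_pos[OF D'] unfolding hub_ratio_def
      by (intro mult_mono mult_left_mono mult_nonneg_nonneg) (auto simp: less_imp_le)
    finally show ?thesis by (simp add: mult.assoc)
  qed
  then show ?thesis using np by simp
qed

lemma hub_path:
  assumes D: "admissible l r" "admissible l' r'" and hub: "\<And>i j. admissible i j \<Longrightarrow> nu i j \<le> nu l' r'"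
    and i: "min l l' \<le> i" "i \<le> max l l'" and j: "min r r' \<le> j" "j \<le> max r r'"
    and ij: "i \<le> j" "j + l + l' \<le> i + r + r' + 1"
  shows "\<bar>fam_mean G i j - fam_mean G l' r'\<bar> \<le>
    real (nat (\<bar>int i - int l'\<bar> + \<bar>int j - int r'\<bar>)) * sqrt (hub_ratio * edge_bound G / nu l r)"
  using i j ij
proof (induction "nat (\<bar>int i - int l'\<bar> + \<bar>int j - int r'\<bar>)" arbitrary: i j)
  case 0
  then have "i = l'" "j = r'" by auto
  then show ?case by simp
next
  case (Suc k)
  define \<Delta> where "\<Delta> = sqrt (hub_ratio * edge_bound G / nu l r)"
  have b: "\<beta> \<le> l" "\<beta> \<le> l'" "l \<le> r" "l' \<le> r'" "r + \<beta> \<le> n" "r' + \<beta> \<le> n" using D by (auto simp: admissible_def)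
  have nlr: "0 < nu l r" using nu_pos D by auto
  have close: "\<bar>x\<bar> \<le> \<Delta>" if "nu p q * x\<^sup>2 \<le> edge_bound G" "min l l' \<le> p" "p \<le> max l l'" "min r r' \<le> q" "q \<le> max r r'"
    "p \<le> q" "q + l + l' \<le> p + r + r' + 1" for x p q
  proof -
    have le: "nu l r \<le> hub_ratio * nu p q" by (rule nu_le_between[OF D hub that(2-7)])
    have "nu l r * x\<^sup>2 \<le> hub_ratio * (nu p q * x\<^sup>2)"
      using mult_right_mono[OF le, of "x\<^sup>2"] by (simp add: mult.assoc)
    also have "\<dots> \<le> hub_ratio * edge_bound G" using that(1) hub_ratio_pos by (intro mult_left_mono) auto
    finally have "x\<^sup>2 \<le> hub_ratio * edge_bound G / nu l r" using nlr by (simp add: field_simps)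
    then show ?thesis unfolding \<Delta>_def by (simp add: real_le_rsqrt)
  qed
  have step: ?case if "\<bar>fam_mean G i j - fam_mean G i1 j1\<bar> \<le> \<Delta>" "k = nat (\<bar>int i1 - int l'\<bar> + \<bar>int j1 - int r'\<bar>)"
     "min l l' \<le> i1" "i1 \<le> max l l'" "min r r' \<le> j1" "j1 \<le> max r r'" "i1 \<le> j1" "j1 + l + l' \<le> i1 + r + r' + 1" for i1 j1
  proof -
    have "\<bar>fam_mean G i1 j1 - fam_mean G l' r'\<bar> \<le> real k * \<Delta>"
      using Suc.hyps(1)[OF that(2-8)] that(2) by (simp add: \<Delta>_def)
    then have "\<bar>fam_mean G i j - fam_mean G l' r'\<bar> \<le> \<Delta> + real k * \<Delta>" using that(1) by linarith
    also have "\<dots> = real (Suc k) * \<Delta>" by (simp add: algebra_simps)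
    finally show ?thesis unfolding Suc.hyps(2)[symmetric] \<Delta>_def .
  qed
  note h = Suc.prems
  have Dij: "admissible i j" using b h by (auto simp: admissible_def)
  have "(i < l' \<and> i < j) \<or> (r' < j \<and> i < j) \<or> (l' < i \<and> j + l + l' \<le> i + r + r') \<or> (j < r' \<and> j + l + l' \<le> i + r + r')"
    using Suc.hyps(2) h b by linarith
  then consider "i < l'" "i < j" | "r' < j" "i < j" | "l' < i" "j + l + l' \<le> i + r + r'" | "j < r'" "j + l + l' \<le> i + r + r'"
    by blast
  then show ?case
  proof cases
    case 1
    have "nu i j * (fam_mean G i j - fam_mean G (Suc i) j)\<^sup>2 \<le> edge_bound G" by (rule left_edge[OF Dij 1(2)])
    from close[OF this h] show ?thesis by (rule step) (use 1 h b Suc.hyps(2) in auto)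
  next
    case 2
    have "nu i j * (fam_mean G i j - fam_mean G i (j - 1))\<^sup>2 \<le> edge_bound G" by (rule right_edge[OF Dij 2(2)])
    from close[OF this h] show ?thesis by (rule step) (use 2 h b Suc.hyps(2) in auto)
  next
    case 3
    have D': "admissible (i - 1) j" using Dij 3 b by (auto simp: admissible_def)
    have e: "Suc (i - 1) = i" using 3 by simp
    have h': "min l l' \<le> i - 1" "i - 1 \<le> max l l'" "i - 1 \<le> j" "j + l + l' \<le> i - 1 + r + r' + 1" using 3 h by auto
    have "nu (i - 1) j * (fam_mean G (i - 1) j - fam_mean G (Suc (i - 1)) j)\<^sup>2 \<le> edge_bound G"
      by (rule left_edge[OF D']) (use 3 h in auto)
    from close[OF this h'(1,2) h(3,4) h'(3,4)] have "\<bar>fam_mean G i j - fam_mean G (i - 1) j\<bar> \<le> \<Delta>"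
      unfolding e by (simp add: abs_minus_commute)
    then show ?thesis by (rule step) (use 3 h h' b Suc.hyps(2) in auto)
  next
    case 4
    have D': "admissible i (Suc j)" using Dij 4 b by (auto simp: admissible_def)
    have h': "min r r' \<le> Suc j" "Suc j \<le> max r r'" "i \<le> Suc j" "Suc j + l + l' \<le> i + r + r' + 1" using 4 h by auto
    have "nu i (Suc j) * (fam_mean G i (Suc j) - fam_mean G i (Suc j - 1))\<^sup>2 \<le> edge_bound G"
      by (rule right_edge[OF D']) (use h in auto)
    from close[OF this h(1,2) h'] have "\<bar>fam_mean G i j - fam_mean G i (Suc j)\<bar> \<le> \<Delta>"
      by (simp add: abs_minus_commute)
    then show ?thesis by (rule step) (use 4 h h' b Suc.hyps(2) in auto)
  qed
qed

lemma edge_bound_nonneg: "0 \<le> edge_bound G"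
  using toggle_energy_nonneg[of G] lam_pos R_pos by (simp add: edge_bound_def)

theorem zsets_poincare:
  "\<exists>c. (\<Sum>Z\<in>zsets. mu Z * (G Z - c)\<^sup>2) \<le>
     (real n + 1)\<^sup>2 * (2 * (R * real m) + 8 * (real n)\<^sup>2 * hub_ratio * (3 * (1 + 4 / lam) * ((1 + lam) * (R * real m) + 1)))
       * toggle_energy G"
proof (cases "zsets = {}")
  case True
  have "0 \<le> hub_ratio * (3 * (1 + 4 / lam) * ((1 + lam) * (R * real m) + 1))"
    using hub_ratio_pos lam_pos R_pos by simp
  then show ?thesis using True by (simp add: toggle_energy_def)
next
  case False
  define S where "S = {(l, r). admissible l r}"
  have finS: "finite S" by (rule finite_subset[of _ "{..n} \<times> {..n}"]) (auto simp: S_def admissible_def)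
  have cardS: "real (card S) \<le> (real n + 1)\<^sup>2"
  proof -
    have "card S \<le> card ({..n} \<times> {..n})" by (rule card_mono) (auto simp: S_def admissible_def)
    then have "real (card S) \<le> real (Suc n * Suc n)" by (simp del: of_nat_mult)
    then show ?thesis by (simp add: power2_eq_square algebra_simps)
  qed
  have sf: "{Z \<in> zsets. (Min Z, Max Z) = (l, r)} = fam l r" if "admissible l r" for l r
  proof
    show "{Z \<in> zsets. (Min Z, Max Z) = (l, r)} \<subseteq> fam l r"
    proof
      fix Z assume "Z \<in> {Z \<in> zsets. (Min Z, Max Z) = (l, r)}"
      then have "finite Z" "Z \<noteq> {}" "Min Z = l" "Max Z = r" using zsets_finite by (auto simp: zsets_def)
      then show "Z \<in> fam l r" using Min_in[of Z] Max_in[of Z] by (auto simp: fam_def)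
    qed
    show "fam l r \<subseteq> {Z \<in> zsets. (Min Z, Max Z) = (l, r)}"
      using fam_sub_zsets[OF that] fam_Min_Max by auto
  qed
  have ends: "admissible (Min Z) (Max Z)" if "Z \<in> zsets" for Z
  proof -
    have f: "finite Z" "Z \<noteq> {}" using that zsets_finite by (auto simp: zsets_def)
    then have "Min Z \<in> {\<beta>..n - \<beta>}" "Max Z \<in> {\<beta>..n - \<beta>}"
      using that Min_in[OF f] Max_in[OF f] unfolding zsets_def by blast+
    moreover have "Min Z \<le> Max Z" using f by simp
    ultimately show ?thesis by (auto simp: admissible_def)
  qed
  have "S \<noteq> {}" using False ends by (auto simp: S_def)
  define M where "M = Max ((\<lambda>(l, r). nu l r) ` S)"
  have "M \<in> (\<lambda>(l, r). nu l r) ` S" unfolding M_def using finS \<open>S \<noteq> {}\<close> by (intro Max_in) auto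
  then obtain l' r' where D': "admissible l' r'" and M: "M = nu l' r'" by (auto simp: S_def)
  have hub: "nu i j \<le> nu l' r'" if "admissible i j" for i j
    unfolding M[symmetric] M_def using finS that by (intro Max_ge) (auto simp: S_def)
  define c where "c = fam_mean G l' r'"
  define B where "B = 2 * (R * real m) * toggle_energy G + 8 * (real n)\<^sup>2 * hub_ratio * edge_bound G"
  have B0: "0 \<le> B" using toggle_energy_nonneg[of G] edge_bound_nonneg[of G] R_pos hub_ratio_pos by (simp add: B_def)
  have fam_le: "(\<Sum>Z\<in>fam l r. mu Z * (G Z - c)\<^sup>2) \<le> B" if D: "admissible l r" for l r
  proof -
    define g where "g = fam_mean G l r"
    have sq: "(x - c)\<^sup>2 \<le> 2 * (x - g)\<^sup>2 + 2 * (g - c)\<^sup>2" for x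
    proof -
      have "2 * (x - g)\<^sup>2 + 2 * (g - c)\<^sup>2 - (x - c)\<^sup>2 = ((x - g) - (g - c))\<^sup>2"
        by (simp add: power2_eq_square algebra_simps)
      then show ?thesis by (smt (verit) zero_le_power2)
    qed
    have gc: "nu l r * (g - c)\<^sup>2 \<le> 4 * (real n)\<^sup>2 * (hub_ratio * edge_bound G)"
    proof -
      define \<Delta> where "\<Delta> = sqrt (hub_ratio * edge_bound G / nu l r)"
      have d0: "0 \<le> hub_ratio * edge_bound G / nu l r"
        using hub_ratio_pos edge_bound_nonneg[of G] nu_pos[OF D] by simp
      have "\<bar>g - c\<bar> \<le> real (nat (\<bar>int l - int l'\<bar> + \<bar>int r - int r'\<bar>)) * \<Delta>"
        unfolding g_def c_def \<Delta>_def
        by (rule hub_path[OF D D' hub]) (use D D' in \<open>auto simp: admissible_def\<close>)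
      also have "\<dots> \<le> (2 * real n) * \<Delta>"
      proof (rule mult_right_mono)
        have "nat (\<bar>int l - int l'\<bar> + \<bar>int r - int r'\<bar>) \<le> 2 * n" using D D' by (auto simp: admissible_def)
        then show "real (nat (\<bar>int l - int l'\<bar> + \<bar>int r - int r'\<bar>)) \<le> 2 * real n" by linarith
        show "0 \<le> \<Delta>" using d0 by (simp add: \<Delta>_def)
      qed
      finally have "\<bar>g - c\<bar>\<^sup>2 \<le> (2 * real n * \<Delta>)\<^sup>2" by (intro power_mono) auto
      also have "\<dots> = 4 * (real n)\<^sup>2 * (hub_ratio * edge_bound G / nu l r)"
        using d0 by (simp add: power_mult_distrib \<Delta>_def)
      finally show ?thesis using nu_pos[OF D] by (simp add: field_simps)
    qed
    have mu0: "0 \<le> mu Z" if "Z \<in> fam l r" for Z using mu_pos[of Z] fam_sub_zsets[OF D] that by auto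
    have "(\<Sum>Z\<in>fam l r. mu Z * (G Z - c)\<^sup>2) \<le> (\<Sum>Z\<in>fam l r. mu Z * (2 * (G Z - g)\<^sup>2 + 2 * (g - c)\<^sup>2))"
      using sq mu0 by (intro sum_mono mult_left_mono) auto
    also have "\<dots> = 2 * (\<Sum>Z\<in>fam l r. mu Z * (G Z - g)\<^sup>2) + 2 * (nu l r * (g - c)\<^sup>2)"
      unfolding fam_mu_total[OF D, symmetric] sum_distrib_right sum_distrib_left sum.distrib[symmetric]
      by (intro sum.cong refl) (simp add: algebra_simps)
    also have "\<dots> \<le> B" using gc fam_mu_variance[OF D, of G] by (simp add: B_def g_def)
    finally show ?thesis .
  qed
  have "(\<Sum>Z\<in>zsets. mu Z * (G Z - c)\<^sup>2) = (\<Sum>p\<in>S. \<Sum>Z\<in>{Z \<in> zsets. (Min Z, Max Z) = p}. mu Z * (G Z - c)\<^sup>2)"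
    by (rule sum.group[symmetric, OF finite_zsets finS]) (use ends in \<open>auto simp: S_def\<close>)
  also have "\<dots> \<le> (\<Sum>p\<in>S. B)"
  proof (rule sum_mono)
    fix p assume "p \<in> S"
    then obtain l r where p: "p = (l, r)" "admissible l r" by (auto simp: S_def)
    show "(\<Sum>Z\<in>{Z \<in> zsets. (Min Z, Max Z) = p}. mu Z * (G Z - c)\<^sup>2) \<le> B"
      unfolding p(1) sf[OF p(2)] by (rule fam_le[OF p(2)])
  qed
  also have "\<dots> = real (card S) * B" by simp
  also have "\<dots> \<le> (real n + 1)\<^sup>2 * B" by (rule mult_right_mono[OF cardS B0])
  also have "\<dots> = (real n + 1)\<^sup>2 * (2 * (R * real m) + 8 * (real n)\<^sup>2 * hub_ratio * (3 * (1 + 4 / lam) * ((1 + lam) * (R * real m) + 1)))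
       * toggle_energy G"
    unfolding B_def edge_bound_def by (simp only: mult.assoc distrib_right distrib_left)
  finally show ?thesis by blast
qed

end

section \<open>Counting excursions and first passages\<close>

fun bal :: "nat \<Rightarrow> nat \<Rightarrow> nat" where
  "bal 0 h = (if h = 0 then 1 else 0)"
| "bal (Suc k) 0 = 0"
| "bal (Suc k) (Suc h) = bal k (h + 2) + bal k h"

lemma bal_eq_0: "k < h \<Longrightarrow> bal k h = 0"
  by (induction k h rule: bal.induct) auto

lemma bal_formula: "h + 2 * j = k \<Longrightarrow> k * bal k h = h * (k choose j)"
proof (induction k arbitrary: h j)
  case (Suc k)
  show ?case
  proof (cases h)
    case 0
    then show ?thesis by simp
  next
    case (Suc h')
    have k: "h' + 2 * j = k" using Suc Suc.prems by simp
    show ?thesis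
    proof (cases "k = 0")
      case True
      then show ?thesis using Suc k by simp
    next
      case False
      show ?thesis
      proof (cases j)
        case 0
        then have "bal k (h' + 2) = 0" using k by (intro bal_eq_0) simp
        moreover have "k * bal k h' = h' * (k choose j)" using Suc.IH[OF k] .
        ultimately show ?thesis using 0 False k \<open>h = Suc h'\<close> by simp
      next
        case (Suc j')
        have 1: "k * bal k h' = h' * (k choose j)" using Suc.IH[OF k] .
        have 2: "k * bal k (h' + 2) = (h' + 2) * (k choose j')" using Suc.IH[of "h' + 2" j'] Suc k by simp
        have 3: "(k - j') * (k choose j') = j * (k choose j)"
          unfolding Suc binomial_absorption binomial_absorb_comp ..
        have kj: "k - j' = h' + j + 1" using Suc k by simp
        have "k * ((k + 1) * bal (k + 1) h) = (k + 1) * (k * bal k (h' + 2) + k * bal k h')"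
          using \<open>h = Suc h'\<close> by (simp add: algebra_simps)
        also have "\<dots> = (k + 1) * ((h' + 2) * (k choose j') + h' * (k choose j))" by (simp only: 1 2)
        also have "\<dots> = k * ((h' + 1) * ((k choose j') + (k choose j)))"
        proof -
          define x where "x = (k choose j)"
          define y where "y = (k choose j')"
          have e: "int (h' + j + 1) * int y = int j * int x" using 3 kj unfolding x_def y_def by (metis of_nat_mult)
          have ki: "int k = int h' + 2 * int j" using k by auto
          have "(int k + 1) * ((int h' + 2) * int y + int h' * int x) - int k * ((int h' + 1) * (int y + int x))
             = 2 * (int (h' + j + 1) * int y - int j * int x)"
            unfolding ki by (simp add: algebra_simps)
          then have "(int k + 1) * ((int h' + 2) * int y + int h' * int x) = int k * ((int h' + 1) * (int y + int x))"
            using e by simp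
          then have "int ((k + 1) * ((h' + 2) * y + h' * x)) = int (k * ((h' + 1) * (y + x)))" by (simp add: algebra_simps)
          then show ?thesis unfolding x_def y_def by (simp only: of_nat_eq_iff)
        qed
        also have "(k choose j') + (k choose j) = Suc k choose j" using Suc by simp
        finally show ?thesis using False \<open>h = Suc h'\<close> by simp
      qed
    qed
  qed
qed simp

text \<open>Excursions of length \<open>2 j\<close> (Catalan numbers) and first passages from \<open>2 \<beta>\<close> to \<open>0\<close> in \<open>2 i\<close> steps.\<close>

definition exc :: "nat \<Rightarrow> real" where
  "exc j = real (bal (2 * j - 1) 1)"

definition fpass :: "nat \<Rightarrow> nat \<Rightarrow> real" where
  "fpass \<beta> i = real (bal (2 * i) (2 * \<beta>))"

lemma exc_1: "exc 1 = 1"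
  by (simp add: exc_def)

lemma exc_formula: "1 \<le> j \<Longrightarrow> (2 * real j - 1) * exc j = real ((2 * j - 1) choose (j - 1))"
proof -
  assume j: "1 \<le> j"
  have "(2 * j - 1) * bal (2 * j - 1) 1 = 1 * ((2 * j - 1) choose (j - 1))"
    using j by (intro bal_formula) auto
  then have "real (2 * j - 1) * exc j = real ((2 * j - 1) choose (j - 1))"
    unfolding exc_def by (metis mult_1 of_nat_mult)
  then show ?thesis using j by (simp add: of_nat_diff)
qed

lemma exc_Suc: "1 \<le> j \<Longrightarrow> (real j + 1) * exc (Suc j) = (4 * real j - 2) * exc j"
proof -
  assume j: "1 \<le> j"
  then obtain i where i: "j = Suc i" by (cases j) auto
  define X where "X = (2 * i + 3) choose Suc i"
  define Y where "Y = (2 * i + 2) choose i"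
  define Z where "Z = (2 * i + 1) choose i"
  have a: "(2 * real i + 1) * exc j = real Z"
    using exc_formula[OF j] i by (simp add: Z_def algebra_simps)
  have b: "(2 * real i + 3) * exc (Suc j) = real X"
  proof -
    have e: "2 * Suc j - 1 = 2 * i + 3" "Suc j - 1 = Suc i" using i by simp_all
    show ?thesis using exc_formula[of "Suc j"] unfolding e X_def[symmetric] using i by (simp add: algebra_simps)
  qed
  have "Suc i * X = (2 * i + 3) * Y"
  proof -
    have e: "2 * i + 3 = Suc (2 * i + 2)" by simp
    show ?thesis unfolding X_def Y_def e by (rule Suc_times_binomial)
  qed
  moreover have "(i + 2) * Y = (2 * i + 2) * Z"
  proof -
    have e: "2 * i + 2 - i = i + 2" "2 * i + 2 - 1 = 2 * i + 1" by simp_all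
    show ?thesis using binomial_absorb_comp[of "2 * i + 2" i] unfolding e Y_def Z_def .
  qed
  ultimately have "real (Suc i * X) = real ((2 * i + 3) * Y)"
    "real ((i + 2) * Y) = real ((2 * i + 2) * Z)"
    by (simp_all only:)
  then have c: "(real i + 1) * real X = (2 * real i + 3) * real Y"
    and d: "(real i + 2) * real Y = (2 * real i + 2) * real Z"
    unfolding of_nat_mult by (simp_all add: add.commute)
  have "(2 * real i + 3) * ((real i + 1) * exc (Suc j)) = (2 * real i + 3) * real Y"
    using c unfolding b[symmetric] by (simp only: mult_ac)
  then have "(real i + 1) * exc (Suc j) = real Y"
    by (subst (asm) mult_cancel_left) simp
  then have "(real i + 2) * ((real i + 1) * exc (Suc j)) = (2 * real i + 2) * ((2 * real i + 1) * exc j)"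
    using d a by simp
  then have "(real i + 1) * ((real i + 2) * exc (Suc j)) = (real i + 1) * (2 * (2 * real i + 1) * exc j)"
    by (simp add: algebra_simps)
  then have "(real i + 2) * exc (Suc j) = 2 * (2 * real i + 1) * exc j"
    by (subst (asm) mult_cancel_left) simp
  then show ?thesis using i by (simp add: algebra_simps)
qed

lemma exc_pos: "1 \<le> j \<Longrightarrow> 0 < exc j"
proof -
  assume j: "1 \<le> j"
  have "0 < real ((2 * j - 1) choose (j - 1))" by simp
  then show ?thesis using exc_formula[OF j] j by (smt (verit) zero_less_mult_iff of_nat_1 of_nat_mono)
qed

lemma exc_Suc_le: "1 \<le> j \<Longrightarrow> exc (Suc j) \<le> 4 * exc j"
proof -
  assume j: "1 \<le> j"
  have "(real j + 1) * exc (Suc j) \<le> (real j + 1) * (4 * exc j)"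
    using exc_Suc[OF j] exc_pos[OF j] by (simp add: algebra_simps)
  then show ?thesis using j by (subst (asm) mult_le_cancel_left_pos) auto
qed

lemma exc_bounds:
  assumes "1 \<le> j"
  shows "(exc j)\<^sup>2 * real j ^ 3 \<le> 16 ^ j / 16" and "16 ^ j / 64 \<le> (exc j)\<^sup>2 * real j ^ 3"
proof -
  have "(exc j)\<^sup>2 * real j ^ 3 \<le> 16 ^ j / 16 \<and> 16 ^ j / 64 \<le> (exc j)\<^sup>2 * (real j ^ 2 * (real j - 3 / 4))"
    using assms
  proof (induction j rule: nat_induct_at_least)
    case base
    then show ?case using exc_1 by simp
  next
    case (Suc j)
    define x where "x = real j"
    have x: "1 \<le> x" using Suc by (simp add: x_def)
    define e where "e = (exc j)\<^sup>2"
    have e0: "0 \<le> e" by (simp add: e_def)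
    have sq: "(exc (Suc j))\<^sup>2 * (x + 1)\<^sup>2 = (4 * x - 2)\<^sup>2 * e"
      using exc_Suc[OF Suc.hyps] by (metis e_def mult.commute power_mult_distrib x_def)
    have "(exc (Suc j))\<^sup>2 * real (Suc j) ^ 3 = ((exc (Suc j))\<^sup>2 * (x + 1)\<^sup>2) * (x + 1)"
      by (simp add: x_def power2_eq_square power3_eq_cube algebra_simps)
    also have "\<dots> = e * ((4 * x - 2)\<^sup>2 * (x + 1))" by (simp add: sq)
    also have "\<dots> \<le> e * (16 * x ^ 3)"
    proof (rule mult_left_mono[OF _ e0])
      have "16 * x ^ 3 - (4 * x - 2)\<^sup>2 * (x + 1) = 12 * x - 4" by (simp add: power2_eq_square power3_eq_cube algebra_simps)
      then show "(4 * x - 2)\<^sup>2 * (x + 1) \<le> 16 * x ^ 3" using x by simp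
    qed
    also have "\<dots> \<le> 16 ^ Suc j / 16" using Suc.IH by (simp add: e_def x_def)
    finally have 1: "(exc (Suc j))\<^sup>2 * real (Suc j) ^ 3 \<le> 16 ^ Suc j / 16" .
    have "16 ^ Suc j / 64 \<le> e * (16 * (x ^ 2 * (x - 3 / 4)))" using Suc.IH by (simp add: e_def x_def)
    also have "\<dots> \<le> e * ((4 * x - 2)\<^sup>2 * (x + 1 / 4))"
    proof (rule mult_left_mono[OF _ e0])
      have "(4 * x - 2)\<^sup>2 * (x + 1 / 4) - 16 * (x ^ 2 * (x - 3 / 4)) = 1" by (simp add: power2_eq_square algebra_simps)
      then show "16 * (x ^ 2 * (x - 3 / 4)) \<le> (4 * x - 2)\<^sup>2 * (x + 1 / 4)" by simp
    qed
    also have "\<dots> = (exc (Suc j))\<^sup>2 * (x + 1)\<^sup>2 * (x + 1 / 4)" by (simp add: sq)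
    also have "\<dots> = (exc (Suc j))\<^sup>2 * (real (Suc j) ^ 2 * (real (Suc j) - 3 / 4))" by (simp add: x_def algebra_simps)
    finally show ?case using 1 by simp
  qed
  moreover have "(exc j)\<^sup>2 * (real j ^ 2 * (real j - 3 / 4)) \<le> (exc j)\<^sup>2 * real j ^ 3"
    by (intro mult_left_mono) (auto simp: power2_eq_square power3_eq_cube intro!: mult_left_mono)
  ultimately show "(exc j)\<^sup>2 * real j ^ 3 \<le> 16 ^ j / 16" "16 ^ j / 64 \<le> (exc j)\<^sup>2 * real j ^ 3" by auto
qed

lemma exc_swap:
  assumes p: "1 \<le> i" "1 \<le> j" "1 \<le> k" "1 \<le> l" and s: "i + j = k + l" "i + j \<le> 2 * m"
  shows "exc i * exc j \<le> 16 * (real m)\<^sup>2 * (exc k * exc l)"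
proof -
  define P where "P = real i * real j"
  define Q where "Q = real k * real l"
  have P1: "1 \<le> P" unfolding P_def using p mult_mono[of 1 "real i" 1 "real j"] by simp
  have Q1: "1 \<le> Q" unfolding Q_def using p mult_mono[of 1 "real k" 1 "real l"] by simp
  have m1: "1 \<le> real m" using p s by simp
  have "Q \<le> real m * P"
  proof -
    have "(real k - real l)\<^sup>2 \<ge> 0" by simp
    then have "4 * Q \<le> (real k + real l)\<^sup>2" by (simp add: Q_def power2_eq_square algebra_simps)
    also have "\<dots> = (real i + real j)\<^sup>2" using s by (metis of_nat_add)
    also have "\<dots> \<le> (2 * real m) * (2 * P)"
    proof -
      have "0 \<le> (real i - 1) * (real j - 1)" using p by simp
      then have "real i + real j \<le> P + 1" by (simp add: P_def algebra_simps)
      then have "real i + real j \<le> 2 * P" using P1 by simp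
      moreover have "real i + real j \<le> 2 * real m" using s(2) by linarith
      ultimately show ?thesis unfolding power2_eq_square by (intro mult_mono) auto
    qed
    finally show ?thesis by simp
  qed
  then have Q3: "Q ^ 3 \<le> (real m) ^ 3 * P ^ 3" using Q1 by (metis power_mono power_mult_distrib order_trans zero_le_one)
  have up: "(exc i * exc j)\<^sup>2 * P ^ 3 \<le> 16 ^ (i + j) / 256"
  proof -
    have "((exc i)\<^sup>2 * real i ^ 3) * ((exc j)\<^sup>2 * real j ^ 3) \<le> (16 ^ i / 16) * (16 ^ j / 16)"
      using exc_bounds(1) p by (intro mult_mono) auto
    then show ?thesis by (simp add: P_def power_mult_distrib power_add mult_ac)
  qed
  have lo: "16 ^ (k + l) / 4096 \<le> (exc k * exc l)\<^sup>2 * Q ^ 3"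
  proof -
    have "(16 ^ k / 64) * (16 ^ l / 64) \<le> ((exc k)\<^sup>2 * real k ^ 3) * ((exc l)\<^sup>2 * real l ^ 3)"
      using exc_bounds(2) p by (intro mult_mono) auto
    then show ?thesis by (simp add: Q_def power_mult_distrib power_add mult_ac)
  qed
  have "(exc i * exc j)\<^sup>2 * P ^ 3 \<le> 16 * ((exc k * exc l)\<^sup>2 * Q ^ 3)" using up lo s by simp
  also have "\<dots> \<le> 16 * ((exc k * exc l)\<^sup>2 * ((real m) ^ 3 * P ^ 3))" using Q3 by (intro mult_left_mono) auto
  finally have "P ^ 3 * (exc i * exc j)\<^sup>2 \<le> P ^ 3 * (16 * (real m) ^ 3 * (exc k * exc l)\<^sup>2)" by (simp add: mult_ac)
  then have "(exc i * exc j)\<^sup>2 \<le> 16 * (real m) ^ 3 * (exc k * exc l)\<^sup>2" using P1 by (subst (asm) mult_le_cancel_left_pos) auto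
  also have "\<dots> \<le> 256 * (real m) ^ 4 * (exc k * exc l)\<^sup>2"
    using m1 by (intro mult_right_mono mult_mono power_increasing) auto
  also have "\<dots> = (16 * (real m)\<^sup>2 * (exc k * exc l))\<^sup>2" by (simp add: power_mult_distrib power_mult[symmetric])
  finally show ?thesis by (rule power2_le_imp_le) (use exc_pos p in \<open>auto simp: less_imp_le\<close>)
qed

lemma exc_insert:
  assumes p: "1 \<le> i" "1 \<le> j" and s: "i + j \<le> m"
  shows "exc (i + j) \<le> 16 * (real m)\<^sup>2 * (exc i * exc j)"
proof -
  define P where "P = real i * real j"
  define Q where "Q = real i + real j"
  have Q0: "0 < Q" using p by (simp add: Q_def)
  have m1: "1 \<le> real m" using p s by simp
  have "P \<le> real m * Q" unfolding P_def Q_def using p s by (intro mult_mono) auto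
  then have P3: "P ^ 3 \<le> (real m) ^ 3 * Q ^ 3" by (metis power_mono power_mult_distrib P_def of_nat_0_le_iff mult_nonneg_nonneg)
  have up: "(exc (i + j))\<^sup>2 * Q ^ 3 \<le> 16 ^ (i + j) / 16"
    using exc_bounds(1)[of "i + j"] p by (simp add: Q_def)
  have lo: "16 ^ (i + j) / 4096 \<le> (exc i * exc j)\<^sup>2 * P ^ 3"
  proof -
    have "(16 ^ i / 64) * (16 ^ j / 64) \<le> ((exc i)\<^sup>2 * real i ^ 3) * ((exc j)\<^sup>2 * real j ^ 3)"
      using exc_bounds(2) p by (intro mult_mono) auto
    then show ?thesis by (simp add: P_def power_mult_distrib power_add mult_ac)
  qed
  have "(exc (i + j))\<^sup>2 * Q ^ 3 \<le> 256 * ((exc i * exc j)\<^sup>2 * P ^ 3)" using up lo by simp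
  also have "\<dots> \<le> 256 * ((exc i * exc j)\<^sup>2 * ((real m) ^ 3 * Q ^ 3))" using P3 by (intro mult_left_mono) auto
  finally have "Q ^ 3 * (exc (i + j))\<^sup>2 \<le> Q ^ 3 * (256 * (real m) ^ 3 * (exc i * exc j)\<^sup>2)" by (simp add: mult_ac)
  then have "(exc (i + j))\<^sup>2 \<le> 256 * (real m) ^ 3 * (exc i * exc j)\<^sup>2" using Q0 by (subst (asm) mult_le_cancel_left_pos) auto
  also have "\<dots> \<le> 256 * (real m) ^ 4 * (exc i * exc j)\<^sup>2"
    using m1 by (intro mult_right_mono mult_mono power_increasing) auto
  also have "\<dots> = (16 * (real m)\<^sup>2 * (exc i * exc j))\<^sup>2" by (simp add: power_mult_distrib power_mult[symmetric])
  finally show ?thesis by (rule power2_le_imp_le) (use exc_pos p in \<open>auto simp: less_imp_le\<close>)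
qed

lemma fpass_formula: "\<beta> \<le> i \<Longrightarrow> real i * fpass \<beta> i = real \<beta> * real ((2 * i) choose (i - \<beta>))"
proof -
  assume b: "\<beta> \<le> i"
  have "(2 * i) * bal (2 * i) (2 * \<beta>) = (2 * \<beta>) * ((2 * i) choose (i - \<beta>))"
    using b by (intro bal_formula) auto
  then have "real ((2 * i) * bal (2 * i) (2 * \<beta>)) = real ((2 * \<beta>) * ((2 * i) choose (i - \<beta>)))" by (simp only:)
  then show ?thesis unfolding fpass_def of_nat_mult by simp
qed

lemma fpass_pos: "1 \<le> \<beta> \<Longrightarrow> \<beta> \<le> i \<Longrightarrow> 0 < fpass \<beta> i"
proof -
  assume b: "1 \<le> \<beta>" "\<beta> \<le> i"
  then have "i - \<beta> \<le> 2 * i" by simp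
  then have "0 < real \<beta> * real ((2 * i) choose (i - \<beta>))" using b by simp
  then show ?thesis unfolding fpass_formula[OF b(2), symmetric] using b by (simp add: zero_less_mult_iff)
qed

lemma fpass_Suc:
  assumes b: "1 \<le> \<beta>" "\<beta> \<le> i"
  shows "((real i + 1)\<^sup>2 - (real \<beta>)\<^sup>2) * fpass \<beta> (Suc i) = 2 * real i * (2 * real i + 1) * fpass \<beta> i"
proof -
  define k where "k = i - \<beta>"
  define X where "X = (2 * i + 2) choose Suc k"
  define Y where "Y = (2 * i + 1) choose k"
  define Z where "Z = (2 * i) choose k"
  have "Suc k * X = (2 * i + 2) * Y"
    using Suc_times_binomial[of k "2 * i + 1"] by (simp add: X_def Y_def)
  then have 1: "(real k + 1) * real X = (2 * real i + 2) * real Y"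
    by (metis of_nat_Suc of_nat_mult of_nat_add of_nat_numeral add.commute)
  have "(2 * i + 1 - k) * Y = (2 * i + 1) * Z"
    using binomial_absorb_comp[of "2 * i + 1" k] by (simp add: Y_def Z_def)
  then have "real (2 * i + 1 - k) * real Y = real (2 * i + 1) * real Z" by (metis of_nat_mult)
  then have 2: "(real i + real \<beta> + 1) * real Y = (2 * real i + 1) * real Z"
    using b by (simp add: k_def of_nat_diff add_ac)
  have 3: "(real i + 1) * fpass \<beta> (Suc i) = real \<beta> * real X"
  proof -
    have e: "Suc i - \<beta> = Suc k" "2 * Suc i = 2 * i + 2" using b by (auto simp: k_def)
    show ?thesis using fpass_formula[of \<beta> "Suc i"] b unfolding e X_def[symmetric] by (simp add: add.commute)
  qed
  have 4: "real i * fpass \<beta> i = real \<beta> * real Z" using fpass_formula[of \<beta> i] b by (simp add: Z_def k_def)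
  have k: "real k = real i - real \<beta>" using b by (simp add: k_def of_nat_diff)
  have "(real i + 1) * (((real i + 1)\<^sup>2 - (real \<beta>)\<^sup>2) * fpass \<beta> (Suc i)) =
     (real i + real \<beta> + 1) * (real i - real \<beta> + 1) * ((real i + 1) * fpass \<beta> (Suc i))"
    by (simp add: power2_eq_square algebra_simps)
  also have "\<dots> = real \<beta> * ((real i + real \<beta> + 1) * ((real k + 1) * real X))" unfolding 3 k by (simp add: mult_ac)
  also have "\<dots> = real \<beta> * ((2 * real i + 2) * ((real i + real \<beta> + 1) * real Y))" unfolding 1 by (simp only: mult_ac)
  also have "\<dots> = (2 * real i + 2) * (2 * real i + 1) * (real \<beta> * real Z)" unfolding 2 by (simp only: mult_ac)
  also have "\<dots> = (real i + 1) * (2 * real i * (2 * real i + 1) * fpass \<beta> i)" unfolding 4[symmetric] by (simp add: algebra_simps)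
  finally show ?thesis by (subst (asm) mult_cancel_left) simp
qed

lemma fpass_mono: "1 \<le> \<beta> \<Longrightarrow> \<beta> \<le> i \<Longrightarrow> fpass \<beta> i \<le> fpass \<beta> (Suc i)"
proof -
  assume b: "1 \<le> \<beta>" "\<beta> \<le> i"
  define d where "d = (real i + 1)\<^sup>2 - (real \<beta>)\<^sup>2"
  have "(real \<beta>)\<^sup>2 < (real i + 1)\<^sup>2" using b by (intro power_strict_mono) auto
  then have d: "0 < d" by (simp add: d_def)
  have "1 \<le> (real \<beta>)\<^sup>2" using b by simp
  moreover have "2 * real i * (2 * real i + 1) - ((real i + 1)\<^sup>2 - 1) = 3 * (real i)\<^sup>2"
    by (simp add: power2_eq_square algebra_simps)
  moreover have "0 \<le> 3 * (real i)\<^sup>2" by simp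
  ultimately have "d \<le> 2 * real i * (2 * real i + 1)" unfolding d_def by linarith
  then have "d * fpass \<beta> i \<le> d * fpass \<beta> (Suc i)"
    unfolding d_def fpass_Suc[OF b] using fpass_pos[OF b] by (intro mult_right_mono) auto
  then show ?thesis using d by simp
qed

lemma fpass_growth: "1 \<le> \<beta> \<Longrightarrow> \<beta> \<le> i \<Longrightarrow> i \<le> n \<Longrightarrow> fpass \<beta> (Suc i) \<le> 4 * real n * fpass \<beta> i"
proof -
  assume b: "1 \<le> \<beta>" "\<beta> \<le> i" and n: "i \<le> n"
  define d where "d = (real i + 1)\<^sup>2 - (real \<beta>)\<^sup>2"
  have "d = (real i + 1 - real \<beta>) * (real i + 1 + real \<beta>)" by (simp add: d_def power2_eq_square algebra_simps)
  moreover have "1 * (real i + 1) \<le> (real i + 1 - real \<beta>) * (real i + 1 + real \<beta>)" using b by (intro mult_mono) auto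
  ultimately have d: "real i + 1 \<le> d" by simp
  have "2 * real i * (2 * real i + 1) \<le> 4 * real n * (real i + 1)"
  proof -
    have "2 * real i * (2 * real i + 1) \<le> 2 * real n * (2 * (real i + 1))" using n by (intro mult_mono) auto
    then show ?thesis by (simp add: algebra_simps)
  qed
  also have "\<dots> \<le> 4 * real n * d" using d by (intro mult_left_mono) auto
  finally have "d * fpass \<beta> (Suc i) \<le> (4 * real n * d) * fpass \<beta> i"
    unfolding fpass_Suc[OF b, folded d_def] using fpass_pos[OF b] by (intro mult_right_mono) auto
  then have "d * fpass \<beta> (Suc i) \<le> d * (4 * real n * fpass \<beta> i)" by (simp add: mult_ac)
  moreover have "0 < d" using d by linarith
  ultimately show ?thesis by simp
qed

text \<open>\<open>fpass\<close> itself is not log-concave, but \<open>i\<^sup>2 fpass i\<close> is: its ratios factor into the two decreasing terms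
  \<open>2 (2 i + 1) / i\<close> and \<open>(i + 1)\<^sup>2 / ((i + 1)\<^sup>2 - \<beta>\<^sup>2)\<close>.\<close>

lemma fpass_log_concave:
  assumes b: "1 \<le> \<beta>" "\<beta> \<le> i" "i \<le> j"
  defines "X \<equiv> \<lambda>i. (real i)\<^sup>2 * fpass \<beta> i"
  shows "X i * X (Suc j) \<le> X (Suc i) * X j"
proof -
  define \<rho> where "\<rho> x = (2 * (2 * x + 1) / x) * ((x + 1)\<^sup>2 / ((x + 1)\<^sup>2 - (real \<beta>)\<^sup>2))" for x :: real
  have den: "0 < (real i + 1)\<^sup>2 - (real \<beta>)\<^sup>2" if "\<beta> \<le> i" for i
  proof -
    have "(real \<beta>)\<^sup>2 < (real i + 1)\<^sup>2" using that by (intro power_strict_mono) auto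
    then show ?thesis by simp
  qed
  have step: "X (Suc i) = \<rho> (real i) * X i" if "\<beta> \<le> i" for i
  proof -
    have i: "0 < real i" using that b by simp
    have "fpass \<beta> (Suc i) = 2 * real i * (2 * real i + 1) * fpass \<beta> i / ((real i + 1)\<^sup>2 - (real \<beta>)\<^sup>2)"
      unfolding fpass_Suc[OF b(1) that, symmetric] using den[OF that] that by simp
    then show ?thesis using i by (simp add: X_def \<rho>_def power2_eq_square add.commute)
  qed
  have X0: "0 \<le> X i" if "\<beta> \<le> i" for i using fpass_pos[OF b(1) that] by (simp add: X_def)
  have "\<rho> (real j) \<le> \<rho> (real i)" unfolding \<rho>_def
  proof (rule mult_mono)
    have ij: "0 < real i" "real i \<le> real j" using b by auto
    have "2 * (2 * x + 1) / x = 4 + 2 / x" if "0 < x" for x :: real using that by (simp add: field_simps)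
    then show "2 * (2 * real j + 1) / real j \<le> 2 * (2 * real i + 1) / real i"
      using ij by (simp add: divide_left_mono)
    have fr: "x / (x - c) = 1 + c / (x - c)" if "0 < x - c" for x c :: real using that by (simp add: field_simps)
    have di: "0 < (real i + 1)\<^sup>2 - (real \<beta>)\<^sup>2" and dj: "0 < (real j + 1)\<^sup>2 - (real \<beta>)\<^sup>2" using den b by auto
    have "(real i + 1)\<^sup>2 \<le> (real j + 1)\<^sup>2" using ij by (intro power_mono) auto
    then show "(real j + 1)\<^sup>2 / ((real j + 1)\<^sup>2 - (real \<beta>)\<^sup>2) \<le> (real i + 1)\<^sup>2 / ((real i + 1)\<^sup>2 - (real \<beta>)\<^sup>2)"
      unfolding fr[OF di] fr[OF dj] using di dj by (intro add_left_mono divide_left_mono) auto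
    show "0 \<le> 2 * (2 * real i + 1) / real i" by simp
    show "0 \<le> (real j + 1)\<^sup>2 / ((real j + 1)\<^sup>2 - (real \<beta>)\<^sup>2)" using dj by (intro divide_nonneg_pos) auto
  qed
  then have "\<rho> (real j) * (X i * X j) \<le> \<rho> (real i) * (X i * X j)"
    using X0 b by (intro mult_right_mono) auto
  then show ?thesis using step[of i] step[of j] b by (simp add: mult_ac)
qed

lemma fpass_swap:
  assumes b: "1 \<le> \<beta>" "\<beta> \<le> i" and k: "i \<le> k" "k \<le> j" and n: "j \<le> n" and s: "i + j = k + l"
  shows "fpass \<beta> i * fpass \<beta> j \<le> (real n / real \<beta>) ^ 4 * (fpass \<beta> k * fpass \<beta> l)"
proof -
  define X where "X i = (real i)\<^sup>2 * fpass \<beta> i" for i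
  have lc: "X p * X (Suc q) \<le> X (Suc p) * X q" if "\<beta> \<le> p" "p \<le> q" for p q
    using fpass_log_concave[OF b(1) that] by (simp add: X_def)
  have X1: "X i * X j \<le> X (i + d) * X (j - d)" if "i + 2 * d \<le> j" for d
    using that
  proof (induction d)
    case (Suc d)
    have e: "Suc (j - Suc d) = j - d" using Suc.prems by simp
    have "X (i + d) * X (j - d) \<le> X (Suc (i + d)) * X (j - Suc d)"
      using lc[of "i + d" "j - Suc d"] e b Suc.prems by simp
    then show ?case using Suc by simp
  qed simp
  have X2: "X i * X j \<le> X k * X l"
  proof (cases "k \<le> l")
    case True
    then show ?thesis using X1[of "k - i"] k s by (simp add: add.commute)
  next
    case False
    then show ?thesis using X1[of "l - i"] k s by (simp add: add.commute mult.commute)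
  qed
  define F where "F = fpass \<beta> k * fpass \<beta> l"
  have l: "\<beta> \<le> l" "l \<le> n" "\<beta> \<le> k" "k \<le> n" using b k n s by auto
  have F0: "0 \<le> F" using fpass_pos[OF b(1)] l by (simp add: F_def less_imp_le)
  have f0: "0 \<le> fpass \<beta> i * fpass \<beta> j" using fpass_pos[OF b(1)] b k by (simp add: less_imp_le)
  have bp: "0 < real \<beta>" using b by simp
  have "((real \<beta>)\<^sup>2 * (real \<beta>)\<^sup>2) * (fpass \<beta> i * fpass \<beta> j) \<le> ((real i)\<^sup>2 * (real j)\<^sup>2) * (fpass \<beta> i * fpass \<beta> j)"
    using b k f0 by (intro mult_right_mono mult_mono power_mono) auto
  also have "\<dots> = X i * X j" by (simp add: X_def)
  also have "\<dots> \<le> X k * X l" by (rule X2)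
  also have "\<dots> = ((real k)\<^sup>2 * (real l)\<^sup>2) * F" by (simp add: X_def F_def)
  also have "\<dots> \<le> ((real n)\<^sup>2 * (real n)\<^sup>2) * F"
    using l F0 by (intro mult_right_mono mult_mono power_mono) auto
  finally have "(real \<beta>) ^ 4 * (fpass \<beta> i * fpass \<beta> j) \<le> (real n) ^ 4 * F"
    by (simp only: power_add[symmetric]) simp
  then have "fpass \<beta> i * fpass \<beta> j \<le> (real n) ^ 4 * F / (real \<beta>) ^ 4"
    using bp by (simp add: pos_le_divide_eq mult.commute)
  then show ?thesis by (simp add: F_def power_divide)
qed

lemma paths_split_card:
  assumes su: "s < u" "u < t" and u: "u \<in> A"
  shows "card (paths s \<alpha> t \<beta> A) = card (paths s \<alpha> u 0 (A \<inter> {..<u})) * card (paths u 0 t \<beta> (A \<inter> {u<..}))"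
proof -
  define cut where "cut \<eta> = ((\<lambda>x. if x \<le> u then \<eta> x else 0), (\<lambda>x. if u \<le> x then \<eta> x else 0))" for \<eta> :: config
  define glue where "glue p = (\<lambda>x. if x \<le> u then fst p x else snd p x)" for p :: "config \<times> config"
  have "bij_betw cut (paths s \<alpha> t \<beta> A) (paths s \<alpha> u 0 (A \<inter> {..<u}) \<times> paths u 0 t \<beta> (A \<inter> {u<..}))"
  proof (rule bij_betw_byWitness[where f' = glue])
    show "\<forall>\<eta>\<in>paths s \<alpha> t \<beta> A. glue (cut \<eta>) = \<eta>" by (auto simp: glue_def cut_def fun_eq_iff)
    show "\<forall>p\<in>paths s \<alpha> u 0 (A \<inter> {..<u}) \<times> paths u 0 t \<beta> (A \<inter> {u<..}). cut (glue p) = p"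
    proof
      fix p assume p: "p \<in> paths s \<alpha> u 0 (A \<inter> {..<u}) \<times> paths u 0 t \<beta> (A \<inter> {u<..})"
      then have h: "fst p u = 0" "snd p u = 0" "\<And>x. u < x \<Longrightarrow> fst p x = 0" "\<And>x. x < u \<Longrightarrow> snd p x = 0"
        by (auto simp: paths_def)
      show "cut (glue p) = p"
        by (rule prod_eqI) (use h in \<open>auto simp: cut_def glue_def fun_eq_iff le_less not_le\<close>)
    qed
    show "cut ` paths s \<alpha> t \<beta> A \<subseteq> paths s \<alpha> u 0 (A \<inter> {..<u}) \<times> paths u 0 t \<beta> (A \<inter> {u<..})"
    proof (rule image_subsetI)
      fix \<eta> assume e: "\<eta> \<in> paths s \<alpha> t \<beta> A"
      then have A: "A = {x. s < x \<and> x < t \<and> \<eta> x = 0}" and z: "\<eta> u = 0" using u by (auto simp: paths_def)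
      have "fst (cut \<eta>) \<in> paths s \<alpha> u 0 (A \<inter> {..<u})"
        using e su z unfolding cut_def paths_def A by auto
      moreover have "snd (cut \<eta>) \<in> paths u 0 t \<beta> (A \<inter> {u<..})"
        using e su z unfolding cut_def paths_def A by auto
      ultimately show "cut \<eta> \<in> paths s \<alpha> u 0 (A \<inter> {..<u}) \<times> paths u 0 t \<beta> (A \<inter> {u<..})"
        by (simp add: mem_Times_iff)
    qed
    show "glue ` (paths s \<alpha> u 0 (A \<inter> {..<u}) \<times> paths u 0 t \<beta> (A \<inter> {u<..})) \<subseteq> paths s \<alpha> t \<beta> A"
    proof (rule image_subsetI)
      fix p assume p: "p \<in> paths s \<alpha> u 0 (A \<inter> {..<u}) \<times> paths u 0 t \<beta> (A \<inter> {u<..})"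
      define \<xi> where "\<xi> = fst p"
      define \<zeta> where "\<zeta> = snd p"
      have g: "glue p x = (if x \<le> u then \<xi> x else \<zeta> x)" for x by (simp add: glue_def \<xi>_def \<zeta>_def)
      have x1: "\<And>x. x < s \<Longrightarrow> \<xi> x = 0" "\<And>x. s \<le> x \<Longrightarrow> x \<le> u \<Longrightarrow> 0 \<le> \<xi> x" "\<xi> s = \<alpha>" "\<xi> u = 0"
        "\<And>x. s \<le> x \<Longrightarrow> x < u \<Longrightarrow> \<bar>\<xi> (x + 1) - \<xi> x\<bar> = 1" and x2: "{x. s < x \<and> x < u \<and> \<xi> x = 0} = A \<inter> {..<u}"
        using p by (auto simp: paths_def \<xi>_def)
      have y1: "\<And>x. t < x \<Longrightarrow> \<zeta> x = 0" "\<And>x. u \<le> x \<Longrightarrow> x \<le> t \<Longrightarrow> 0 \<le> \<zeta> x" "\<zeta> u = 0" "\<zeta> t = \<beta>"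
        "\<And>x. u \<le> x \<Longrightarrow> x < t \<Longrightarrow> \<bar>\<zeta> (x + 1) - \<zeta> x\<bar> = 1" and y2: "{x. u < x \<and> x < t \<and> \<zeta> x = 0} = A \<inter> {u<..}"
        using p by (auto simp: paths_def \<zeta>_def)
      have st: "\<bar>glue p (x + 1) - glue p x\<bar> = 1" if "s \<le> x" "x < t" for x
      proof -
        consider "x < u" | "x = u" | "u < x" by linarith
        then show ?thesis
        proof cases
          case 1 then show ?thesis using x1(5)[of x] that by (simp add: g)
        next
          case 2 then show ?thesis using y1(5)[of u] y1(3) x1(4) that by (simp add: g)
        next
          case 3 then show ?thesis using y1(5)[of x] that by (simp add: g)
        qed
      qed
      have "{x. s < x \<and> x < t \<and> glue p x = 0} = A"
      proof (rule set_eq_trichotomy[of u])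
        fix x
        show "x \<in> {x. s < x \<and> x < t \<and> glue p x = 0} \<longleftrightarrow> x \<in> A" if "x < u"
          using that x2 su by (auto simp: g)
        show "x \<in> {x. s < x \<and> x < t \<and> glue p x = 0} \<longleftrightarrow> x \<in> A" if "u < x"
          using that y2 su by (auto simp: g)
      qed (use u su x1 in \<open>auto simp: g\<close>)
      then show "glue p \<in> paths s \<alpha> t \<beta> A"
        using x1 y1 su st unfolding paths_def by (auto simp: g)
    qed
  qed
  then show ?thesis using bij_betw_same_card card_cartesian_product by metis
qed

lemma paths_first_step_card:
  assumes "s < t" "0 \<le> \<alpha>" "0 \<le> v" "\<bar>v - \<alpha>\<bar> = 1" "Suc s < t \<Longrightarrow> 0 < v"
  shows "card {\<eta> \<in> paths s \<alpha> t \<beta> {}. \<eta> (Suc s) = v} = card (paths (Suc s) v t \<beta> {})"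
proof (rule bij_betw_same_card[where f = "\<lambda>\<eta>. \<eta>(s := 0)"], rule bij_betw_byWitness[where f' = "\<lambda>\<zeta>. \<zeta>(s := \<alpha>)"])
  show "\<forall>\<eta>\<in>{\<eta> \<in> paths s \<alpha> t \<beta> {}. \<eta> (Suc s) = v}. (\<eta>(s := 0))(s := \<alpha>) = \<eta>" by (auto simp: paths_def)
  show "\<forall>\<zeta>\<in>paths (Suc s) v t \<beta> {}. (\<zeta>(s := \<alpha>))(s := 0) = \<zeta>" by (auto simp: paths_def)
  show "(\<lambda>\<eta>. \<eta>(s := 0)) ` {\<eta> \<in> paths s \<alpha> t \<beta> {}. \<eta> (Suc s) = v} \<subseteq> paths (Suc s) v t \<beta> {}"
    using assms by (auto simp: paths_def)
  show "(\<lambda>\<zeta>. \<zeta>(s := \<alpha>)) ` paths (Suc s) v t \<beta> {} \<subseteq> {\<eta> \<in> paths s \<alpha> t \<beta> {}. \<eta> (Suc s) = v}"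
  proof (rule image_subsetI)
    fix \<zeta> assume z: "\<zeta> \<in> paths (Suc s) v t \<beta> {}"
    have "\<bar>(\<zeta>(s := \<alpha>)) (x + 1) - (\<zeta>(s := \<alpha>)) x\<bar> = 1" if "s \<le> x" "x < t" for x
      using z that assms(4) by (cases "x = s") (auto simp: paths_def)
    moreover have "(\<zeta>(s := \<alpha>)) x \<noteq> 0" if "s < x" "x < t" for x
      using z that assms(5) by (cases "x = Suc s") (auto simp: paths_def)
    ultimately show "\<zeta>(s := \<alpha>) \<in> {\<eta> \<in> paths s \<alpha> t \<beta> {}. \<eta> (Suc s) = v}"
      using z assms(1,2) by (auto simp: paths_def)
  qed
qed

lemma card_paths_bal: "0 < h \<or> k = 0 \<Longrightarrow> card (paths s (int h) (s + k) 0 {}) = bal k h"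
proof (induction k arbitrary: s h)
  case 0
  show ?case
  proof (cases "h = 0")
    case True
    have "paths s 0 s 0 {} = {\<lambda>_. 0}"
      by (auto simp: paths_def fun_eq_iff) (metis linorder_neqE_nat)
    then show ?thesis using True by simp
  next
    case False
    then have "paths s (int h) s 0 {} = {}" by (auto simp: paths_def)
    then show ?thesis using False by simp
  qed
next
  case (Suc k)
  then obtain h' where h: "h = Suc h'" by (cases h) auto
  define S where "S = paths s (int h) (s + Suc k) 0 {}"
  have Seq: "S = {\<eta> \<in> S. \<eta> (Suc s) = int h' + 2} \<union> {\<eta> \<in> S. \<eta> (Suc s) = int h'}"
  proof -
    have "\<eta> (Suc s) = int h' + 2 \<or> \<eta> (Suc s) = int h'" if e: "\<eta> \<in> S" for \<eta>
    proof -
      have "\<eta> s = int h" using e by (simp add: S_def paths_def)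
      then show ?thesis using paths_step[OF e[unfolded S_def], of s] h by auto
    qed
    then show ?thesis by blast
  qed
  have "finite S" by (simp add: S_def finite_paths)
  then have "card ({\<eta> \<in> S. \<eta> (Suc s) = int h' + 2} \<union> {\<eta> \<in> S. \<eta> (Suc s) = int h'}) =
      card {\<eta> \<in> S. \<eta> (Suc s) = int h' + 2} + card {\<eta> \<in> S. \<eta> (Suc s) = int h'}"
    by (intro card_Un_disjoint) auto
  then have "card S = card {\<eta> \<in> S. \<eta> (Suc s) = int h' + 2} + card {\<eta> \<in> S. \<eta> (Suc s) = int h'}"
    unfolding Seq[symmetric] .
  moreover have "card {\<eta> \<in> S. \<eta> (Suc s) = int h' + 2} = bal k (h' + 2)"
  proof -
    have v: "int h' + 2 = int (h' + 2)" and t: "s + Suc k = Suc s + k" by simp_all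
    have "card {\<eta> \<in> S. \<eta> (Suc s) = int h' + 2} = card (paths (Suc s) (int (h' + 2)) (Suc s + k) 0 {})"
      unfolding S_def v t using h by (intro paths_first_step_card) auto
    also have "\<dots> = bal k (h' + 2)" by (rule Suc.IH) simp
    finally show ?thesis .
  qed
  moreover have "card {\<eta> \<in> S. \<eta> (Suc s) = int h'} = bal k h'"
  proof (cases "0 < h' \<or> k = 0")
    case True
    have "card {\<eta> \<in> S. \<eta> (Suc s) = int h'} = card (paths (Suc s) (int h') (Suc s + k) 0 {})"
      unfolding S_def add_Suc_shift[symmetric] using h True by (intro paths_first_step_card) auto
    also have "\<dots> = bal k h'" by (rule Suc.IH[OF True])
    finally show ?thesis .
  next
    case False
    then have "h' = 0" "0 < k" by auto
    moreover have "{\<eta> \<in> S. \<eta> (Suc s) = 0} = {}" using \<open>0 < k\<close> by (auto simp: S_def paths_def)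
    moreover have "bal k 0 = 0" using \<open>0 < k\<close> by (cases k) auto
    ultimately show ?thesis by (simp only: of_nat_0 card.empty)
  qed
  ultimately show ?case using h by (simp add: S_def)
qed

lemma card_paths_excursion:
  assumes "1 \<le> j"
  shows "real (card (paths s 0 (s + 2 * j) 0 {})) = exc j"
proof -
  define S where "S = paths s 0 (s + 2 * j) 0 {}"
  have "\<eta> (Suc s) = 1" if e: "\<eta> \<in> S" for \<eta>
  proof -
    have "\<eta> s = 0" "0 \<le> \<eta> (Suc s)" using e assms by (auto simp: S_def paths_def)
    then show ?thesis using paths_step[OF e[unfolded S_def], of s] assms by auto
  qed
  then have "S = {\<eta> \<in> S. \<eta> (Suc s) = 1}" by blast
  then have "card S = card {\<eta> \<in> S. \<eta> (Suc s) = 1}" by simp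
  also have "\<dots> = card (paths (Suc s) 1 (s + 2 * j) 0 {})"
    unfolding S_def using assms by (intro paths_first_step_card) auto
  also have "s + 2 * j = Suc s + (2 * j - 1)" using assms by simp
  also have "card (paths (Suc s) 1 (Suc s + (2 * j - 1)) 0 {}) = bal (2 * j - 1) 1"
    using card_paths_bal[of 1 "2 * j - 1" "Suc s"] by simp
  finally show ?thesis by (simp add: S_def exc_def)
qed

lemma card_paths_reverse:
  assumes st: "s \<le> t"
  shows "card (paths s \<alpha> t \<beta> {}) = card (paths s \<beta> t \<alpha> {})"
proof -
  define rv where "rv \<eta> = (\<lambda>x. if s \<le> x \<and> x \<le> t then \<eta> (s + t - x) else 0)" for \<eta> :: config
  have mem: "rv \<eta> \<in> paths s b t a {}" if e: "\<eta> \<in> paths s a t b {}" for \<eta> a b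
  proof -
    have "\<bar>rv \<eta> (x + 1) - rv \<eta> x\<bar> = 1" if x: "s \<le> x" "x < t" for x
    proof -
      have "s + t - x = (s + t - (x + 1)) + 1" "s \<le> s + t - (x + 1)" "s + t - (x + 1) < t" using x by auto
      then have "\<bar>\<eta> (s + t - x) - \<eta> (s + t - (x + 1))\<bar> = 1" using e by (simp add: paths_def)
      then show ?thesis using x by (simp add: rv_def abs_minus_commute)
    qed
    moreover have "rv \<eta> x \<noteq> 0" if x: "s < x" "x < t" for x
    proof -
      have "s < s + t - x" "s + t - x < t" using x by auto
      then have "\<eta> (s + t - x) \<noteq> 0" using e by (auto simp: paths_def)
      then show ?thesis using x by (simp add: rv_def)
    qed
    moreover have "0 \<le> rv \<eta> x" for x
    proof (cases "s \<le> x \<and> x \<le> t")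
      case True
      then have "s \<le> s + t - x" "s + t - x \<le> t" by auto
      then show ?thesis using e True by (simp add: rv_def paths_def)
    qed (auto simp: rv_def)
    moreover have "rv \<eta> s = b" "rv \<eta> t = a" "\<And>x. x < s \<or> t < x \<Longrightarrow> rv \<eta> x = 0" using e st by (auto simp: rv_def paths_def)
    ultimately show ?thesis unfolding paths_def by auto
  qed
  have inv: "rv (rv \<eta>) = \<eta>" if "\<eta> \<in> paths s a t b {}" for \<eta> a b
  proof
    fix x show "rv (rv \<eta>) x = \<eta> x"
      using that by (cases "s \<le> x \<and> x \<le> t") (auto simp: rv_def paths_def)
  qed
  have "bij_betw rv (paths s \<alpha> t \<beta> {}) (paths s \<beta> t \<alpha> {})"
    by (rule bij_betw_byWitness[where f' = rv]) (use mem inv in auto)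
  then show ?thesis by (rule bij_betw_same_card)
qed

lemma card_paths_first_passage:
  assumes "1 \<le> \<beta>"
  shows "real (card (paths s (2 * int \<beta>) (s + 2 * i) 0 {})) = fpass \<beta> i"
    and "real (card (paths s 0 (s + 2 * i) (2 * int \<beta>) {})) = fpass \<beta> i"
  using card_paths_bal[of "2 * \<beta>" "2 * i" s] card_paths_reverse[of s "s + 2 * i" 0 "2 * int \<beta>"] assms
  by (auto simp: fpass_def)

context renewal
begin

lemma card_paths_left:
  assumes K: "\<And>j. 1 \<le> j \<Longrightarrow> K j = exc j" and b: "1 \<le> \<beta>" and A: "finite A" "A \<noteq> {}" "\<And>x. x \<in> A \<Longrightarrow> \<beta> \<le> x \<and> x < u"
  shows "real (card (paths 0 (2 * int \<beta>) (2 * u) 0 ((*) 2 ` A))) = fpass \<beta> (Min A) * gap_weight (insert u A)"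
  using A
proof (induction A arbitrary: u rule: finite_linorder_max_induct)
  case (insert p A)
  have fin: "finite A" by fact
  have lt: "\<And>x. x \<in> A \<Longrightarrow> x < p" using insert by blast
  have p: "\<beta> \<le> p" "p < u" using insert.prems by auto
  have i1: "((*) 2 ` insert p A) \<inter> {..<2 * p} = (*) 2 ` A" using lt by auto
  have i2: "((*) 2 ` insert p A) \<inter> {2 * p<..} = {}" using lt by force
  have "card (paths 0 (2 * int \<beta>) (2 * u) 0 ((*) 2 ` insert p A)) =
     card (paths 0 (2 * int \<beta>) (2 * p) 0 ((*) 2 ` A)) * card (paths (2 * p) 0 (2 * u) 0 {})"
    using paths_split_card[of 0 "2 * p" "2 * u" "(*) 2 ` insert p A"] p b unfolding i1 i2 by simp
  moreover have "real (card (paths (2 * p) 0 (2 * u) 0 {})) = K (u - p)"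
    using card_paths_excursion[of "u - p" "2 * p"] p K[of "u - p"] by (simp add: algebra_simps)
  ultimately have c: "real (card (paths 0 (2 * int \<beta>) (2 * u) 0 ((*) 2 ` insert p A))) =
     real (card (paths 0 (2 * int \<beta>) (2 * p) 0 ((*) 2 ` A))) * K (u - p)" by simp
  have Ma: "Max (insert p A) = p" using fin lt by (intro Max_eqI) (auto simp: less_imp_le)
  have lt': "x < u" if "x \<in> insert p A" for x using that lt[of x] p by auto
  have gap_weight: "gap_weight (insert u (insert p A)) = gap_weight (insert p A) * K (u - p)"
    using gap_weight_join[of "insert p A" "{u}"] fin lt' Ma by (simp add: insert_commute)
  show ?case
  proof (cases "A = {}")
    case True
    then show ?thesis using c gap_weight card_paths_first_passage(1)[OF b, of 0 p] by simp
  next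
    case False
    have "real (card (paths 0 (2 * int \<beta>) (2 * p) 0 ((*) 2 ` A))) = fpass \<beta> (Min A) * gap_weight (insert p A)"
      using insert.IH[OF False, of p] insert.prems lt by auto
    moreover have "Min (insert p A) = Min A" using fin False lt by (simp add: min_def) (metis Min_in less_imp_le linorder_not_less)
    ultimately show ?thesis using c gap_weight by simp
  qed
qed simp

lemma card_paths_zero_set:
  assumes K: "\<And>j. 1 \<le> j \<Longrightarrow> K j = exc j" and b: "1 \<le> \<beta>" and Z: "Z \<noteq> {}" "Z \<subseteq> {\<beta>..n - \<beta>}"
  shows "real (card (paths 0 (2 * int \<beta>) (2 * n) (2 * int \<beta>) ((*) 2 ` Z))) = fpass \<beta> (Min Z) * gap_weight Z * fpass \<beta> (n - Max Z)"
proof -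
  have fin: "finite Z" using Z finite_subset by blast
  define r where "r = Max Z"
  have r: "r \<in> Z" using fin Z by (simp add: r_def)
  have rb: "\<beta> \<le> r" "r + \<beta> \<le> n" using r Z b by (auto simp: subset_iff)
  have le: "x \<le> r" if "x \<in> Z" for x using fin that by (simp add: r_def)
  have i1: "((*) 2 ` Z) \<inter> {..<2 * r} = (*) 2 ` (Z - {r})" using le by (force simp: less_le)
  have i2: "((*) 2 ` Z) \<inter> {2 * r<..} = {}" using le by force
  have "card (paths 0 (2 * int \<beta>) (2 * n) (2 * int \<beta>) ((*) 2 ` Z)) =
     card (paths 0 (2 * int \<beta>) (2 * r) 0 ((*) 2 ` (Z - {r}))) * card (paths (2 * r) 0 (2 * n) (2 * int \<beta>) {})"
    using paths_split_card[of 0 "2 * r" "2 * n" "(*) 2 ` Z"] rb b r unfolding i1 i2 by simp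
  moreover have "real (card (paths (2 * r) 0 (2 * n) (2 * int \<beta>) {})) = fpass \<beta> (n - r)"
    using card_paths_first_passage(2)[OF b, of "2 * r" "n - r"] rb by (simp add: algebra_simps)
  moreover have "real (card (paths 0 (2 * int \<beta>) (2 * r) 0 ((*) 2 ` (Z - {r})))) = fpass \<beta> (Min Z) * gap_weight Z"
  proof (cases "Z = {r}")
    case True
    then show ?thesis using card_paths_first_passage(1)[OF b, of 0 r] by simp
  next
    case False
    then have ne: "Z - {r} \<noteq> {}" using r by auto
    have "real (card (paths 0 (2 * int \<beta>) (2 * r) 0 ((*) 2 ` (Z - {r})))) = fpass \<beta> (Min (Z - {r})) * gap_weight (insert r (Z - {r}))"
      using fin ne Z le by (intro card_paths_left[OF K b]) (auto simp: less_le)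
    moreover have "insert r (Z - {r}) = Z" using r by auto
    moreover have "Min (Z - {r}) = Min Z"
    proof (rule Min_eqI[symmetric])
      show "finite Z" by fact
      show "Min (Z - {r}) \<in> Z" using Min_in[of "Z - {r}"] fin ne by auto
      show "Min (Z - {r}) \<le> y" if "y \<in> Z" for y
      proof (cases "y = r")
        case True
        then show ?thesis using Min_in[of "Z - {r}"] fin ne le by auto
      next
        case False
        then show ?thesis using fin that by simp
      qed
    qed
    ultimately show ?thesis by simp
  qed
  ultimately show ?thesis by (simp add: r_def mult_ac)
qed

end

section \<open>The pinned polymer\<close>

locale polymer =
  fixes a lam :: real and n \<beta> :: nat
  assumes a0: "0 < a" and lam0: "0 < lam" and n1: "1 \<le> n" and \<beta>1: "1 \<le> \<beta>" and an: "a * real n \<le> real \<beta>"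
    and height: "even_ceil (a * real (2 * n)) = 2 * int \<beta>"

sublocale polymer \<subseteq> pinned_renewal exc lam "16 * (real (2 * n))\<^sup>2" "2 * n" "fpass \<beta>" n \<beta> "(1 / a) ^ 4" "4 * real n"
proof unfold_locales
  show "0 < 16 * (real (2 * n))\<^sup>2" using n1 by simp
  show "exc (Suc j) \<le> 4 * exc j" if "1 \<le> j" for j by (rule exc_Suc_le[OF that])
  show "exc i * exc j \<le> 16 * (real (2 * n))\<^sup>2 * (exc k * exc l)"
    if "1 \<le> i" "1 \<le> j" "1 \<le> k" "1 \<le> l" "i + j = k + l" "i + j \<le> 2 * (2 * n)" for i j k l
    by (rule exc_swap[OF that])
  show "exc (i + j) \<le> 16 * (real (2 * n))\<^sup>2 * (exc i * exc j)" if "1 \<le> i" "1 \<le> j" "i + j \<le> 2 * n" for i j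
    by (rule exc_insert[OF that])
  show "fpass \<beta> i * fpass \<beta> j \<le> (1 / a) ^ 4 * (fpass \<beta> k * fpass \<beta> l)"
    if h: "\<beta> \<le> i" "i \<le> k" "k \<le> j" "j \<le> n" "i + j = k + l" for i j k l
  proof -
    have "real n / real \<beta> \<le> 1 / a" using an a0 \<beta>1 by (simp add: field_simps)
    then have p: "(real n / real \<beta>) ^ 4 \<le> (1 / a) ^ 4" by (intro power_mono) auto
    have "0 < fpass \<beta> k" "0 < fpass \<beta> l" using fpass_pos[OF \<beta>1] h by auto
    then have "(real n / real \<beta>) ^ 4 * (fpass \<beta> k * fpass \<beta> l) \<le> (1 / a) ^ 4 * (fpass \<beta> k * fpass \<beta> l)"
      using p by (intro mult_right_mono) auto
    then show ?thesis using fpass_swap[OF \<beta>1 h] by linarith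
  qed
qed (use lam0 a0 n1 \<beta>1 exc_pos exc_1 fpass_pos fpass_mono fpass_growth in auto)

context polymer
begin

definition \<Omega> :: "nat set \<Rightarrow> config set" where
  "\<Omega> Z = paths 0 (2 * int \<beta>) (2 * n) (2 * int \<beta>) ((*) 2 ` Z)"

lemma finite_\<Omega>: "finite (\<Omega> Z)"
  by (simp add: \<Omega>_def finite_paths)

lemma card_\<Omega>: "Z \<in> zsets \<Longrightarrow> real (card (\<Omega> Z)) = fpass \<beta> (Min Z) * gap_weight Z * fpass \<beta> (n - Max Z)"
  unfolding \<Omega>_def by (rule card_paths_zero_set[OF refl \<beta>1]) (auto simp: zsets_def)

lemma mu_\<Omega>: "Z \<in> zsets \<Longrightarrow> mu Z = lam ^ card Z * real (card (\<Omega> Z))"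
  by (simp add: card_\<Omega> mu_def wt_def)

lemma zsets_mem: "Z \<in> zsets \<Longrightarrow> z \<in> Z \<Longrightarrow> \<beta> \<le> z \<and> z \<le> n - \<beta> \<and> z \<le> n"
  unfolding zsets_def by fastforce

lemma \<Omega>_zero_iff:
  assumes "\<eta> \<in> \<Omega> Z" "x \<le> 2 * n"
  shows "\<eta> x = 0 \<longleftrightarrow> x \<in> (*) 2 ` Z"
proof -
  have Z: "{x. 0 < x \<and> x < 2 * n \<and> \<eta> x = 0} = (*) 2 ` Z" and e: "\<eta> 0 = 2 * int \<beta>" "\<eta> (2 * n) = 2 * int \<beta>"
    using assms by (auto simp: \<Omega>_def paths_def)
  have "\<eta> 0 \<noteq> 0" "\<eta> (2 * n) \<noteq> 0" using e \<beta>1 by auto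
  then have "x \<noteq> 0" "x \<noteq> 2 * n" if "\<eta> x = 0" using that by metis+
  then show ?thesis using Z assms(2) by (auto simp: nless_le)
qed

lemma H_\<Omega>: "\<eta> \<in> \<Omega> Z \<Longrightarrow> Z \<in> zsets \<Longrightarrow> H (2 * n) \<eta> = card Z"
proof -
  assume e: "\<eta> \<in> \<Omega> Z" and Z: "Z \<in> zsets"
  have "{x \<in> {0..2 * n}. \<eta> x = 0} = (*) 2 ` Z"
    using \<Omega>_zero_iff[OF e] zsets_mem[OF Z] by auto
  then show ?thesis by (simp add: H_def card_image inj_on_def)
qed

lemma \<Omega>_sub_pinned: "Z \<in> zsets \<Longrightarrow> \<Omega> Z \<subseteq> S_pinned a (2 * n)"
proof
  fix \<eta> assume Z: "Z \<in> zsets" and e: "\<eta> \<in> \<Omega> Z"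
  have "Z \<noteq> {}" using Z by (simp add: zsets_def)
  then obtain z where z: "z \<in> Z" "z \<le> n" using zsets_mem[OF Z] by blast
  then have "\<eta> (2 * z) = 0" using \<Omega>_zero_iff[OF e, of "2 * z"] by auto
  then show "\<eta> \<in> S_pinned a (2 * n)"
    using e z height unfolding \<Omega>_def paths_def S_pinned_def S_space_def
    by (auto intro!: exI[of _ "2 * z"])
qed

lemma pinned_in_\<Omega>:
  assumes e: "\<eta> \<in> S_pinned a (2 * n)"
  shows "\<exists>Z\<in>zsets. \<eta> \<in> \<Omega> Z"
proof -
  have nn: "\<And>x. x \<le> 2 * n \<Longrightarrow> 0 \<le> \<eta> x" and e0: "\<eta> 0 = 2 * int \<beta>" and eN: "\<eta> (2 * n) = 2 * int \<beta>"
    and st: "\<And>x. x < 2 * n \<Longrightarrow> \<bar>\<eta> (x + 1) - \<eta> x\<bar> = 1" and out: "\<And>x. 2 * n < x \<Longrightarrow> \<eta> x = 0"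
    using e height by (auto simp: S_pinned_def S_space_def)
  have left: "2 * int \<beta> - int x \<le> \<eta> x \<and> even (\<eta> x + int x)" if "x \<le> 2 * n" for x
    using that
  proof (induction x)
    case 0
    then show ?case using e0 by simp
  next
    case (Suc x)
    have "\<eta> (x + 1) = \<eta> x + 1 \<or> \<eta> (x + 1) = \<eta> x - 1" using st[of x] Suc.prems by linarith
    then show ?case using Suc by auto
  qed
  have right: "2 * int \<beta> - int k \<le> \<eta> (2 * n - k)" if "k \<le> 2 * n" for k
    using that
  proof (induction k)
    case 0
    then show ?case using eN by simp
  next
    case (Suc k)
    have "2 * n - k = (2 * n - Suc k) + 1" using Suc.prems by simp
    then show ?case using Suc st[of "2 * n - Suc k"] by simp
  qed
  define Z where "Z = {z. z \<le> n \<and> \<eta> (2 * z) = 0}"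
  have zero: "\<exists>z\<in>Z. x = 2 * z \<and> \<beta> \<le> z \<and> z \<le> n - \<beta>" if x: "x \<le> 2 * n" "\<eta> x = 0" for x
  proof -
    have "even x" using left[OF x(1)] x(2) by simp
    then obtain z where z: "x = 2 * z" by (elim evenE)
    have "2 * int \<beta> \<le> int x" using left[OF x(1)] x(2) by simp
    moreover have "2 * int \<beta> \<le> int (2 * n - x)" using right[of "2 * n - x"] x by simp
    ultimately show ?thesis using z x by (intro bexI[of _ z]) (auto simp: Z_def)
  qed
  have "Z \<noteq> {}" using e zero by (auto simp: S_pinned_def)
  moreover have "Z \<subseteq> {\<beta>..n - \<beta>}"
  proof
    fix z assume "z \<in> Z"
    then have "2 * z \<le> 2 * n" "\<eta> (2 * z) = 0" by (auto simp: Z_def)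
    from zero[OF this] show "z \<in> {\<beta>..n - \<beta>}" by auto
  qed
  moreover have "{x. 0 < x \<and> x < 2 * n \<and> \<eta> x = 0} = (*) 2 ` Z"
  proof
    show "{x. 0 < x \<and> x < 2 * n \<and> \<eta> x = 0} \<subseteq> (*) 2 ` Z"
    proof
      fix x assume "x \<in> {x. 0 < x \<and> x < 2 * n \<and> \<eta> x = 0}"
      then show "x \<in> (*) 2 ` Z" using zero[of x] by auto
    qed
    have "\<eta> (2 * 0) \<noteq> 0" "\<eta> (2 * n) \<noteq> 0" using e0 eN \<beta>1 by auto
    then have nz: "z \<noteq> 0" "z \<noteq> n" if "\<eta> (2 * z) = 0" for z using that by metis+
    show "(*) 2 ` Z \<subseteq> {x. 0 < x \<and> x < 2 * n \<and> \<eta> x = 0}"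
    proof
      fix x assume "x \<in> (*) 2 ` Z"
      then obtain z where "x = 2 * z" "z \<le> n" "\<eta> (2 * z) = 0" by (auto simp: Z_def)
      then show "x \<in> {x. 0 < x \<and> x < 2 * n \<and> \<eta> x = 0}" using nz[of z] by auto
    qed
  qed
  ultimately show ?thesis
    using nn e0 eN st out by (intro bexI[of _ Z]) (auto simp: zsets_def \<Omega>_def paths_def)
qed

lemma sum_pinned: "(\<Sum>\<eta>\<in>S_pinned a (2 * n). F \<eta>) = (\<Sum>Z\<in>zsets. \<Sum>\<eta>\<in>\<Omega> Z. (F \<eta> :: real))"
proof -
  have "S_pinned a (2 * n) = (\<Union>Z\<in>zsets. \<Omega> Z)" using pinned_in_\<Omega> \<Omega>_sub_pinned by blast
  moreover have "\<Omega> Z \<inter> \<Omega> Z' = {}" if "Z \<noteq> Z'" for Z Z'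
  proof (rule ccontr)
    assume "\<Omega> Z \<inter> \<Omega> Z' \<noteq> {}"
    then obtain \<eta> where "\<eta> \<in> \<Omega> Z" "\<eta> \<in> \<Omega> Z'" by blast
    moreover have "{x. 0 < x \<and> x < 2 * n \<and> \<eta> x = 0} = (*) 2 ` Y" if "\<eta> \<in> \<Omega> Y" for Y
      using that by (simp add: \<Omega>_def paths_def)
    ultimately have "(*) 2 ` Z = (*) (2 :: nat) ` Z'" by metis
    moreover have "inj ((*) (2 :: nat))" by (simp add: inj_on_def)
    ultimately show False using that by (simp only: inj_image_eq_iff)
  qed
  ultimately show ?thesis using finite_zsets finite_\<Omega> by (simp add: sum.UNION_disjoint)
qed

lemma finite_pinned: "finite (S_pinned a (2 * n))"
proof -
  have "S_pinned a (2 * n) = (\<Union>Z\<in>zsets. \<Omega> Z)" using pinned_in_\<Omega> \<Omega>_sub_pinned by blast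
  then show ?thesis using finite_zsets finite_\<Omega> by simp
qed

definition energy :: "(config \<Rightarrow> real) \<Rightarrow> real" where
  "energy f = (\<Sum>\<eta>\<in>S_pinned a (2 * n). lam ^ H (2 * n) \<eta> *
     (\<Sum>x\<in>{1..2 * n - 1}. if flip \<eta> x \<in> S_pinned a (2 * n) then (f (flip \<eta> x) - f \<eta>)\<^sup>2 else 0))"

lemma energy_alt: "energy f = (\<Sum>Z\<in>zsets. lam ^ card Z * (\<Sum>\<eta>\<in>\<Omega> Z.
     \<Sum>x\<in>{1..2 * n - 1}. if flip \<eta> x \<in> S_pinned a (2 * n) then (f (flip \<eta> x) - f \<eta>)\<^sup>2 else 0))"
  unfolding energy_def sum_pinned sum_distrib_left by (intro sum.cong refl) (simp add: H_\<Omega>)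

lemma energy_nonneg: "0 \<le> energy f"
  unfolding energy_def using lam0 by (intro sum_nonneg mult_nonneg_nonneg) auto

definition cond_mean :: "(config \<Rightarrow> real) \<Rightarrow> nat set \<Rightarrow> real" where
  "cond_mean f Z = (\<Sum>\<eta>\<in>\<Omega> Z. f \<eta>) / real (card (\<Omega> Z))"

lemma cond_variance:
  "(\<Sum>Z\<in>zsets. lam ^ card Z * (\<Sum>\<eta>\<in>\<Omega> Z. (f \<eta> - cond_mean f Z)\<^sup>2)) \<le> (real (2 * n))\<^sup>2 / 4 * energy f"
proof -
  have "(\<Sum>Z\<in>zsets. lam ^ card Z * (\<Sum>\<eta>\<in>\<Omega> Z. (f \<eta> - cond_mean f Z)\<^sup>2)) \<le>
    (\<Sum>Z\<in>zsets. lam ^ card Z * ((real (2 * n))\<^sup>2 / 4 * (\<Sum>\<eta>\<in>\<Omega> Z. \<Sum>x\<in>{1..2 * n - 1}. if flip \<eta> x \<in> \<Omega> Z then (f (flip \<eta> x) - f \<eta>)\<^sup>2 else 0)))"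
    unfolding cond_mean_def using lam0 n1
    by (intro sum_mono mult_left_mono paths_poincare[OF \<Omega>_def]) auto
  also have "\<dots> \<le> (\<Sum>Z\<in>zsets. lam ^ card Z * ((real (2 * n))\<^sup>2 / 4 * (\<Sum>\<eta>\<in>\<Omega> Z. \<Sum>x\<in>{1..2 * n - 1}. if flip \<eta> x \<in> S_pinned a (2 * n) then (f (flip \<eta> x) - f \<eta>)\<^sup>2 else 0)))"
    using \<Omega>_sub_pinned lam0 by (intro sum_mono mult_left_mono) auto
  also have "\<dots> = (real (2 * n))\<^sup>2 / 4 * energy f"
    unfolding energy_alt sum_distrib_left by (intro sum.cong refl) (simp only: mult_ac)
  finally show ?thesis .
qed

lemma flip_zero_mem:
  assumes e: "\<eta> \<in> \<Omega> I" and I: "I \<in> zsets" and z: "z \<in> I"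
  shows "flip \<eta> (2 * z) \<in> \<Omega> (I - {z})"
proof -
  have zz: "\<beta> \<le> z" "z \<le> n - \<beta>" using zsets_mem[OF I z] by auto
  have x: "0 < 2 * z" "2 * z < 2 * n" using zz \<beta>1 by auto
  have p: "\<eta> \<in> paths 0 (2 * int \<beta>) (2 * n) (2 * int \<beta>) ((*) 2 ` I)" using e by (simp add: \<Omega>_def)
  have nn: "0 \<le> \<eta> y" if "y \<le> 2 * n" for y using p that by (simp add: paths_def)
  have bridge_mass: "\<eta> (2 * z) = 0" using \<Omega>_zero_iff[OF e, of "2 * z"] z x by auto
  have "\<eta> (2 * z + 1) = 1" using paths_step[OF p, of "2 * z"] x nn[of "2 * z + 1"] bridge_mass by auto
  moreover have "2 * z - 1 \<le> 2 * n" using x by simp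
  then have "\<eta> (2 * z - 1) = 1" using paths_step_left[OF p, of "2 * z"] x nn[of "2 * z - 1"] bridge_mass by auto
  ultimately have f2: "flip \<eta> (2 * z) (2 * z) = 2" using bridge_mass by (simp add: flip_same)
  have "\<bar>flip \<eta> (2 * z) (y + 1) - flip \<eta> (2 * z) y\<bar> = 1" if "y < 2 * n" for y
  proof -
    consider "y = 2 * z" | "y + 1 = 2 * z" | "y \<noteq> 2 * z" "y + 1 \<noteq> 2 * z" by auto
    then show ?thesis
    proof cases
      case 1
      then show ?thesis using f2 \<open>\<eta> (2 * z + 1) = 1\<close> by (simp add: flip_other)
    next
      case 2
      then have "y = 2 * z - 1" "y \<noteq> 2 * z" by auto
      then show ?thesis using f2 2 \<open>\<eta> (2 * z - 1) = 1\<close> by (simp add: flip_other)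
    next
      case 3
      then show ?thesis using p that by (simp add: flip_other paths_def)
    qed
  qed
  moreover have "{y. 0 < y \<and> y < 2 * n \<and> flip \<eta> (2 * z) y = 0} = (*) 2 ` (I - {z})"
  proof -
    have "{y. 0 < y \<and> y < 2 * n \<and> flip \<eta> (2 * z) y = 0} = {y. 0 < y \<and> y < 2 * n \<and> \<eta> y = 0} - {2 * z}"
    proof (rule set_eqI)
      fix y show "y \<in> {y. 0 < y \<and> y < 2 * n \<and> flip \<eta> (2 * z) y = 0} \<longleftrightarrow> y \<in> {y. 0 < y \<and> y < 2 * n \<and> \<eta> y = 0} - {2 * z}"
        using f2 by (cases "y = 2 * z") (auto simp: flip_other)
    qed
    also have "{y. 0 < y \<and> y < 2 * n \<and> \<eta> y = 0} = (*) 2 ` I" using p by (simp add: paths_def)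
    also have "(*) 2 ` I - {2 * z} = (*) 2 ` (I - {z})" by auto
    finally show ?thesis .
  qed
  moreover have "0 \<le> flip \<eta> (2 * z) y" if "y \<le> 2 * n" for y
    using f2 nn[OF that] by (cases "y = 2 * z") (auto simp: flip_other)
  moreover have "flip \<eta> (2 * z) 0 = 2 * int \<beta>" "flip \<eta> (2 * z) (2 * n) = 2 * int \<beta>" "\<And>y. 2 * n < y \<Longrightarrow> flip \<eta> (2 * z) y = 0"
    using p x by (auto simp: flip_other paths_def)
  ultimately show ?thesis unfolding \<Omega>_def paths_def by simp
qed

lemma toggle_energy_le:
  "toggle_energy (cond_mean f) \<le> (2 + lam * (real n + 1) * (real (2 * n))\<^sup>2 / 2) * energy f"
proof -
  define P where "P = Sigma zsets (\<lambda>I. Sigma {z \<in> I. I \<noteq> {z}} (\<lambda>z. \<Omega> I))"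
  define Q where "Q = Sigma zsets (\<lambda>Z. \<Omega> Z \<times> {..n})"
  have finP: "finite P" unfolding P_def using finite_zsets zsets_finite finite_\<Omega> by (intro finite_SigmaI) auto
  have finQ: "finite Q" unfolding Q_def using finite_zsets finite_\<Omega> by (intro finite_SigmaI) auto
  define u where "u = (\<lambda>(I :: nat set, z, \<zeta>). lam ^ card I * (f (flip \<zeta> (2 * z)) - f \<zeta>)\<^sup>2)"
  define v where "v = (\<lambda>(I, z, \<zeta>). lam ^ card I * (f (flip \<zeta> (2 * z)) - cond_mean f (I - {z}))\<^sup>2)"
  have sub: "I - {z} \<in> zsets" if "I \<in> zsets" "z \<in> I" "I \<noteq> {z}" for I z using that by (auto simp: zsets_def)
  have "toggle_energy (cond_mean f) = (\<Sum>I\<in>zsets. \<Sum>z\<in>{z \<in> I. I \<noteq> {z}}. mu I * (cond_mean f I - cond_mean f (I - {z}))\<^sup>2)"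
    unfolding toggle_energy_def
    by (rule sum.cong[OF refl], rule sum.mono_neutral_cong_right) (auto simp: zsets_finite)
  also have "\<dots> \<le> (\<Sum>I\<in>zsets. \<Sum>z\<in>{z \<in> I. I \<noteq> {z}}. \<Sum>\<zeta>\<in>\<Omega> I. 2 * u (I, z, \<zeta>) + 2 * v (I, z, \<zeta>))"
  proof (intro sum_mono)
    fix I z assume I: "I \<in> zsets"
    define c where "c = cond_mean f (I - {z})"
    have "mu I * (cond_mean f I - c)\<^sup>2 = lam ^ card I * (real (card (\<Omega> I)) * (cond_mean f I - c)\<^sup>2)"
      using mu_\<Omega>[OF I] by simp
    also have "\<dots> \<le> lam ^ card I * (\<Sum>\<zeta>\<in>\<Omega> I. (f \<zeta> - c)\<^sup>2)"
      unfolding cond_mean_def[of f I] using lam0 by (intro mult_left_mono jensen_sum finite_\<Omega>) auto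
    also have "\<dots> = (\<Sum>\<zeta>\<in>\<Omega> I. lam ^ card I * (f \<zeta> - c)\<^sup>2)" by (simp add: sum_distrib_left)
    also have "\<dots> \<le> (\<Sum>\<zeta>\<in>\<Omega> I. 2 * u (I, z, \<zeta>) + 2 * v (I, z, \<zeta>))"
    proof (rule sum_mono)
      fix \<zeta>
      define g where "g = f (flip \<zeta> (2 * z))"
      have "2 * (g - f \<zeta>)\<^sup>2 + 2 * (g - c)\<^sup>2 - (f \<zeta> - c)\<^sup>2 = (2 * g - f \<zeta> - c)\<^sup>2"
        by (simp add: power2_eq_square algebra_simps)
      then have "(f \<zeta> - c)\<^sup>2 \<le> 2 * (g - f \<zeta>)\<^sup>2 + 2 * (g - c)\<^sup>2" by (smt (verit) zero_le_power2)
      then have "lam ^ card I * (f \<zeta> - c)\<^sup>2 \<le> lam ^ card I * (2 * (g - f \<zeta>)\<^sup>2 + 2 * (g - c)\<^sup>2)"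
        using lam0 by (intro mult_left_mono) auto
      then show "lam ^ card I * (f \<zeta> - c)\<^sup>2 \<le> 2 * u (I, z, \<zeta>) + 2 * v (I, z, \<zeta>)"
        by (simp add: u_def v_def c_def g_def algebra_simps)
    qed
    finally show "mu I * (cond_mean f I - cond_mean f (I - {z}))\<^sup>2 \<le> (\<Sum>\<zeta>\<in>\<Omega> I. 2 * u (I, z, \<zeta>) + 2 * v (I, z, \<zeta>))"
      by (simp add: c_def)
  qed
  also have "\<dots> = (\<Sum>p\<in>P. 2 * u p + 2 * v p)"
  proof -
    have "(\<Sum>z\<in>{z \<in> I. I \<noteq> {z}}. \<Sum>\<zeta>\<in>\<Omega> I. 2 * u (I, z, \<zeta>) + 2 * v (I, z, \<zeta>)) =
       (\<Sum>q\<in>Sigma {z \<in> I. I \<noteq> {z}} (\<lambda>z. \<Omega> I). 2 * u (I, q) + 2 * v (I, q))" if "I \<in> zsets" for I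
      using zsets_finite[OF that] finite_\<Omega> by (subst sum.Sigma) (auto simp: split_def)
    then have "(\<Sum>I\<in>zsets. \<Sum>z\<in>{z \<in> I. I \<noteq> {z}}. \<Sum>\<zeta>\<in>\<Omega> I. 2 * u (I, z, \<zeta>) + 2 * v (I, z, \<zeta>)) =
       (\<Sum>I\<in>zsets. \<Sum>q\<in>Sigma {z \<in> I. I \<noteq> {z}} (\<lambda>z. \<Omega> I). 2 * u (I, q) + 2 * v (I, q))" by simp
    also have "\<dots> = (\<Sum>p\<in>P. 2 * u p + 2 * v p)" unfolding P_def
      using finite_zsets zsets_finite finite_\<Omega> by (subst sum.Sigma) (auto simp: split_def)
    finally show ?thesis .
  qed
  also have "\<dots> = 2 * (\<Sum>p\<in>P. u p) + 2 * (\<Sum>p\<in>P. v p)" by (simp add: sum.distrib sum_distrib_left)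
  finally have 1: "toggle_energy (cond_mean f) \<le> 2 * (\<Sum>p\<in>P. u p) + 2 * (\<Sum>p\<in>P. v p)" .
  have 2: "(\<Sum>p\<in>P. u p) \<le> energy f"
  proof -
    define Q' where "Q' = Sigma zsets (\<lambda>Z. \<Omega> Z \<times> {1..2 * n - 1})"
    define w where "w = (\<lambda>(Z :: nat set, \<eta>, x). lam ^ card Z * (if flip \<eta> x \<in> S_pinned a (2 * n) then (f (flip \<eta> x) - f \<eta>)\<^sup>2 else 0))"
    have finQ': "finite Q'" unfolding Q'_def using finite_zsets finite_\<Omega> by (intro finite_SigmaI) auto
    have "(\<Sum>p\<in>P. u p) \<le> (\<Sum>q\<in>Q'. w q)"
    proof (rule sum_le_included[OF finP finQ', where i = "\<lambda>(Z, \<eta>, x). (Z, x div 2, \<eta>)"])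
      show "\<forall>q\<in>Q'. 0 \<le> w q" using lam0 by (auto simp: w_def)
      show "\<forall>p\<in>P. \<exists>q\<in>Q'. (case q of (Z, \<eta>, x) \<Rightarrow> (Z, x div 2, \<eta>)) = p \<and> u p \<le> w q"
      proof
        fix p assume "p \<in> P"
        then obtain I z \<zeta> where p: "p = (I, z, \<zeta>)" and I: "I \<in> zsets" "z \<in> I" "I \<noteq> {z}" "\<zeta> \<in> \<Omega> I" by (auto simp: P_def)
        have "\<beta> \<le> z" "z \<le> n - \<beta>" using zsets_mem[OF I(1,2)] by auto
        then have "2 * z \<in> {1..2 * n - 1}" using \<beta>1 n1 by auto
        moreover have "flip \<zeta> (2 * z) \<in> S_pinned a (2 * n)"
          using flip_zero_mem[OF I(4,1,2)] \<Omega>_sub_pinned[OF sub[OF I(1-3)]] by blast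
        ultimately show "\<exists>q\<in>Q'. (case q of (Z, \<eta>, x) \<Rightarrow> (Z, x div 2, \<eta>)) = p \<and> u p \<le> w q"
          using I p by (intro bexI[of _ "(I, \<zeta>, 2 * z)"]) (auto simp: Q'_def u_def w_def)
      qed
    qed
    also have "\<dots> = (\<Sum>Z\<in>zsets. \<Sum>q\<in>\<Omega> Z \<times> {1..2 * n - 1}. w (Z, q))" unfolding Q'_def
      using finite_zsets finite_\<Omega> by (subst sum.Sigma) (auto simp: split_def)
    also have "\<dots> = energy f" unfolding energy_alt sum_distrib_left
      by (rule sum.cong[OF refl]) (simp add: sum.cartesian_product' w_def)
    finally show ?thesis .
  qed
  have 3: "(\<Sum>p\<in>P. v p) \<le> lam * (real n + 1) * ((real (2 * n))\<^sup>2 / 4 * energy f)"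
  proof -
    define w where "w = (\<lambda>(Z, \<eta>, z :: nat). lam * (lam ^ card Z * (f \<eta> - cond_mean f Z)\<^sup>2))"
    have "(\<Sum>p\<in>P. v p) \<le> (\<Sum>q\<in>Q. w q)"
    proof (rule sum_le_included[OF finP finQ, where i = "\<lambda>(Z, \<eta>, z). (insert z Z, z, flip \<eta> (2 * z))"])
      show "\<forall>q\<in>Q. 0 \<le> w q" using lam0 by (auto simp: w_def)
      show "\<forall>p\<in>P. \<exists>q\<in>Q. (case q of (Z, \<eta>, z) \<Rightarrow> (insert z Z, z, flip \<eta> (2 * z))) = p \<and> v p \<le> w q"
      proof
        fix p assume "p \<in> P"
        then obtain I z \<zeta> where p: "p = (I, z, \<zeta>)" and I: "I \<in> zsets" "z \<in> I" "I \<noteq> {z}" "\<zeta> \<in> \<Omega> I" by (auto simp: P_def)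
        have z: "\<beta> \<le> z" "z \<le> n" using zsets_mem[OF I(1,2)] by auto
        have "card I = Suc (card (I - {z}))" using I zsets_finite by (intro card.remove) auto
        then have "v p = w (I - {z}, flip \<zeta> (2 * z), z)" by (simp add: p v_def w_def)
        moreover have "insert z (I - {z}) = I" using I by auto
        moreover have "flip (flip \<zeta> (2 * z)) (2 * z) = \<zeta>" using z \<beta>1 by (intro flip_flip) auto
        ultimately show "\<exists>q\<in>Q. (case q of (Z, \<eta>, z) \<Rightarrow> (insert z Z, z, flip \<eta> (2 * z))) = p \<and> v p \<le> w q"
          using flip_zero_mem[OF I(4,1,2)] sub[OF I(1-3)] z p
          by (intro bexI[of _ "(I - {z}, flip \<zeta> (2 * z), z)"]) (auto simp: Q_def)
      qed
    qed
    also have "\<dots> = (\<Sum>Z\<in>zsets. \<Sum>q\<in>\<Omega> Z \<times> {..n}. w (Z, q))" unfolding Q_def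
      using finite_zsets finite_\<Omega> by (subst sum.Sigma) (auto simp: split_def)
    also have "\<dots> = (\<Sum>Z\<in>zsets. \<Sum>\<eta>\<in>\<Omega> Z. \<Sum>z\<in>{..n}. w (Z, \<eta>, z))"
      by (intro sum.cong refl, subst sum.cartesian_product) (auto simp: split_def)
    also have "\<dots> = lam * (real n + 1) * (\<Sum>Z\<in>zsets. lam ^ card Z * (\<Sum>\<eta>\<in>\<Omega> Z. (f \<eta> - cond_mean f Z)\<^sup>2))"
      by (simp add: w_def sum_distrib_left mult_ac add.commute)
    also have "\<dots> \<le> lam * (real n + 1) * ((real (2 * n))\<^sup>2 / 4 * energy f)"
      using lam0 by (intro mult_left_mono[OF cond_variance]) auto
    finally show ?thesis .
  qed
  have X: "(2 + lam * (real n + 1) * X / 2) * energy f = 2 * energy f + 2 * (lam * (real n + 1) * (X / 4 * energy f))" for X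
    by (simp add: algebra_simps)
  show ?thesis unfolding X using 1 2 3 by linarith
qed

lemma pinned_poincare:
  fixes f :: "config \<Rightarrow> real"
  defines "C1 \<equiv> ((1 / a) ^ 4)\<^sup>2 * (1 + 20 / lam)" and "C2 \<equiv> 3 * (1 + 4 / lam) * ((1 + lam) * 16 + 1)"
  shows "\<exists>c. (\<Sum>\<eta>\<in>S_pinned a (2 * n). lam ^ H (2 * n) \<eta> * (f \<eta> - c)\<^sup>2) \<le>
     (1 + 2 * (32 + 8 * C1 * C2) * (2 + lam)) * real (2 * n) ^ 12 * energy f"
proof -
  define x where "x = real (2 * n)"
  define G where "G = cond_mean f"
  have x1: "1 \<le> x" and nx: "real n \<le> x" "real n + 1 \<le> x" using n1 by (auto simp: x_def)
  have C: "0 \<le> C1" "0 \<le> C2" using lam0 by (auto simp: C1_def C2_def)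
  define hr where "hr = hub_ratio"
  define ed where "ed = 3 * (1 + 4 / lam) * ((1 + lam) * (16 * x\<^sup>2 * x) + 1)"
  define P where "P = (real n + 1)\<^sup>2 * (2 * (16 * x\<^sup>2 * x) + 8 * (real n)\<^sup>2 * hr * ed)"
  obtain c where c: "(\<Sum>Z\<in>zsets. mu Z * (G Z - c)\<^sup>2) \<le> P * toggle_energy G"
    using zsets_poincare[of G] unfolding P_def hr_def ed_def x_def by blast
  have pw: "x ^ i \<le> x ^ j" if "i \<le> j" for i j using power_increasing[OF that x1] .
  have hub: "hr \<le> C1 * x\<^sup>2"
  proof -
    have "4 * real n \<le> 4 * x\<^sup>2" using nx pw[of 1 2] by simp
    then have "4 * real n / lam \<le> 4 * x\<^sup>2 / lam" using lam0 by (intro divide_right_mono) auto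
    moreover have "1 \<le> x\<^sup>2" using pw[of 0 2] by simp
    moreover have "(1 + 20 / lam) * x\<^sup>2 = x\<^sup>2 + 16 * x\<^sup>2 / lam + 4 * x\<^sup>2 / lam" using lam0 by (simp add: field_simps)
    ultimately have "1 + 16 * x\<^sup>2 / lam + 4 * real n / lam \<le> (1 + 20 / lam) * x\<^sup>2" by linarith
    then have "((1 / a) ^ 4)\<^sup>2 * (1 + 16 * x\<^sup>2 / lam + 4 * real n / lam) \<le> ((1 / a) ^ 4)\<^sup>2 * ((1 + 20 / lam) * x\<^sup>2)"
      by (intro mult_left_mono) auto
    then show ?thesis unfolding hr_def hub_ratio_def C1_def unfolding x_def[symmetric] by (simp only: mult.assoc)
  qed
  have edge: "ed \<le> C2 * x ^ 3"
  proof -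
    have "1 \<le> x ^ 3" using pw[of 0 3] by simp
    then have "(1 + lam) * (16 * x\<^sup>2 * x) + 1 \<le> ((1 + lam) * 16 + 1) * x ^ 3"
      by (simp add: power2_eq_square power3_eq_cube algebra_simps)
    then have "3 * (1 + 4 / lam) * ((1 + lam) * (16 * x\<^sup>2 * x) + 1) \<le> 3 * (1 + 4 / lam) * (((1 + lam) * 16 + 1) * x ^ 3)"
      using lam0 by (intro mult_left_mono) auto
    then show ?thesis unfolding ed_def C2_def by (simp only: mult.assoc)
  qed
  have pos: "0 \<le> hr" "0 \<le> ed" using hub_ratio_pos lam0 x1 by (auto simp: hr_def ed_def less_imp_le)
  have P: "P \<le> (32 + 8 * C1 * C2) * x ^ 9"
  proof -
    have "8 * (real n)\<^sup>2 * hr * ed \<le> 8 * x\<^sup>2 * (C1 * x\<^sup>2) * (C2 * x ^ 3)"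
      using nx hub edge C x1 pos by (intro mult_mono power_mono mult_nonneg_nonneg) (auto simp: less_imp_le)
    also have "\<dots> = 8 * C1 * C2 * x ^ 7" by (simp add: power2_eq_square power3_eq_cube eval_nat_numeral)
    finally have 1: "8 * (real n)\<^sup>2 * hr * ed \<le> 8 * C1 * C2 * x ^ 7" .
    have "2 * (16 * x\<^sup>2 * x) = 32 * x ^ 3" by (simp add: power2_eq_square power3_eq_cube)
    also have "\<dots> \<le> 32 * x ^ 7" using pw[of 3 7] by simp
    finally have 2: "2 * (16 * x\<^sup>2 * x) \<le> 32 * x ^ 7" .
    have A: "(real n + 1)\<^sup>2 \<le> x\<^sup>2" using nx by (intro power_mono) auto
    have B: "0 \<le> 2 * (16 * x\<^sup>2 * x) + 8 * (real n)\<^sup>2 * hr * ed" using pos x1 by simp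
    have "P \<le> x\<^sup>2 * (32 * x ^ 7 + 8 * C1 * C2 * x ^ 7)"
      unfolding P_def by (rule mult_mono[OF A add_mono[OF 2 1] _ B]) simp
    also have "\<dots> = (32 + 8 * C1 * C2) * x ^ 9" by (simp add: algebra_simps eval_nat_numeral)
    finally show ?thesis .
  qed
  have T: "toggle_energy G \<le> (2 + lam) * x ^ 3 * energy f"
  proof -
    have "(real n + 1) * x\<^sup>2 \<le> x * x\<^sup>2" using nx by (intro mult_right_mono) auto
    then have "lam * ((real n + 1) * x\<^sup>2) \<le> lam * (2 * x ^ 3)"
      using lam0 x1 by (intro mult_left_mono) (auto simp: power2_eq_square power3_eq_cube)
    moreover have "1 \<le> x ^ 3" using pw[of 0 3] by simp
    ultimately have "2 + lam * ((real n + 1) * x\<^sup>2) / 2 \<le> 2 * x ^ 3 + lam * (2 * x ^ 3) / 2" by linarith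
    then have "2 + lam * (real n + 1) * x\<^sup>2 / 2 \<le> (2 + lam) * x ^ 3" by (simp add: distrib_right mult.assoc)
    then have "(2 + lam * (real n + 1) * x\<^sup>2 / 2) * energy f \<le> (2 + lam) * x ^ 3 * energy f"
      using energy_nonneg by (intro mult_right_mono) auto
    then show ?thesis using toggle_energy_le[of f] by (simp only: G_def x_def)
  qed
  have sq: "(y - c)\<^sup>2 \<le> 2 * (y - g)\<^sup>2 + 2 * (g - c)\<^sup>2" for y g
  proof -
    have "2 * (y - g)\<^sup>2 + 2 * (g - c)\<^sup>2 - (y - c)\<^sup>2 = ((y - g) - (g - c))\<^sup>2"
      by (simp add: power2_eq_square algebra_simps)
    then show ?thesis by (smt (verit) zero_le_power2)
  qed
  have "(\<Sum>\<eta>\<in>S_pinned a (2 * n). lam ^ H (2 * n) \<eta> * (f \<eta> - c)\<^sup>2) = (\<Sum>Z\<in>zsets. \<Sum>\<eta>\<in>\<Omega> Z. lam ^ card Z * (f \<eta> - c)\<^sup>2)"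
    unfolding sum_pinned by (intro sum.cong refl) (simp add: H_\<Omega>)
  also have "\<dots> \<le> (\<Sum>Z\<in>zsets. \<Sum>\<eta>\<in>\<Omega> Z. lam ^ card Z * (2 * (f \<eta> - G Z)\<^sup>2 + 2 * (G Z - c)\<^sup>2))"
    using sq lam0 by (intro sum_mono mult_left_mono) auto
  also have "\<dots> = (\<Sum>Z\<in>zsets. 2 * (lam ^ card Z * (\<Sum>\<eta>\<in>\<Omega> Z. (f \<eta> - G Z)\<^sup>2)) + 2 * (mu Z * (G Z - c)\<^sup>2))"
    by (intro sum.cong refl) (simp add: mu_\<Omega> sum.distrib distrib_left sum_distrib_left mult_ac)
  also have "\<dots> = 2 * (\<Sum>Z\<in>zsets. lam ^ card Z * (\<Sum>\<eta>\<in>\<Omega> Z. (f \<eta> - G Z)\<^sup>2)) + 2 * (\<Sum>Z\<in>zsets. mu Z * (G Z - c)\<^sup>2)"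
    by (simp add: sum.distrib sum_distrib_left)
  also have "\<dots> \<le> 2 * (x\<^sup>2 / 4 * energy f) + 2 * (((32 + 8 * C1 * C2) * x ^ 9) * ((2 + lam) * x ^ 3 * energy f))"
  proof (intro add_mono mult_left_mono)
    show "(\<Sum>Z\<in>zsets. lam ^ card Z * (\<Sum>\<eta>\<in>\<Omega> Z. (f \<eta> - G Z)\<^sup>2)) \<le> x\<^sup>2 / 4 * energy f"
      using cond_variance[of f] by (simp only: G_def x_def)
    have "P * toggle_energy G \<le> ((32 + 8 * C1 * C2) * x ^ 9) * ((2 + lam) * x ^ 3 * energy f)"
      using P T toggle_energy_nonneg[of G] C x1 by (intro mult_mono) auto
    then show "(\<Sum>Z\<in>zsets. mu Z * (G Z - c)\<^sup>2) \<le> ((32 + 8 * C1 * C2) * x ^ 9) * ((2 + lam) * x ^ 3 * energy f)"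
      using c by linarith
  qed auto
  also have "\<dots> \<le> (1 + 2 * (32 + 8 * C1 * C2) * (2 + lam)) * x ^ 12 * energy f"
  proof -
    have "2 * (x\<^sup>2 / 4) \<le> x ^ 12" using pw[of 2 12] zero_le_power2[of x] by linarith
    then have "2 * (x\<^sup>2 / 4) * energy f \<le> x ^ 12 * energy f" using energy_nonneg by (intro mult_right_mono)
    moreover have "2 * (((32 + 8 * C1 * C2) * x ^ 9) * ((2 + lam) * x ^ 3 * energy f)) = 2 * (32 + 8 * C1 * C2) * (2 + lam) * x ^ 12 * energy f"
    proof -
      have "x ^ 12 = x ^ 9 * x ^ 3" by (simp flip: power_add)
      then show ?thesis by (simp only: mult_ac)
    qed
    ultimately show ?thesis by (simp only: distrib_right mult_1 mult.assoc)
  qed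
  finally show ?thesis unfolding x_def by blast
qed

lemma site_rate_lower_bound:
  assumes e: "\<eta> \<in> S_pinned a (2 * n)" and fe: "flip \<eta> x \<in> S_pinned a (2 * n)" and ne: "flip \<eta> x \<noteq> \<eta>"
    and x: "0 < x" "x < 2 * n"
  shows "min (1 / 2) (min (lam / (lam + 1)) (1 / (lam + 1))) \<le> site_rate lam \<eta> x"
proof -
  have s1: "\<bar>\<eta> (x + 1) - \<eta> x\<bar> = 1" using e x by (simp add: S_pinned_def S_space_def)
  have "x - 1 < 2 * n" "x - 1 + 1 = x" using x by auto
  then have s2: "\<bar>\<eta> x - \<eta> (x - 1)\<bar> = 1" using e unfolding S_pinned_def S_space_def by fastforce
  have p: "0 \<le> \<eta> x" "0 \<le> flip \<eta> x x" using e fe x by (auto simp: S_pinned_def S_space_def)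
  have fx: "flip \<eta> x x = \<eta> (x + 1) + \<eta> (x - 1) - \<eta> x" by (rule flip_same)
  have ne': "flip \<eta> x x \<noteq> \<eta> x" using ne by (auto simp: flip_def)
  have b: "min (1 / 2) (min (lam / (lam + 1)) (1 / (lam + 1))) \<le> 1 / 2"
    "min (1 / 2) (min (lam / (lam + 1)) (1 / (lam + 1))) \<le> lam / (lam + 1)"
    "min (1 / 2) (min (lam / (lam + 1)) (1 / (lam + 1))) \<le> 1 / (lam + 1)"
    by (simp_all only: min_le_iff_disj order_refl simp_thms)
  consider "0 < \<eta> x" "0 < flip \<eta> x x" | "\<eta> x = 0" | "0 < \<eta> x" "flip \<eta> x x = 0" using p by linarith
  then show ?thesis
  proof cases
    case 1
    then have "site_rate lam \<eta> x = 1 / 2" by (simp add: site_rate_def)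
    then show ?thesis using b(1) by simp
  next
    case 2
    then have "site_rate lam \<eta> x = 1 / (lam + 1)" by (simp add: site_rate_def)
    then show ?thesis using b(3) by simp
  next
    case 3
    then have "\<eta> (x - 1) = 1" "\<eta> (x + 1) = 1" "\<eta> x = 2" using s1 s2 fx ne' by linarith+
    then have "site_rate lam \<eta> x = lam / (lam + 1)" using 3 by (simp add: site_rate_def)
    then show ?thesis using b(2) by simp
  qed
qed

lemma dirichlet_lower_bound:
  "min (1 / 2) (min (lam / (lam + 1)) (1 / (lam + 1))) * energy f \<le>
     2 * (\<Sum>\<zeta>\<in>S_pinned a (2 * n). lam ^ H (2 * n) \<zeta>) * dirichlet1 lam a (2 * n) f"
proof (cases "S_pinned a (2 * n) = {}")
  case True
  then show ?thesis by (simp add: energy_def)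
next
  case False
  define S where "S = S_pinned a (2 * n)"
  define q where "q = min (1 / 2) (min (lam / (lam + 1)) (1 / (lam + 1)))"
  define Zp where "Zp = (\<Sum>\<zeta>\<in>S. lam ^ H (2 * n) \<zeta>)"
  have fin: "finite S" by (simp add: S_def finite_pinned)
  have Zp: "0 < Zp" unfolding Zp_def using fin False lam0 by (intro sum_pos) (auto simp: S_def)
  have row: "(\<Sum>\<eta>'\<in>S. rate lam (2 * n) \<eta> \<eta>' * (f \<eta>' - f \<eta>)\<^sup>2) =
      (\<Sum>x\<in>{1..2 * n - 1}. if flip \<eta> x \<in> S then site_rate lam \<eta> x * (f (flip \<eta> x) - f \<eta>)\<^sup>2 else 0)" for \<eta>
  proof -
    have "(\<Sum>\<eta>'\<in>S. rate lam (2 * n) \<eta> \<eta>' * (f \<eta>' - f \<eta>)\<^sup>2) =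
      (\<Sum>\<eta>'\<in>S. \<Sum>x\<in>{1..2 * n - 1}. if \<eta>' = flip \<eta> x then site_rate lam \<eta> x * (f \<eta>' - f \<eta>)\<^sup>2 else 0)"
      unfolding rate_def sum_distrib_right by (intro sum.cong refl) auto
    also have "\<dots> = (\<Sum>x\<in>{1..2 * n - 1}. \<Sum>\<eta>'\<in>S. if \<eta>' = flip \<eta> x then site_rate lam \<eta> x * (f \<eta>' - f \<eta>)\<^sup>2 else 0)"
      by (rule sum.swap)
    also have "\<dots> = (\<Sum>x\<in>{1..2 * n - 1}. if flip \<eta> x \<in> S then site_rate lam \<eta> x * (f (flip \<eta> x) - f \<eta>)\<^sup>2 else 0)"
      using fin by (simp add: sum.delta)
    finally show ?thesis .
  qed
  have "q * energy f = (\<Sum>\<eta>\<in>S. lam ^ H (2 * n) \<eta> * (\<Sum>x\<in>{1..2 * n - 1}. if flip \<eta> x \<in> S then q * (f (flip \<eta> x) - f \<eta>)\<^sup>2 else 0))"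
    unfolding energy_def S_def[symmetric] sum_distrib_left by (intro sum.cong refl) auto
  also have "\<dots> \<le> (\<Sum>\<eta>\<in>S. lam ^ H (2 * n) \<eta> * (\<Sum>x\<in>{1..2 * n - 1}. if flip \<eta> x \<in> S then site_rate lam \<eta> x * (f (flip \<eta> x) - f \<eta>)\<^sup>2 else 0))"
  proof (intro sum_mono mult_left_mono)
    fix \<eta> x assume e: "\<eta> \<in> S" and x: "x \<in> {1..2 * n - 1}"
    show "(if flip \<eta> x \<in> S then q * (f (flip \<eta> x) - f \<eta>)\<^sup>2 else 0) \<le> (if flip \<eta> x \<in> S then site_rate lam \<eta> x * (f (flip \<eta> x) - f \<eta>)\<^sup>2 else 0)"
    proof (cases "flip \<eta> x \<in> S \<and> flip \<eta> x \<noteq> \<eta>")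
      case True
      then have "q \<le> site_rate lam \<eta> x" unfolding q_def using e x n1 by (intro site_rate_lower_bound) (auto simp: S_def)
      then show ?thesis using True by (simp add: mult_right_mono)
    qed auto
  qed (use lam0 in auto)
  also have "\<dots> = 2 * Zp * dirichlet1 lam a (2 * n) f"
  proof -
    have "dirichlet1 lam a (2 * n) f = (1 / 2) * (\<Sum>\<eta>\<in>S. (lam ^ H (2 * n) \<eta> / Zp) * (\<Sum>\<eta>'\<in>S. rate lam (2 * n) \<eta> \<eta>' * (f \<eta>' - f \<eta>)\<^sup>2))"
      unfolding dirichlet1_def S_def[symmetric] sum_distrib_left
      by (intro sum.cong refl arg_cong[where f = "(*) (1 / 2)"]) (simp add: pi_pinned_def S_def[symmetric] Zp_def)
    also have "\<dots> = (1 / 2) * ((\<Sum>\<eta>\<in>S. lam ^ H (2 * n) \<eta> * (\<Sum>\<eta>'\<in>S. rate lam (2 * n) \<eta> \<eta>' * (f \<eta>' - f \<eta>)\<^sup>2)) / Zp)"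
      by (simp add: sum_divide_distrib)
    finally show ?thesis using Zp by (simp add: row)
  qed
  finally show ?thesis by (simp add: q_def Zp_def S_def)
qed

lemma variance_upper_bound:
  assumes ne: "S_pinned a (2 * n) \<noteq> {}"
  shows "(\<Sum>\<zeta>\<in>S_pinned a (2 * n). lam ^ H (2 * n) \<zeta>) * var1 lam a (2 * n) f \<le>
     (\<Sum>\<eta>\<in>S_pinned a (2 * n). lam ^ H (2 * n) \<eta> * (f \<eta> - c)\<^sup>2)"
proof -
  define S where "S = S_pinned a (2 * n)"
  define w where "w \<eta> = lam ^ H (2 * n) \<eta>" for \<eta>
  define Zp where "Zp = (\<Sum>\<zeta>\<in>S. w \<zeta>)"
  define M where "M = (\<Sum>\<zeta>\<in>S. w \<zeta> * f \<zeta>) / Zp"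
  have fin: "finite S" by (simp add: S_def finite_pinned)
  have Zp: "0 < Zp" unfolding Zp_def w_def using fin ne lam0 by (intro sum_pos) (auto simp: S_def)
  have pi: "pi_pinned lam a (2 * n) \<eta> = w \<eta> / Zp" if "\<eta> \<in> S" for \<eta>
    using that by (simp add: pi_pinned_def S_def w_def Zp_def)
  have "(\<Sum>\<zeta>\<in>S. pi_pinned lam a (2 * n) \<zeta> * f \<zeta>) = M"
    unfolding M_def sum_divide_distrib by (intro sum.cong refl) (simp add: pi)
  then have "var1 lam a (2 * n) f = (\<Sum>\<eta>\<in>S. (w \<eta> * (f \<eta> - M)\<^sup>2) / Zp)"
    unfolding var1_def S_def[symmetric] by (intro sum.cong refl) (simp add: pi)
  then have v: "Zp * var1 lam a (2 * n) f = (\<Sum>\<eta>\<in>S. w \<eta> * (f \<eta> - M)\<^sup>2)"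
    using Zp by (simp add: sum_divide_distrib[symmetric])
  have "(\<Sum>\<eta>\<in>S. w \<eta> * (f \<eta> - M)) = (\<Sum>\<eta>\<in>S. w \<eta> * f \<eta>) - Zp * M"
    by (simp add: right_diff_distrib sum_subtractf sum_distrib_right Zp_def)
  also have "\<dots> = 0" using Zp by (simp add: M_def)
  finally have "(\<Sum>\<eta>\<in>S. w \<eta> * (f \<eta> - M)) = 0" .
  moreover have "(\<Sum>\<eta>\<in>S. w \<eta> * (f \<eta> - c)\<^sup>2) = (\<Sum>\<eta>\<in>S. w \<eta> * (f \<eta> - M)\<^sup>2 + 2 * (M - c) * (w \<eta> * (f \<eta> - M)) + (M - c)\<^sup>2 * w \<eta>)"
    by (intro sum.cong refl) (simp add: power2_eq_square algebra_simps)
  ultimately have "(\<Sum>\<eta>\<in>S. w \<eta> * (f \<eta> - c)\<^sup>2) = (\<Sum>\<eta>\<in>S. w \<eta> * (f \<eta> - M)\<^sup>2) + (M - c)\<^sup>2 * Zp"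
    by (simp add: sum.distrib sum_distrib_left[symmetric] Zp_def)
  then have "Zp * var1 lam a (2 * n) f \<le> (\<Sum>\<eta>\<in>S. w \<eta> * (f \<eta> - c)\<^sup>2)" using v Zp by simp
  then show ?thesis by (simp add: S_def w_def Zp_def)
qed

end

lemma polymer_locale:
  fixes a lam :: real
  assumes "0 < a" "0 < lam" "even N" "1 \<le> N"
  shows "polymer a lam (N div 2) (nat \<lceil>a * real N / 2\<rceil>)"
proof
  have N: "N = 2 * (N div 2)" using assms by simp
  then have N': "real N = 2 * real (N div 2)" by (metis of_nat_mult of_nat_numeral)
  have p: "0 < a * real N / 2" using assms by simp
  then have c: "1 \<le> \<lceil>a * real N / 2\<rceil>" by simp
  show "1 \<le> nat \<lceil>a * real N / 2\<rceil>" using c by linarith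
  have "a * real N / 2 \<le> real_of_int \<lceil>a * real N / 2\<rceil>" by (rule le_of_int_ceiling)
  then show "a * real (N div 2) \<le> real (nat \<lceil>a * real N / 2\<rceil>)" using c N' by simp
  show "even_ceil (a * real (2 * (N div 2))) = 2 * int (nat \<lceil>a * real N / 2\<rceil>)"
    unfolding N[symmetric] even_ceil_def using c by simp
  show "1 \<le> N div 2" using assms N by linarith
qed (use assms in auto)

theorem theorem4p4:
  fixes a lam :: real
  assumes "0 < a" and "a < 1/2" and "0 < lam"
  shows "\<exists>c > 0. \<forall>N::nat. even N \<and> 1 \<le> N \<and> S_pinned a N \<noteq> {} \<longrightarrow>
           gap1 lam a N \<ge> ereal (c * real N powr (-12))"
proof -
  define C1 where "C1 = ((1 / a) ^ 4)\<^sup>2 * (1 + 20 / lam)"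
  define C2 where "C2 = 3 * (1 + 4 / lam) * ((1 + lam) * 16 + 1)"
  define C3 where "C3 = 1 + 2 * (32 + 8 * C1 * C2) * (2 + lam)"
  define q where "q = min (1 / 2) (min (lam / (lam + 1)) (1 / (lam + 1)))"
  have q: "0 < q" using assms by (simp add: q_def)
  have "0 \<le> C1" "0 \<le> C2" using assms by (auto simp: C1_def C2_def)
  then have C3: "0 < C3" using assms unfolding C3_def by (intro add_pos_nonneg) auto
  have "gap1 lam a N \<ge> ereal (q / (2 * C3) * real N powr (-12))"
    if N: "even N" "1 \<le> N" "S_pinned a N \<noteq> {}" for N
  proof -
    interpret polymer a lam "N div 2" "nat \<lceil>a * real N / 2\<rceil>"
      by (rule polymer_locale) (use assms N in auto)
    have N2: "2 * (N div 2) = N" using N by simp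
    note bounds = pinned_poincare[unfolded N2 C1_def[symmetric] C2_def[symmetric] C3_def[symmetric]]
      dirichlet_lower_bound[unfolded N2 q_def[symmetric]] variance_upper_bound[unfolded N2, OF N(3)]
    define Zp where "Zp = (\<Sum>\<zeta>\<in>S_pinned a N. lam ^ H N \<zeta>)"
    have Zp: "0 < Zp" unfolding Zp_def using finite_pinned[unfolded N2] N(3) assms by (intro sum_pos) auto
    have Np: "real N powr (-12) = 1 / real N ^ 12"
      unfolding powr_minus_divide using N by (subst powr_numeral) auto
    show ?thesis unfolding gap1_def
    proof (rule Inf_greatest)
      fix y assume "y \<in> {ereal (dirichlet1 lam a N f / var1 lam a N f) |f. var1 lam a N f \<noteq> 0}"
      then obtain f where y: "y = ereal (dirichlet1 lam a N f / var1 lam a N f)" and v: "var1 lam a N f \<noteq> 0" by auto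
      obtain c where c: "(\<Sum>\<eta>\<in>S_pinned a N. lam ^ H N \<eta> * (f \<eta> - c)\<^sup>2) \<le> C3 * real N ^ 12 * energy f"
        using bounds(1) by blast
      have "0 \<le> var1 lam a N f" unfolding var1_def pi_pinned_def using assms
        by (intro sum_nonneg mult_nonneg_nonneg) (auto intro!: divide_nonneg_nonneg sum_nonneg)
      then have vp: "0 < var1 lam a N f" using v by simp
      have "q * (Zp * var1 lam a N f) \<le> q * (C3 * real N ^ 12 * energy f)"
        using bounds(3)[of f c] c q unfolding Zp_def by (intro mult_left_mono) auto
      also have "\<dots> = C3 * real N ^ 12 * (q * energy f)" by simp
      also have "\<dots> \<le> C3 * real N ^ 12 * (2 * Zp * dirichlet1 lam a N f)"
        using bounds(2)[of f] C3 unfolding Zp_def by (intro mult_left_mono) auto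
      finally have "Zp * (q * var1 lam a N f) \<le> Zp * (C3 * real N ^ 12 * 2 * dirichlet1 lam a N f)"
        by (simp only: mult_ac)
      then have "q * var1 lam a N f \<le> C3 * real N ^ 12 * 2 * dirichlet1 lam a N f" using Zp by simp
      then have "q / (2 * C3) * real N powr (-12) \<le> dirichlet1 lam a N f / var1 lam a N f"
        using C3 vp N unfolding Np by (simp add: field_simps)
      then show "ereal (q / (2 * C3) * real N powr (-12)) \<le> y" by (simp add: y)
    qed
  qed
  moreover have "0 < q / (2 * C3)" using q C3 by simp
  ultimately show ?thesis by blast
qed

end
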